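(* Let $p>1$, $C>0$, and let $(\mathcal{X},\mathcal{F},\{\mathcal{F}_n\}_{n\ge0},\mu)$ be any discrete-time filtered probability space. For all $(F,\mathbf{f},M)$ with $\mathbf{f}\ge0$, $\mathbf{f}^p\le F$, $0\le M\le C$, $$\mathcal{B}^{\mathcal{F}}_\mu(F,\mathbf{f},M;C)\le\mathcal{B}(F,\mathbf{f},M;C).$$ Moreover, if $\{\mathcal{F}_n\}_{n\ge0}$ is an infinitely refining filtration, then $\mathcal{B}^{\mathcal{F}}_\mu(F,\mathbf{f},M;C)=\mathcal{B}(F,\mathbf{f},M;C)$ for all such $(F,\mathbf{f},M)$.
   Context: Dyadic Bellman function: $\mathcal{D}$ is the standard dyadic lattice on $\mathbb{R}$, $\langle f\rangle_J=|J|^{-1}\int_J f$. For a fixed $I\in\mathcal{D}$ (the value does not depend on $I$), $\mathcal{B}(F,\mathbf{f},M;C)$ is the supremum of $|I|^{-1}\sum_{J\in\mathcal{D},J\subseteq I}\alpha_J\langle f\rangle_J^p$ over all non-negative $f\in L^p(I)$ and non-negative numbers $\{\alpha_J\}_{J\in\mathcal{D},J\subseteq I}$ such that $\langle f^p\rangle_I=F$, $\langle f\rangle_I=\mathbf{f}$, $|I|^{-1}\sum_{J\subseteq I}\alpha_J=M$, and $\sum_{J'\in\mathcal{D},J'\subseteq J}\alpha_{J'}\le C|J|$ for all dyadic $J\subseteq I$. Martingale Bellman function: on a filtered probability space with filtration $\{\emptyset,\mathcal{X}\}=\mathcal{F}_0\subseteq\mathcal{F}_1\subseteq\cdots\subseteq\mathcal{F}$,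 with $f_n=\mathbb{E}^\mu[f\mid\mathcal{F}_n]$, $\mathcal{B}^{\mathcal{F}}_\mu(F,\mathbf{f},M;C)$ is the supremum of $\mathbb{E}^\mu[\sum_{n\ge0}\alpha_nf_n^p]$ over all non-negative $f$ and all Carleson sequences $\{\alpha_n\}$ with constant $C$ such that $\mathbb{E}^\mu[f^p]=F$, $\mathbb{E}^\mu[f]=\mathbf{f}$, $\mathbb{E}^\mu[\sum_{n\ge0}\alpha_n]=M$. A Carleson sequence with constant $C$ is a sequence of non-negative random variables with $\alpha_n$ $\mathcal{F}_n$-measurable and $\mathbb{E}^\mu[\sum_{k\ge n}\alpha_k\mid\mathcal{F}_n]\le C$ for all $n\ge0$. The filtration is infinitely refining if for every $\varepsilon>0$, every $n\ge0$ and every $E\in\mathcal{F}_n$ there exist $k>n$ and a real-valued $\mathcal{F}_k$-measurable $h$ with $|h\mathbf{1}_E|=\mathbf{1}_E$ and $\int_E|\mathbb{E}^\mu[h\mid\mathcal{F}_n]|\,d\mu\le\varepsilon$. *)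

theory Defs
  imports "HOL-Probability.Probability"
begin

text \<open>The reference dyadic interval is I = [0,1). Dyadic subintervals of I are indexed by
  (j,k) with k < 2^j, namely [k/2^j, (k+1)/2^j). The descendants of (j,k) at level j+i
  are (j+i, k*2^i + m) with m < 2^i.\<close>

definition dyad :: "nat \<Rightarrow> nat \<Rightarrow> real set" where
  "dyad j k = {real k / 2 ^ j ..< (real k + 1) / 2 ^ j}"

definition avg :: "(real \<Rightarrow> real) \<Rightarrow> real set \<Rightarrow> real" where
  "avg f J = (LINT x:J|lborel. f x) / measure lborel J"

definition dyadic_admissible ::
  "real \<Rightarrow> real \<Rightarrow> real \<Rightarrow> real \<Rightarrow> real \<Rightarrow> (real \<Rightarrow> real) \<Rightarrow> (nat \<Rightarrow> nat \<Rightarrow> real) \<Rightarrow> bool" where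
  "dyadic_admissible p F ff M C f \<alpha> \<longleftrightarrow>
     f \<in> borel_measurable lborel \<and>
     (\<forall>x\<in>dyad 0 0. 0 \<le> f x) \<and>
     set_integrable lborel (dyad 0 0) (\<lambda>x. f x powr p) \<and>
     avg (\<lambda>x. f x powr p) (dyad 0 0) = F \<and>
     avg f (dyad 0 0) = ff \<and>
     (\<forall>j k. k < 2 ^ j \<longrightarrow> 0 \<le> \<alpha> j k) \<and>
     (\<Sum>j. \<Sum>k<2^j. ennreal (\<alpha> j k)) / ennreal (measure lborel (dyad 0 0)) = ennreal M \<and>
     (\<forall>j k. k < 2 ^ j \<longrightarrow>
        (\<Sum>i. \<Sum>m<2^i. ennreal (\<alpha> (j + i) (k * 2 ^ i + m)))
          \<le> ennreal (C * measure lborel (dyad j k)))"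

definition dyadic_bellman :: "real \<Rightarrow> real \<Rightarrow> real \<Rightarrow> real \<Rightarrow> real \<Rightarrow> ennreal" where
  "dyadic_bellman p F ff M C =
     Sup {(\<Sum>j. \<Sum>k<2^j. ennreal (\<alpha> j k * avg f (dyad j k) powr p))
            / ennreal (measure lborel (dyad 0 0))
          | f \<alpha>. dyadic_admissible p F ff M C f \<alpha>}"

definition filtered_prob_space :: "'a measure \<Rightarrow> (nat \<Rightarrow> 'a measure) \<Rightarrow> bool" where
  "filtered_prob_space \<mu> Fn \<longleftrightarrow>
     prob_space \<mu> \<and> filtration (space \<mu>) Fn \<and>
     sets (Fn 0) = {{}, space \<mu>} \<and> (\<forall>n. sets (Fn n) \<subseteq> sets \<mu>)"

definition carleson_seq :: "'a measure \<Rightarrow> (nat \<Rightarrow> 'a measure) \<Rightarrow> real \<Rightarrow> (nat \<Rightarrow> 'a \<Rightarrow> real) \<Rightarrow> bool" where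
  "carleson_seq \<mu> Fn C \<alpha> \<longleftrightarrow>
     (\<forall>n. \<alpha> n \<in> borel_measurable (Fn n)) \<and>
     (\<forall>n. \<forall>x\<in>space \<mu>. 0 \<le> \<alpha> n x) \<and>
     (\<forall>n. AE x in \<mu>. nn_cond_exp \<mu> (Fn n) (\<lambda>y. \<Sum>k. ennreal (\<alpha> (n + k) y)) x \<le> ennreal C)"

definition mart_admissible ::
  "'a measure \<Rightarrow> (nat \<Rightarrow> 'a measure) \<Rightarrow> real \<Rightarrow> real \<Rightarrow> real \<Rightarrow> real \<Rightarrow> real
     \<Rightarrow> ('a \<Rightarrow> real) \<Rightarrow> (nat \<Rightarrow> 'a \<Rightarrow> real) \<Rightarrow> bool" where
  "mart_admissible \<mu> Fn p F ff M C f \<alpha> \<longleftrightarrow>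
     f \<in> borel_measurable \<mu> \<and> (\<forall>x\<in>space \<mu>. 0 \<le> f x) \<and>
     integrable \<mu> f \<and> integrable \<mu> (\<lambda>x. f x powr p) \<and>
     (\<integral>x. f x powr p \<partial>\<mu>) = F \<and> (\<integral>x. f x \<partial>\<mu>) = ff \<and>
     carleson_seq \<mu> Fn C \<alpha> \<and>
     (\<integral>\<^sup>+ x. (\<Sum>n. ennreal (\<alpha> n x)) \<partial>\<mu>) = ennreal M"

definition mart_bellman ::
  "'a measure \<Rightarrow> (nat \<Rightarrow> 'a measure) \<Rightarrow> real \<Rightarrow> real \<Rightarrow> real \<Rightarrow> real \<Rightarrow> real \<Rightarrow> ennreal" where
  "mart_bellman \<mu> Fn p F ff M C =
     Sup {(\<integral>\<^sup>+ x. (\<Sum>n. ennreal (\<alpha> n x * real_cond_exp \<mu> (Fn n) f x powr p)) \<partial>\<mu>)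
          | f \<alpha>. mart_admissible \<mu> Fn p F ff M C f \<alpha>}"

definition infinitely_refining :: "'a measure \<Rightarrow> (nat \<Rightarrow> 'a measure) \<Rightarrow> bool" where
  "infinitely_refining \<mu> Fn \<longleftrightarrow>
     (\<forall>\<epsilon>>0. \<forall>n. \<forall>E\<in>sets (Fn n). \<exists>k>n. \<exists>h::'a \<Rightarrow> real.
        h \<in> borel_measurable (Fn k) \<and> integrable \<mu> h \<and>
        (\<forall>x\<in>space \<mu>. \<bar>h x * indicator E x\<bar> = indicator E x) \<and>
        (\<integral>x. \<bar>real_cond_exp \<mu> (Fn n) h x\<bar> * indicator E x \<partial>\<mu>) \<le> \<epsilon>)"

end

theory Submission
  imports Defs
begin

text \<open>
  The dyadic Bellman function \<open>B\<close> is midpoint concave (glue two dyadic configurations on the two halves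
  of the unit interval) and satisfies the jump inequality \<open>B(F, f, M + a) \<ge> B(F, f, M) + a f\<^sup>p\<close> (add
  \<open>a\<close> to the coefficient of the top interval). Being nonnegative, it is then concave along segments with
  arbitrary real weights, without any finiteness or continuity. For a martingale, replace the \<open>\<alpha>\<^sub>n\<close> and the
  conditional expectations of \<open>f\<close> by simple functions from below; backward induction over the level, with
  Jensen's inequality over the finitely many level sets and the jump inequality on each, bounds the
  martingale sum by \<open>B\<close>.

  Conversely, infinite refinement applied to the whole space yields signs \<open>h\<^sub>1, h\<^sub>2, \<dots>\<close> at
  levels \<open>\<nu>\<^sub>1 < \<nu>\<^sub>2 < \<dots>\<close> whose conditional means given the previous level are small in \<open>L\<^sup>1\<close>. Reading them as
  binary digits transports a dyadic configuration of finite depth to the probability space with small \<open>L\<^sup>1\<close>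
  errors. The Carleson condition is restored by stopping, the total mass by adding the deficit at
  level \<open>0\<close> (which only affects the condition \<open>M \<le> C\<close>), and the two moments of \<open>f\<close> by the intermediate
  value theorem.
\<close>

section \<open>Convexity of powers\<close>

text \<open>In the converse direction every transported quantity is only approximately right, so
  each constraint needs slack before it can be repaired. Scaling function and coefficients by
  \<open>\<theta> = 1 - \<delta>\<close> creates it: conditional tails may rise to
  \<open>C / \<theta>\<close>, and mean and mass of order \<open>\<delta>\<close> become free. The
  p-th moment takes its slack from \<open>ff powr p < F\<close>. The repairs keep only lower bounds
  on the function and on the coefficients that survive stopping, which suffices because the value
  increases in both. The depth \<open>N\<close> and the bound \<open>K\<close> are fixed first, then
  \<open>\<delta>\<close> and \<open>e\<close>, and the tolerance \<open>\<epsilon>\<close> last, so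
  constants depending on \<open>N\<close> and \<open>K\<close> do no harm. On the boundary
  \<open>ff = 0\<close>, \<open>F = ff powr p\<close> or \<open>M = 0\<close> some slack is missing;
  there the dyadic value can be computed directly. Truncation to depth \<open>N\<close> replaces the
  function by averages, which can only lower the p-th moment; hence that moment has to be raised
  back to \<open>F\<close>, and never lowered.\<close>

lemma powr_above_tangent:
  fixes p x m :: real
  assumes "p > 1" "x \<ge> 0" "m \<ge> 0"
  shows "m powr p + p * m powr (p - 1) * (x - m) \<le> x powr p"
\<comment> \<open>The derivative argument lives on the open half-line, so a point at 0 is checked by
  hand.\<close>
proof (cases "m = 0 \<or> x = 0")
  case True
  moreover have "m powr (p - 1) * m = m powr p"
    using assms by (cases "m = 0") (simp_all add: powr_diff)
  ultimately show ?thesis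
    using assms mult_right_mono[of 1 p "m powr p"] by (auto simp: mult.assoc)
next
  case False
  then have pos: "m > 0" "x > 0" using assms by auto
  have "x powr p - m powr p \<ge> (p * m powr (p - 1)) * (x - m)"
  proof (rule convex_on_imp_above_tangent[where A = "{0<..}"])
    show "convex_on {0<..} (\<lambda>x. x powr p)" using powr_convex assms by simp
    show "((\<lambda>x. x powr p) has_real_derivative p * m powr (p - 1)) (at m within {0<..})"
      using pos by (auto intro!: derivative_eq_intros)
    show "m \<in> interior {0<..}" using pos by (simp add: interior_open)
  qed (use pos in \<open>auto simp: is_interval_connected\<close>)
  then show ?thesis by simp
qed

text \<open>Average the two tangent inequalities at the mean \<open>m\<close>; the first-order terms
  cancel.\<close>

lemma powr_convex_combination:
  fixes p x y s :: real
  assumes "p > 1" "x \<ge> 0" "y \<ge> 0" "0 \<le> s" "s \<le> 1"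
  shows "((1 - s) * x + s * y) powr p \<le> (1 - s) * x powr p + s * y powr p"
proof -
  define m where "m = (1 - s) * x + s * y"
  have m: "m \<ge> 0" using assms by (simp add: m_def)
  define d where "d = p * m powr (p - 1)"
  have "(1 - s) * (m powr p + d * (x - m)) + s * (m powr p + d * (y - m)) \<le> (1 - s) * x powr p + s * y powr p"
    unfolding d_def using assms m by (intro add_mono mult_left_mono powr_above_tangent) auto
  moreover have "(1 - s) * (m powr p + d * (x - m)) + s * (m powr p + d * (y - m)) = m powr p"
    by (simp add: m_def algebra_simps)
  ultimately show ?thesis by (simp add: m_def)
qed

text \<open>The tangent at \<open>u\<close> bounds \<open>u powr p - v powr p\<close>, and its slope
  is at most the slope at \<open>K\<close>. Exchanging the two points gives the absolute
  value.\<close>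

lemma abs_powr_diff_le:
  fixes p x y K :: real
  assumes "p > 1" "0 \<le> x" "x \<le> K" "0 \<le> y" "y \<le> K"
  shows "\<bar>x powr p - y powr p\<bar> \<le> p * K powr (p - 1) * \<bar>x - y\<bar>"
proof -
  have *: "u powr p - v powr p \<le> p * K powr (p - 1) * \<bar>u - v\<bar>" if "0 \<le> u" "u \<le> K" "0 \<le> v" for u v
  proof -
    have "u powr p - v powr p \<le> p * u powr (p - 1) * (u - v)"
      using powr_above_tangent[OF assms(1) that(3) that(1)] by (simp add: algebra_simps)
    also have "\<dots> \<le> p * u powr (p - 1) * \<bar>u - v\<bar>"
      using assms by (intro mult_left_mono) auto
    also have "\<dots> \<le> p * K powr (p - 1) * \<bar>u - v\<bar>"
      using assms that by (intro mult_right_mono mult_left_mono powr_mono2) auto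
    finally show ?thesis .
  qed
  show ?thesis
    using *[of x y] *[of y x] assms by (auto simp: abs_le_iff abs_minus_commute)
qed

text \<open>Jensen's inequality, by integrating the tangent inequality at the mean of
  \<open>f\<close> over \<open>S\<close>. In this unnormalised form a null set \<open>S\<close> is
  harmless, as the quotient is then 0.\<close>

lemma set_integral_powr_ge:
  fixes f :: "'a \<Rightarrow> real"
  assumes "p > 1" "S \<in> sets M" "emeasure M S < \<infinity>" "\<And>x. x \<in> S \<Longrightarrow> 0 \<le> f x"
    and int: "set_integrable M S f" "set_integrable M S (\<lambda>x. f x powr p)"
  shows "measure M S * ((LINT x:S|M. f x) / measure M S) powr p \<le> (LINT x:S|M. f x powr p)"
proof -
  define w where "w = measure M S"
  define m where "m = (LINT x:S|M. f x) / w"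
  define d where "d = p * m powr (p - 1)"
  have "(LINT x:S|M. f x) \<ge> 0"
    unfolding set_lebesgue_integral_def using assms(4)
    by (intro integral_nonneg_AE) (auto simp: indicator_def)
  then have m: "m \<ge> 0" by (simp add: m_def w_def)
  have c: "set_integrable M S (\<lambda>x. c)" for c :: real
    using assms(2,3) by (auto simp: set_integrable_def)
  have i: "set_integrable M S (\<lambda>x. d * f x)" using int by simp
  have "(LINT x:S|M. (m powr p - d * m) + d * f x) \<le> (LINT x:S|M. f x powr p)"
  proof (rule set_integral_mono)
    show "set_integrable M S (\<lambda>x. (m powr p - d * m) + d * f x)"
      by (rule set_integral_add(1)[OF c i])
    show "m powr p - d * m + d * f x \<le> f x powr p" if "x \<in> S" for x
      using powr_above_tangent[OF assms(1) assms(4)[OF that] m] by (simp add: d_def algebra_simps)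
  qed (rule int)
  also have "(LINT x:S|M. (m powr p - d * m) + d * f x) = (m powr p - d * m) * w + d * (LINT x:S|M. f x)"
    using assms(2,3) by (subst set_integral_add(2)[OF c i]) (simp add: set_integral_mult_right w_def set_integral_const)
  also have "\<dots> = w * m powr p"
  proof (cases "w = 0")
    case True
    then show ?thesis by (simp add: m_def d_def)
  next
    case False
    then have "(LINT x:S|M. f x) = w * m" by (simp add: m_def)
    then show ?thesis by (simp add: algebra_simps)
  qed
  finally show ?thesis by (simp add: m_def w_def)
qed

section \<open>Dyadic intervals and integrability of admissible functions\<close>

lemma emeasure_dyad: "emeasure lborel (dyad j k) = ennreal (1 / 2 ^ j)"
  by (simp add: dyad_def diff_divide_distrib[symmetric] divide_right_mono)

lemma measure_dyad [simp]: "measure lborel (dyad j k) = 1 / 2 ^ j"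
  by (simp add: measure_def emeasure_dyad)

lemma sets_dyad [measurable, simp]: "dyad j k \<in> sets borel"
  by (simp add: dyad_def)

lemma dyad_subset: "k < 2 ^ j \<Longrightarrow> dyad j k \<subseteq> dyad 0 0"
proof -
  assume "k < 2 ^ j"
  then have "real (k + 1) \<le> real (2 ^ j)" by (simp only: of_nat_le_iff)
  then have "(real k + 1) / 2 ^ j \<le> 1" by (simp add: field_simps)
  moreover have "0 \<le> real k / 2 ^ j" by simp
  ultimately show ?thesis unfolding dyad_def by (auto intro: order_trans less_le_trans)
qed

text \<open>Admissibility records integrability of the p-th power only; \<open>f\<close> itself
  follows from \<open>x \<le> 1 + x powr p\<close> on a set of finite measure.\<close>

lemma dyadic_admissible_integrable:
  assumes "dyadic_admissible p F ff M C f \<alpha>" "p > 1" "k < 2 ^ j"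
  shows "set_integrable lborel (dyad j k) f" "set_integrable lborel (dyad j k) (\<lambda>x. f x powr p)"
proof -
  note a = assms(1)[unfolded dyadic_admissible_def]
  have [measurable]: "f \<in> borel_measurable borel" using a by simp
  have le: "x \<le> 1 + x powr p" if "x \<ge> 0" for x :: real
  proof (cases "x \<le> 1")
    case False
    then have "x powr 1 \<le> x powr p" using assms by (intro powr_mono) auto
    then show ?thesis using False by simp
  qed (simp add: add_increasing2)
  have "set_integrable lborel (dyad 0 0) (\<lambda>x. 1 + f x powr p)"
    using a by (intro set_integral_add) (auto simp: set_integrable_def emeasure_dyad)
  then have "set_integrable lborel (dyad 0 0) f"
    unfolding set_integrable_def
    by (rule Bochner_Integration.integrable_bound) (use le a in \<open>auto simp: indicator_def\<close>)
  then show "set_integrable lborel (dyad j k) f"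
    by (rule set_integrable_subset) (use dyad_subset assms(3) in auto)
  show "set_integrable lborel (dyad j k) (\<lambda>x. f x powr p)"
    by (rule set_integrable_subset[of _ "dyad 0 0"]) (use a dyad_subset assms(3) in auto)
qed

section \<open>The dyadic Bellman function\<close>

lemma ennreal_divide_one [simp]: "(x :: ennreal) / 1 = x"
  by (simp add: divide_ennreal_def)

definition dyadic_value :: "real \<Rightarrow> (real \<Rightarrow> real) \<Rightarrow> (nat \<Rightarrow> nat \<Rightarrow> real) \<Rightarrow> ennreal" where
  "dyadic_value p f \<alpha> = (\<Sum>j. \<Sum>k<2^j. ennreal (\<alpha> j k * avg f (dyad j k) powr p))"

lemma dyadic_bellman_eq:
  "dyadic_bellman p F ff M C = (SUP (f, \<alpha>)\<in>{(f, \<alpha>). dyadic_admissible p F ff M C f \<alpha>}. dyadic_value p f \<alpha>)"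
  unfolding dyadic_bellman_def dyadic_value_def by (rule arg_cong[where f = Sup]) (auto simp: image_iff)

lemma dyadic_value_le_bellman:
  "dyadic_admissible p F ff M C f \<alpha> \<Longrightarrow> dyadic_value p f \<alpha> \<le> dyadic_bellman p F ff M C"
  unfolding dyadic_bellman_eq by (rule SUP_upper2[where i = "(f, \<alpha>)"]) auto

lemma avg_nonneg:
  assumes "\<And>x. x \<in> J \<Longrightarrow> 0 \<le> f x"
  shows "0 \<le> avg f J"
  unfolding avg_def set_lebesgue_integral_def using assms
  by (intro divide_nonneg_nonneg integral_nonneg_AE) (auto simp: indicator_def)

lemma suminf_ennreal_split_head:
  fixes u :: "nat \<Rightarrow> ennreal"
  shows "(\<Sum>j. u j) = u 0 + (\<Sum>j. u (Suc j))"
  using suminf_offset[of u 1] by (simp add: summableI)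

lemma sum_lessThan_double:
  fixes g :: "nat \<Rightarrow> 'a :: comm_monoid_add"
  shows "(\<Sum>k<2 ^ Suc i. g k) = (\<Sum>k<2 ^ i. g k) + (\<Sum>k<2 ^ i. g (2 ^ i + k))"
  using sum.atLeastLessThan_concat[of 0 "2 ^ i" "2 ^ i + 2 ^ i" g, symmetric]
    sum.shift_bounds_nat_ivl[of g 0 "2 ^ i" "2 ^ i"]
  by (simp add: mult_2 lessThan_atLeast0 add.commute)

text \<open>The top coefficient enters a single Carleson condition, that of the top interval. This
  condition bounds the total mass, so it becomes \<open>M + a \<le> C\<close>.\<close>

lemma dyadic_admissible_jump:
  assumes adm: "dyadic_admissible p F ff M C f \<alpha>" and "0 \<le> a" "0 \<le> M" "M + a \<le> C"
  shows "dyadic_bellman p F ff (M + a) C \<ge> dyadic_value p f \<alpha> + ennreal (a * ff powr p)"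
proof -
  define \<beta> where "\<beta> = (\<lambda>j k. \<alpha> j k + (if j = 0 then a else 0))"
  note A = adm[unfolded dyadic_admissible_def]
  have tot: "(\<Sum>j. \<Sum>k<2^j. ennreal (\<alpha> j k)) = ennreal M" using A by simp
  have tot': "(\<Sum>j. \<Sum>k<2^j. ennreal (\<beta> j k)) = ennreal (M + a)"
  proof -
    have "(\<Sum>j. \<Sum>k<2^j. ennreal (\<beta> j k)) = ennreal (\<beta> 0 0) + (\<Sum>j. \<Sum>k<2^Suc j. ennreal (\<alpha> (Suc j) k))"
      by (subst suminf_ennreal_split_head) (simp add: \<beta>_def)
    also have "\<dots> = ennreal a + (ennreal (\<alpha> 0 0) + (\<Sum>j. \<Sum>k<2^Suc j. ennreal (\<alpha> (Suc j) k)))"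
      using A assms(2) by (simp add: \<beta>_def add_ac)
    also have "ennreal (\<alpha> 0 0) + (\<Sum>j. \<Sum>k<2^Suc j. ennreal (\<alpha> (Suc j) k)) = ennreal M"
      unfolding tot[symmetric] by (subst (2) suminf_ennreal_split_head) simp
    finally show ?thesis using assms by (simp add: add.commute)
  qed
  have "dyadic_admissible p F ff (M + a) C f \<beta>"
    unfolding dyadic_admissible_def
  proof (intro conjI allI impI)
    fix j k :: nat assume k: "k < 2 ^ j"
    show "0 \<le> \<beta> j k" using A k assms by (simp add: \<beta>_def)
    show "(\<Sum>i. \<Sum>m<2 ^ i. ennreal (\<beta> (j + i) (k * 2 ^ i + m))) \<le> ennreal (C * measure lborel (dyad j k))"
    proof (cases "j = 0")
      case True
      then show ?thesis using k tot' assms ennreal_leI[of "M + a" C] by (simp del: ennreal_plus)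
    next
      case False
      then show ?thesis using A k by (simp add: \<beta>_def)
    qed
  qed (use A tot' in auto)
  then have "dyadic_value p f \<beta> \<le> dyadic_bellman p F ff (M + a) C"
    by (rule dyadic_value_le_bellman)
  moreover have "dyadic_value p f \<beta> = dyadic_value p f \<alpha> + ennreal (a * ff powr p)"
  proof -
    have "avg f (dyad 0 0) = ff" using A by simp
    moreover have "0 \<le> \<alpha> 0 0" using A by simp
    ultimately show ?thesis
      unfolding dyadic_value_def using assms
      by (subst (1 2) suminf_ennreal_split_head) (simp add: \<beta>_def add_ac distrib_right)
  qed
  ultimately show ?thesis by simp
qed

text \<open>An admissible pair is required because the constant is moved inside the supremum, which
  over the empty set would be 0.\<close>

lemma bellman_jump:
  assumes "\<exists>f \<alpha>. dyadic_admissible p F ff M C f \<alpha>" and "0 \<le> a" "0 \<le> M" "M + a \<le> C"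
  shows "dyadic_bellman p F ff M C + ennreal (a * ff powr p) \<le> dyadic_bellman p F ff (M + a) C"
  unfolding dyadic_bellman_eq[of _ _ _ M]
  using assms dyadic_admissible_jump
  by (subst ennreal_SUP_add_left[symmetric]) (auto intro!: SUP_least)

section \<open>Gluing two configurations on the halves of the unit interval\<close>

lemma set_integral_half:
  fixes f g :: "real \<Rightarrow> real"
  assumes "\<And>y. (y + s) / 2 \<in> B \<longleftrightarrow> y \<in> A" "\<And>y. y \<in> A \<Longrightarrow> f ((y + s) / 2) = g y"
  shows "(LINT x:B|lborel. f x) = (LINT x:A|lborel. g x) / 2"
    "set_integrable lborel A g \<Longrightarrow> set_integrable lborel B f"
proof -
  have *: "indicator B (s / 2 + (1 / 2) * y) *\<^sub>R f (s / 2 + (1 / 2) * y) = indicator A y *\<^sub>R g y" for y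
  proof -
    have "s / 2 + (1 / 2) * y = (y + s) / 2" by (simp add: field_simps)
    then show ?thesis using assms[of y] by (cases "y \<in> A") (simp_all only: indicator_simps, simp_all)
  qed
  show "(LINT x:B|lborel. f x) = (LINT x:A|lborel. g x) / 2"
    unfolding set_lebesgue_integral_def
    by (subst lborel_integral_real_affine[where c = "1/2" and t = "s/2"]) (simp_all only: *, simp_all)
  show "set_integrable lborel B f" if "set_integrable lborel A g"
    using that lborel_integrable_real_affine_iff[of "1/2" "\<lambda>x. indicator B x *\<^sub>R f x" "s/2"]
    unfolding set_integrable_def by (simp only: *)
qed

definition glue :: "(real \<Rightarrow> real) \<Rightarrow> (real \<Rightarrow> real) \<Rightarrow> real \<Rightarrow> real" where
  "glue f1 f2 x = (if x < 1 / 2 then f1 (2 * x) else f2 (2 * x - 1))"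

text \<open>Coefficients are halved because the intervals carrying them are: ratios of mass to
  length, and with them the constant \<open>C\<close>, stay the same. The top interval receives
  nothing.\<close>

definition glue_seq :: "(nat \<Rightarrow> nat \<Rightarrow> real) \<Rightarrow> (nat \<Rightarrow> nat \<Rightarrow> real) \<Rightarrow> nat \<Rightarrow> nat \<Rightarrow> real" where
  "glue_seq \<alpha>1 \<alpha>2 j k =
     (case j of 0 \<Rightarrow> 0 | Suc i \<Rightarrow> (if k < 2 ^ i then \<alpha>1 i k / 2 else \<alpha>2 i (k - 2 ^ i) / 2))"

lemma mem_dyad_Suc_left: "(y + 0) / 2 \<in> dyad (Suc j) k \<longleftrightarrow> y \<in> dyad j k"
  by (auto simp: dyad_def field_simps)

lemma mem_dyad_Suc_right: "(y + 1) / 2 \<in> dyad (Suc j) (2 ^ j + k) \<longleftrightarrow> y \<in> dyad j k"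
  by (auto simp: dyad_def field_simps)

lemma mem_dyad_bounds: "y \<in> dyad j k \<Longrightarrow> k < 2 ^ j \<Longrightarrow> 0 \<le> y \<and> y < 1"
  using dyad_subset[of k j] by (auto simp: dyad_def[of 0])

lemma glue_half:
  "y < 1 \<Longrightarrow> glue f1 f2 ((y + 0) / 2) = f1 y" "0 \<le> y \<Longrightarrow> glue f1 f2 ((y + 1) / 2) = f2 y"
  by (simp_all add: glue_def add_divide_distrib)

text \<open>The Jacobian of \<open>y \<mapsto> (y + s) / 2\<close> cancels against the halved
  length. The function \<open>\<phi>\<close> is left free to serve both \<open>f\<close> and its
  p-th power.\<close>

lemma avg_glue:
  assumes "k < 2 ^ j"
  shows "avg (\<lambda>x. \<phi> (glue f1 f2 x)) (dyad (Suc j) k) = avg (\<lambda>x. \<phi> (f1 x)) (dyad j k)"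
    "avg (\<lambda>x. \<phi> (glue f1 f2 x)) (dyad (Suc j) (2 ^ j + k)) = avg (\<lambda>x. \<phi> (f2 x)) (dyad j k)"
proof -
  have "(LINT x:dyad (Suc j) k|lborel. \<phi> (glue f1 f2 x)) = (LINT x:dyad j k|lborel. \<phi> (f1 x)) / 2"
    by (rule set_integral_half(1)[OF mem_dyad_Suc_left]) (metis mem_dyad_bounds assms glue_half(1))
  then show "avg (\<lambda>x. \<phi> (glue f1 f2 x)) (dyad (Suc j) k) = avg (\<lambda>x. \<phi> (f1 x)) (dyad j k)"
    by (simp add: avg_def)
  have "(LINT x:dyad (Suc j) (2 ^ j + k)|lborel. \<phi> (glue f1 f2 x)) = (LINT x:dyad j k|lborel. \<phi> (f2 x)) / 2"
    by (rule set_integral_half(1)[OF mem_dyad_Suc_right]) (metis mem_dyad_bounds assms glue_half(2))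
  then show "avg (\<lambda>x. \<phi> (glue f1 f2 x)) (dyad (Suc j) (2 ^ j + k)) = avg (\<lambda>x. \<phi> (f2 x)) (dyad j k)"
    by (simp add: avg_def)
qed

lemma glue_top:
  assumes "set_integrable lborel (dyad 0 0) (\<lambda>x. \<phi> (f1 x))" "set_integrable lborel (dyad 0 0) (\<lambda>x. \<phi> (f2 x))"
  shows "set_integrable lborel (dyad 0 0) (\<lambda>x. \<phi> (glue f1 f2 x))"
    "avg (\<lambda>x. \<phi> (glue f1 f2 x)) (dyad 0 0) = (avg (\<lambda>x. \<phi> (f1 x)) (dyad 0 0) + avg (\<lambda>x. \<phi> (f2 x)) (dyad 0 0)) / 2"
proof -
  have un: "dyad 0 0 = dyad 1 0 \<union> dyad 1 1" by (auto simp: dyad_def)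
  have dis: "dyad 1 0 \<inter> dyad 1 1 = {}" by (auto simp: dyad_def)
  have i1: "set_integrable lborel (dyad 1 0) (\<lambda>x. \<phi> (glue f1 f2 x))"
    using mem_dyad_bounds[of _ 0 0] mem_dyad_Suc_left[of _ 0 0]
    by (intro set_integral_half(2)[OF _ _ assms(1), where s = 0]) (simp_all add: glue_half(1)[simplified])
  have i2: "set_integrable lborel (dyad 1 1) (\<lambda>x. \<phi> (glue f1 f2 x))"
    using mem_dyad_bounds[of _ 0 0] mem_dyad_Suc_right[of _ 0 0]
    by (intro set_integral_half(2)[OF _ _ assms(2), where s = 1]) (simp_all add: glue_half)
  show "set_integrable lborel (dyad 0 0) (\<lambda>x. \<phi> (glue f1 f2 x))"
    unfolding un by (rule set_integrable_Un[OF i1 i2]) auto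
  show "avg (\<lambda>x. \<phi> (glue f1 f2 x)) (dyad 0 0) = (avg (\<lambda>x. \<phi> (f1 x)) (dyad 0 0) + avg (\<lambda>x. \<phi> (f2 x)) (dyad 0 0)) / 2"
    using avg_glue[of 0 0 \<phi> f1 f2] set_integral_Un[OF dis i1 i2]
    unfolding un[symmetric] by (simp add: avg_def)
qed

text \<open>The weights are abstract since the identity is used twice: with the coefficients, for
  the total mass, and with coefficients times powers of averages, for the value.\<close>

lemma sum_glue_seq:
  fixes w w1 w2 :: "nat \<Rightarrow> nat \<Rightarrow> real"
  assumes "\<And>j k. k < 2 ^ j \<Longrightarrow> w (Suc j) k = w1 j k / 2"
    and "\<And>j k. k < 2 ^ j \<Longrightarrow> w (Suc j) (2 ^ j + k) = w2 j k / 2" and "w 0 0 = 0"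
    and "\<And>j k. k < 2 ^ j \<Longrightarrow> 0 \<le> w1 j k" "\<And>j k. k < 2 ^ j \<Longrightarrow> 0 \<le> w2 j k"
  shows "(\<Sum>j. \<Sum>k<2^j. ennreal (w j k)) =
    ennreal (1/2) * (\<Sum>j. \<Sum>k<2^j. ennreal (w1 j k)) + ennreal (1/2) * (\<Sum>j. \<Sum>k<2^j. ennreal (w2 j k))"
proof -
  have h: "ennreal (x / 2) = ennreal (1/2) * ennreal x" if "x \<ge> 0" for x
    using that by (subst ennreal_mult[symmetric]) auto
  have "(\<Sum>j. \<Sum>k<2^j. ennreal (w j k)) = (\<Sum>j. \<Sum>k<2^Suc j. ennreal (w (Suc j) k))"
    by (subst suminf_ennreal_split_head) (use assms(3) in simp)
  also have "\<dots> = (\<Sum>j. (\<Sum>k<2^j. ennreal (w1 j k / 2)) + (\<Sum>k<2^j. ennreal (w2 j k / 2)))"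
    unfolding sum_lessThan_double
    by (intro suminf_cong arg_cong2[where f = "(+)"] sum.cong refl) (simp_all only: assms(1,2) lessThan_iff)
  also have "\<dots> = (\<Sum>j. ennreal (1/2) * (\<Sum>k<2^j. ennreal (w1 j k)) + ennreal (1/2) * (\<Sum>k<2^j. ennreal (w2 j k)))"
    unfolding sum_distrib_left using assms(4,5)
    by (intro suminf_cong arg_cong2[where f = "(+)"] sum.cong refl h) auto
  also have "\<dots> = ennreal (1/2) * (\<Sum>j. \<Sum>k<2^j. ennreal (w1 j k)) + ennreal (1/2) * (\<Sum>j. \<Sum>k<2^j. ennreal (w2 j k))"
    by (simp only: suminf_add[OF summableI summableI, symmetric] ennreal_suminf_cmult)
  finally show ?thesis .
qed

lemma glue_seq_simps:
  "k < 2 ^ j \<Longrightarrow> glue_seq \<alpha>1 \<alpha>2 (Suc j) k = \<alpha>1 j k / 2"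
  "glue_seq \<alpha>1 \<alpha>2 (Suc j) (2 ^ j + k) = \<alpha>2 j k / 2"
  "glue_seq \<alpha>1 \<alpha>2 0 k = 0"
  by (simp_all add: glue_seq_def)

lemma descendant_less:
  fixes k m :: nat
  assumes "k < 2 ^ j" "m < 2 ^ i"
  shows "k * 2 ^ i + m < 2 ^ (j + i)"
proof -
  have "k * 2 ^ i + m < (k + 1) * 2 ^ i" using assms by simp
  also have "\<dots> \<le> 2 ^ j * 2 ^ i" using assms by (intro mult_right_mono) auto
  finally show ?thesis by (simp add: power_add)
qed

lemma glue_admissible:
  assumes "dyadic_admissible p F1 ff1 M1 C f1 \<alpha>1" "dyadic_admissible p F2 ff2 M2 C f2 \<alpha>2"
    and "p > 1" "0 \<le> M1" "M1 \<le> C" "0 \<le> M2" "M2 \<le> C"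
  shows "dyadic_admissible p ((F1 + F2) / 2) ((ff1 + ff2) / 2) ((M1 + M2) / 2) C (glue f1 f2) (glue_seq \<alpha>1 \<alpha>2)"
    "dyadic_value p (glue f1 f2) (glue_seq \<alpha>1 \<alpha>2) =
      ennreal (1/2) * dyadic_value p f1 \<alpha>1 + ennreal (1/2) * dyadic_value p f2 \<alpha>2"
proof -
  note A1 = assms(1)[unfolded dyadic_admissible_def] and A2 = assms(2)[unfolded dyadic_admissible_def]
  have [measurable]: "f1 \<in> borel_measurable borel" "f2 \<in> borel_measurable borel" using A1 A2 by auto
  note I1 = dyadic_admissible_integrable[OF assms(1) assms(3), of 0 0, simplified]
  note I2 = dyadic_admissible_integrable[OF assms(2) assms(3), of 0 0, simplified]
  have h: "ennreal (x / 2) = ennreal (1/2) * ennreal x" if "x \<ge> 0" for x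
    using that by (subst ennreal_mult[symmetric]) auto
  have tot: "(\<Sum>j. \<Sum>k<2^j. ennreal (glue_seq \<alpha>1 \<alpha>2 j k)) = ennreal ((M1 + M2) / 2)"
  proof -
    have "(\<Sum>j. \<Sum>k<2^j. ennreal (glue_seq \<alpha>1 \<alpha>2 j k)) = ennreal (1/2) * ennreal M1 + ennreal (1/2) * ennreal M2"
      using A1 A2 by (subst sum_glue_seq[where ?w1.0 = \<alpha>1 and ?w2.0 = \<alpha>2]) (auto simp: glue_seq_simps)
    also have "\<dots> = ennreal (M1 / 2) + ennreal (M2 / 2)"
      using h[OF assms(4)] h[OF assms(6)] by (simp only:)
    also have "\<dots> = ennreal ((M1 + M2) / 2)"
      using assms by (simp add: add_divide_distrib)
    finally show ?thesis .
  qed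
  show "dyadic_admissible p ((F1 + F2) / 2) ((ff1 + ff2) / 2) ((M1 + M2) / 2) C (glue f1 f2) (glue_seq \<alpha>1 \<alpha>2)"
    unfolding dyadic_admissible_def
  proof (intro conjI allI impI ballI)
    show "glue f1 f2 \<in> borel_measurable lborel" unfolding glue_def by measurable
    show "0 \<le> glue f1 f2 x" if "x \<in> dyad 0 0" for x
      using that A1 A2 by (auto simp: glue_def dyad_def)
    show "set_integrable lborel (dyad 0 0) (\<lambda>x. glue f1 f2 x powr p)"
      by (rule glue_top(1)[of "\<lambda>x. x powr p"]) (use I1 I2 in auto)
    show "avg (\<lambda>x. glue f1 f2 x powr p) (dyad 0 0) = (F1 + F2) / 2"
      by (subst glue_top(2)[of "\<lambda>x. x powr p"]) (use I1 I2 A1 A2 in auto)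
    show "avg (glue f1 f2) (dyad 0 0) = (ff1 + ff2) / 2"
      using glue_top(2)[of "\<lambda>x. x" f1 f2] I1 I2 A1 A2 by auto
    show "(\<Sum>j. \<Sum>k<2 ^ j. ennreal (glue_seq \<alpha>1 \<alpha>2 j k)) / ennreal (measure lborel (dyad 0 0)) = ennreal ((M1 + M2) / 2)"
      using tot by simp
    fix j k :: nat assume k: "k < 2 ^ j"
    show "0 \<le> glue_seq \<alpha>1 \<alpha>2 j k" using k A1 A2 by (auto simp: glue_seq_def split: nat.splits)
    show "(\<Sum>i. \<Sum>m<2 ^ i. ennreal (glue_seq \<alpha>1 \<alpha>2 (j + i) (k * 2 ^ i + m))) \<le> ennreal (C * measure lborel (dyad j k))"
    proof (cases j)
      case 0
      then show ?thesis using k tot assms by (simp add: ennreal_leI)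
    next
      case (Suc j')
      \<comment> \<open>Below the top level an interval \<open>(j, k)\<close> is the half-size copy
        of some \<open>(j', l)\<close> in one of the two configurations; tail and length are halved
        together.\<close>
      have half: "(\<Sum>i. \<Sum>m<2 ^ i. ennreal (glue_seq \<alpha>1 \<alpha>2 (j + i) (k * 2 ^ i + m))) \<le> ennreal (C * measure lborel (dyad j k))"
        if eq: "\<And>i m. m < 2 ^ i \<Longrightarrow> glue_seq \<alpha>1 \<alpha>2 (j + i) (k * 2 ^ i + m) = \<gamma> (j' + i) (l * 2 ^ i + m) / 2"
          and nn: "\<And>j k. k < 2 ^ j \<Longrightarrow> 0 \<le> \<gamma> j k" and l: "l < 2 ^ j'"
          and car: "(\<Sum>i. \<Sum>m<2^i. ennreal (\<gamma> (j' + i) (l * 2 ^ i + m))) \<le> ennreal (C * measure lborel (dyad j' l))"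
        for \<gamma> l
      proof -
        have "(\<Sum>i. \<Sum>m<2 ^ i. ennreal (glue_seq \<alpha>1 \<alpha>2 (j + i) (k * 2 ^ i + m)))
          = (\<Sum>i. \<Sum>m<2 ^ i. ennreal (1/2) * ennreal (\<gamma> (j' + i) (l * 2 ^ i + m)))"
          using nn descendant_less[OF l]
          by (intro suminf_cong sum.cong refl) (subst eq, simp, rule h, simp)
        also have "\<dots> = ennreal (1/2) * (\<Sum>i. \<Sum>m<2 ^ i. ennreal (\<gamma> (j' + i) (l * 2 ^ i + m)))"
          by (simp only: sum_distrib_left[symmetric] ennreal_suminf_cmult)
        also have "\<dots> \<le> ennreal (1/2) * ennreal (C * measure lborel (dyad j' l))"
          using car by (intro mult_left_mono) auto
        also have "\<dots> = ennreal (C * measure lborel (dyad j k))"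
          using assms by (subst ennreal_mult[symmetric]) (auto simp: Suc)
        finally show ?thesis .
      qed
      show ?thesis
      proof (cases "k < 2 ^ j'")
        case True
        show ?thesis
          by (rule half[where \<gamma> = \<alpha>1 and l = k])
            (use A1 True descendant_less in \<open>auto simp: Suc glue_seq_simps\<close>)
      next
        case False
        define l where "l = k - 2 ^ j'"
        have l: "k = 2 ^ j' + l" "l < 2 ^ j'" using False k by (auto simp: l_def Suc)
        have "k * 2 ^ i + m = 2 ^ (j' + i) + (l * 2 ^ i + m)" for i m
          by (simp add: l power_add algebra_simps)
        then have "glue_seq \<alpha>1 \<alpha>2 (j + i) (k * 2 ^ i + m) = \<alpha>2 (j' + i) (l * 2 ^ i + m) / 2" for i m
          by (simp only: Suc add_Suc glue_seq_simps)
        then show ?thesis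
          by (rule half) (use A2 l in auto)
      qed
    qed
  qed
  show "dyadic_value p (glue f1 f2) (glue_seq \<alpha>1 \<alpha>2) =
      ennreal (1/2) * dyadic_value p f1 \<alpha>1 + ennreal (1/2) * dyadic_value p f2 \<alpha>2"
    unfolding dyadic_value_def using A1 A2
    by (intro sum_glue_seq)
      (simp_all add: glue_seq_simps avg_glue[where \<phi> = "\<lambda>x. x"])
qed

lemma bellman_midpoint:
  assumes "\<exists>f \<alpha>. dyadic_admissible p F1 ff1 M1 C f \<alpha>" "\<exists>f \<alpha>. dyadic_admissible p F2 ff2 M2 C f \<alpha>"
    and "p > 1" "0 \<le> M1" "M1 \<le> C" "0 \<le> M2" "M2 \<le> C"
  shows "ennreal (1/2) * dyadic_bellman p F1 ff1 M1 C + ennreal (1/2) * dyadic_bellman p F2 ff2 M2 C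
    \<le> dyadic_bellman p ((F1 + F2) / 2) ((ff1 + ff2) / 2) ((M1 + M2) / 2) C"
proof -
  have "ennreal (1/2) * dyadic_value p f1 \<alpha>1 + ennreal (1/2) * dyadic_bellman p F2 ff2 M2 C
    \<le> dyadic_bellman p ((F1 + F2) / 2) ((ff1 + ff2) / 2) ((M1 + M2) / 2) C"
    if "dyadic_admissible p F1 ff1 M1 C f1 \<alpha>1" for f1 \<alpha>1
  proof -
    have "{(f, \<alpha>). dyadic_admissible p F2 ff2 M2 C f \<alpha>} \<noteq> {}" using assms(2) by auto
    then show ?thesis
      unfolding dyadic_bellman_eq[of _ _ _ M2] SUP_mult_left_ennreal
      using glue_admissible(2)[OF that _ assms(3-)]
        dyadic_value_le_bellman[OF glue_admissible(1)[OF that _ assms(3-)]]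
      by (subst ennreal_SUP_add_right) (auto intro!: SUP_least)
  qed
  then show ?thesis
    unfolding dyadic_bellman_eq[of _ _ _ M1] SUP_mult_left_ennreal using assms(1)
    by (subst ennreal_SUP_add_left[symmetric]) (auto intro!: SUP_least)
qed

section \<open>Concavity of the dyadic Bellman function\<close>

text \<open>Allows an argument to lose any factor below 1. It is used for concavity and, at the end,
  to remove the losses of the transport.\<close>

lemma ennreal_le_mult_one_interval:
  fixes x y :: ennreal
  assumes "\<And>z. 0 < z \<Longrightarrow> z < 1 \<Longrightarrow> ennreal z * x \<le> y"
  shows "x \<le> y"
proof (cases y)
  case top
  then show ?thesis by simp
next
  case (real b)
  show ?thesis
  proof (cases x)
    case top
    then show ?thesis using assms[of "1/2"] real by (simp add: ennreal_mult_top top_unique)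
  next
    case (real a)
    have "z * a \<le> b" if "0 < z" "z < 1" for z
      using assms[OF that] that \<open>y = ennreal b\<close> \<open>0 \<le> b\<close> real by (simp add: ennreal_mult[symmetric])
    then show ?thesis
      using field_le_mult_one_interval[of a b] \<open>y = ennreal b\<close> real by (simp add: ennreal_leI)
  qed
qed

lemma ennreal_convex_combination_half:
  fixes x y :: ennreal
  assumes "0 \<le> a" "a \<le> 1" "0 \<le> b" "b \<le> 1"
  shows "ennreal (1/2) * (ennreal (1 - a) * x + ennreal a * y) + ennreal (1/2) * (ennreal (1 - b) * x + ennreal b * y)
    = ennreal (1 - (a + b) / 2) * x + ennreal ((a + b) / 2) * y"
proof -
  have h: "0 \<le> (1 - a) / 2" "0 \<le> (1 - b) / 2" "0 \<le> a / 2" "0 \<le> b / 2" using assms by auto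
  have 1: "ennreal (1 - (a + b) / 2) = ennreal (1/2) * ennreal (1 - a) + ennreal (1/2) * ennreal (1 - b)"
  proof -
    have "1 - (a + b) / 2 = (1 - a) / 2 + (1 - b) / 2" by (simp add: field_simps)
    then show ?thesis
      using assms ennreal_plus[OF h(1,2)] ennreal_mult[of "1/2" "1 - a"] ennreal_mult[of "1/2" "1 - b"] by simp
  qed
  have 2: "ennreal ((a + b) / 2) = ennreal (1/2) * ennreal a + ennreal (1/2) * ennreal b"
    using assms ennreal_plus[OF h(3,4)] ennreal_mult[of "1/2" a] ennreal_mult[of "1/2" b]
    by (simp add: add_divide_distrib)
  show ?thesis unfolding 1 2 by (simp add: algebra_simps)
qed

lemma midpoint_concave_dyadic:
  fixes g :: "real \<Rightarrow> ennreal"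
  assumes mid: "\<And>s t. s \<in> {0..1} \<Longrightarrow> t \<in> {0..1} \<Longrightarrow> ennreal (1/2) * g s + ennreal (1/2) * g t \<le> g ((s + t) / 2)"
  shows "k \<le> 2 ^ n \<Longrightarrow> ennreal (1 - real k / 2 ^ n) * g 0 + ennreal (real k / 2 ^ n) * g 1 \<le> g (real k / 2 ^ n)"
proof (induction n arbitrary: k)
  case 0
  then have "k = 0 \<or> k = 1" by auto
  then show ?case by auto
next
  case (Suc n)
  \<comment> \<open>Rounding \<open>k / 2\<close> down and up writes a point of the finer grid as
    the midpoint of two equal or adjacent points of the coarser one.\<close>
  define a b where "a = k div 2" and "b = (k + 1) div 2"
  have ab: "k = a + b" "a \<le> 2 ^ n" "b \<le> 2 ^ n" using Suc.prems by (auto simp: a_def b_def)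
  define s t where "s = real a / 2 ^ n" and "t = real b / 2 ^ n"
  have "real a \<le> real (2 ^ n)" "real b \<le> real (2 ^ n)"
    using ab(2,3) by (simp_all only: of_nat_le_iff)
  then have st: "s \<in> {0..1}" "t \<in> {0..1}" by (auto simp: s_def t_def)
  have k: "real k / 2 ^ Suc n = (s + t) / 2" by (simp add: s_def t_def ab add_divide_distrib)
  have "ennreal (1 - (s + t) / 2) * g 0 + ennreal ((s + t) / 2) * g 1
    = ennreal (1/2) * (ennreal (1 - s) * g 0 + ennreal s * g 1) + ennreal (1/2) * (ennreal (1 - t) * g 0 + ennreal t * g 1)"
    using st by (subst ennreal_convex_combination_half) auto
  also have "\<dots> \<le> ennreal (1/2) * g s + ennreal (1/2) * g t"
    using Suc.IH[OF ab(2)] Suc.IH[OF ab(3)] unfolding s_def t_def by (intro add_mono mult_left_mono) auto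
  also have "\<dots> \<le> g ((s + t) / 2)" by (rule mid[OF st])
  finally show ?case unfolding k .
qed

text \<open>Nonnegativity replaces the usual continuity assumption: write \<open>t\<close> as a convex combination
  with weights \<open>1 - q\<close> and \<open>q = 2\<^sup>-\<^sup>m\<close> of a dyadic number \<open>s\<close> and a remainder \<open>u\<close>, and drop \<open>g u\<close>.\<close>

lemma midpoint_concave_imp_concave:
  fixes g :: "real \<Rightarrow> ennreal"
  assumes mid: "\<And>s t. s \<in> {0..1} \<Longrightarrow> t \<in> {0..1} \<Longrightarrow> ennreal (1/2) * g s + ennreal (1/2) * g t \<le> g ((s + t) / 2)"
    and t: "0 < t" "t < 1"
  shows "ennreal (1 - t) * g 0 + ennreal t * g 1 \<le> g t"
proof (rule ennreal_le_mult_one_interval)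
  fix z :: real assume z: "0 < z" "z < 1"
  \<comment> \<open>With \<open>q\<close> for the power of 1/2 and some \<open>s\<close> in
    \<open>{t - q..t}\<close>, the weights \<open>(1 - q) * (1 - s)\<close> and
    \<open>(1 - q) * s\<close> must exceed \<open>z * (1 - t)\<close> and \<open>z * t\<close>. The
    limit shows that small \<open>q\<close> achieves this.\<close>
  have "(\<lambda>m. (1 - (1/2) ^ m) * (t - (1/2) ^ m)) \<longlonglongrightarrow> (1 - 0) * (t - 0)"
    by (intro tendsto_intros LIMSEQ_power_zero) auto
  then have "\<forall>\<^sub>F m in sequentially. z * t < (1 - (1/2) ^ m) * (t - (1/2) ^ m)"
    using z t by (intro order_tendstoD(1)[where y = t]) auto
  moreover have "\<forall>\<^sub>F m in sequentially. (1/2 :: real) ^ m < min (1 - t) (1 - z)"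
    using z t by (intro order_tendstoD(2)[OF LIMSEQ_power_zero]) auto
  ultimately obtain m where m: "z * t < (1 - (1/2) ^ m) * (t - (1/2) ^ m)" "(1/2) ^ m < min (1 - t) (1 - z)"
    using eventually_happens[OF eventually_conj] by force
  define q :: real where "q = 1 / 2 ^ m"
  have q: "0 < q" "q \<le> 1" "z * t < (1 - q) * (t - q)" "q < 1 - t" "q < 1 - z"
    using m by (auto simp: q_def power_one_over)
  \<comment> \<open>Rounding \<open>t\<close> down on the grid of mesh \<open>q * q\<close> makes
    \<open>t - s\<close> smaller than \<open>q * q\<close>, so the remainder
    \<open>u = s + (t - s) / q\<close> lies within \<open>q\<close> of \<open>s\<close> and stays in
    the unit interval.\<close>
  define k where "k = nat \<lfloor>t * 2 ^ (2 * m)\<rfloor>"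
  define s where "s = real k / 2 ^ (2 * m)"
  have k: "real k \<le> t * 2 ^ (2 * m)" "t * 2 ^ (2 * m) < real k + 1"
    unfolding k_def using t by (auto simp: floor_correct of_nat_nat)
  have qq: "1 / 2 ^ (2 * m) = q * q" by (simp add: q_def mult_2 power_add)
  have s: "s \<le> t" "t < s + q * q" "0 \<le> s"
    using k unfolding qq[symmetric] s_def by (simp_all add: field_simps)
  have "t * 2 ^ (2 * m) \<le> 2 ^ (2 * m)" using t by simp
  then have "real k \<le> real (2 ^ (2 * m))" using k(1) unfolding of_nat_power of_nat_numeral by linarith
  then have k_le: "k \<le> 2 ^ (2 * m)" by (simp only: of_nat_le_iff)
  define u where "u = s + (t - s) / q"
  have "(t - s) / q \<le> q" "0 \<le> (t - s) / q" using s q by (auto simp: field_simps)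
  then have u: "u \<in> {0..1}" using s q unfolding u_def by auto
  have su: "s + q * (u - s) = t" using q by (simp add: u_def)
  have conv: "s + l * (u - s) \<in> {0..1}" if "l \<in> {0..1}" for l
  proof -
    have "s + l * (u - s) = (1 - l) * s + l * u" by (simp add: algebra_simps)
    moreover have "(1 - l) * s + l * u \<le> (1 - l) * 1 + l * 1"
      using that s t u by (intro add_mono mult_left_mono) auto
    ultimately show ?thesis using that s u by simp
  qed
  have "ennreal (1 - q) * g s \<le> ennreal (1 - real 1 / 2 ^ m) * g (s + 0 * (u - s)) + ennreal (real 1 / 2 ^ m) * g (s + 1 * (u - s))"
    by (simp add: q_def)
  also have "\<dots> \<le> g (s + real 1 / 2 ^ m * (u - s))"
  proof (rule midpoint_concave_dyadic[where g = "\<lambda>l. g (s + l * (u - s))"])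
    fix a b :: real assume ab: "a \<in> {0..1}" "b \<in> {0..1}"
    have "s + (a + b) / 2 * (u - s) = ((s + a * (u - s)) + (s + b * (u - s))) / 2" by (simp add: field_simps)
    then show "ennreal (1/2) * g (s + a * (u - s)) + ennreal (1/2) * g (s + b * (u - s)) \<le> g (s + (a + b) / 2 * (u - s))"
      using mid[OF conv conv, OF ab] by (simp only:)
  qed simp
  finally have 1: "ennreal (1 - q) * g s \<le> g t" using su by (simp add: q_def)
  have 2: "ennreal (1 - s) * g 0 + ennreal s * g 1 \<le> g s"
    unfolding s_def by (rule midpoint_concave_dyadic[OF mid k_le])
  have "ennreal z * (ennreal (1 - t) * g 0 + ennreal t * g 1) = ennreal (z * (1 - t)) * g 0 + ennreal (z * t) * g 1"
    using z t by (simp add: ennreal_mult distrib_left mult.assoc)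
  also have "\<dots> \<le> ennreal ((1 - q) * (1 - s)) * g 0 + ennreal ((1 - q) * s) * g 1"
  proof (intro add_mono mult_right_mono ennreal_leI)
    show "z * (1 - t) \<le> (1 - q) * (1 - s)" using z t s q by (intro mult_mono) auto
    have "q * q \<le> q" using q by (simp add: mult_left_le)
    then have "t - q \<le> s" using s(2) by linarith
    then have "(1 - q) * (t - q) \<le> (1 - q) * s" using q by (intro mult_left_mono) auto
    then show "z * t \<le> (1 - q) * s" using q by simp
  qed auto
  also have "\<dots> = ennreal (1 - q) * (ennreal (1 - s) * g 0 + ennreal s * g 1)"
    using q s t by (simp add: ennreal_mult distrib_left mult.assoc)
  also have "\<dots> \<le> ennreal (1 - q) * g s" using 2 by (rule mult_left_mono) simp
  finally show "ennreal z * (ennreal (1 - t) * g 0 + ennreal t * g 1) \<le> g t" using 1 by simp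
qed

text \<open>The clause on \<open>ff = 0\<close> removes the points with \<open>F > 0\<close>, where
  no function exists because a non-negative function of mean zero vanishes almost everywhere. On the
  remaining set admissible pairs exist, as the inequalities between suprema require.\<close>

definition bellman_dom :: "real \<Rightarrow> real \<Rightarrow> real \<Rightarrow> real \<Rightarrow> real \<Rightarrow> bool" where
  "bellman_dom p C F ff M \<longleftrightarrow> 0 \<le> ff \<and> ff powr p \<le> F \<and> (ff = 0 \<longrightarrow> F = 0) \<and> 0 \<le> M \<and> M \<le> C"

lemma dyad_00: "dyad 0 0 = {0..<1}"
  by (simp add: dyad_def)

text \<open>The function of height \<open>ff / t\<close> on \<open>{0..<t}\<close> has mean
  \<open>ff\<close> for every \<open>t\<close> and p-th moment
  \<open>ff powr p / t powr (p - 1)\<close>. Equating the latter with \<open>F\<close> determines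
  \<open>t\<close>, and \<open>ff powr p \<le> F\<close> ensures \<open>t \<le> 1\<close>.\<close>

lemma ex_function_with_moments:
  assumes "p > 1" "0 \<le> ff" "ff powr p \<le> F" "ff = 0 \<longrightarrow> F = 0"
  obtains f where "f \<in> borel_measurable borel" "\<And>x. 0 \<le> f x"
    "set_integrable lborel (dyad 0 0) (\<lambda>x. f x powr p)"
    "avg (\<lambda>x. f x powr p) (dyad 0 0) = F" "avg f (dyad 0 0) = ff"
proof (cases "ff = 0")
  case True
  then show ?thesis
    using assms by (intro that[of "\<lambda>_. 0"]) (auto simp: avg_def set_integrable_def)
next
  case False
  then have pos: "ff > 0" "ff powr p > 0" "F > 0" using assms by (auto intro: less_le_trans[of _ "ff powr p"])
  define t where "t = (ff powr p / F) powr (1 / (p - 1))"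
  have t: "0 < t" "t \<le> 1" using pos assms by (auto simp: t_def intro: powr_le1)
  have tp: "t powr (p - 1) = ff powr p / F" using pos assms by (simp add: t_def powr_powr)
  have int: "set_integrable lborel (dyad 0 0) (\<lambda>x. c * indicator {0..<t} x)"
    "avg (\<lambda>x. c * indicator {0..<t} x) (dyad 0 0) = c * t" for c :: real
  proof -
    have *: "indicator (dyad 0 0) x *\<^sub>R (c * indicator {0..<t} x) = c * indicator {0..<t} x" for x
      using t by (auto simp: dyad_00 indicator_def)
    show "set_integrable lborel (dyad 0 0) (\<lambda>x. c * indicator {0..<t} x)"
      unfolding set_integrable_def * using t by (intro integrable_mult_right) simp
    show "avg (\<lambda>x. c * indicator {0..<t} x) (dyad 0 0) = c * t"
      unfolding avg_def set_lebesgue_integral_def * using t by simp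
  qed
  have pw: "(ff / t * indicator {0..<t} x) powr p = (ff / t) powr p * indicator {0..<t} x" for x
    using assms by (auto simp: indicator_def)
  have "(ff / t) powr p * t = ff powr p / (t powr (p - 1))"
    using t pos by (simp add: powr_divide powr_diff)
  then have F: "(ff / t) powr p * t = F" using pos by (simp add: tp)
  show ?thesis
  proof (rule that[of "\<lambda>x. ff / t * indicator {0..<t} x"])
    show "0 \<le> ff / t * indicator {0..<t} x" for x using pos t by simp
  qed (use int F t in \<open>simp_all only: pw, simp_all\<close>)
qed

lemma bellman_dom_nonempty:
  assumes "p > 1" "bellman_dom p C F ff M"
  shows "\<exists>f \<alpha>. dyadic_admissible p F ff M C f \<alpha>"
proof -
  note D = assms(2)[unfolded bellman_dom_def]
  obtain f where f: "f \<in> borel_measurable borel" "\<And>x. 0 \<le> f x"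
    "set_integrable lborel (dyad 0 0) (\<lambda>x. f x powr p)"
    "avg (\<lambda>x. f x powr p) (dyad 0 0) = F" "avg f (dyad 0 0) = ff"
    using ex_function_with_moments[of p ff F] assms(1) D by metis
  \<comment> \<open>With all mass on the top interval the Carleson condition is just
    \<open>M \<le> C\<close>.\<close>
  define \<alpha> where "\<alpha> j k = (if j = 0 then M else 0)" for j k :: nat
  have tot: "(\<Sum>j. \<Sum>k<2^j. ennreal (\<alpha> j k)) = ennreal M"
    by (subst suminf_ennreal_split_head) (simp add: \<alpha>_def)
  have "dyadic_admissible p F ff M C f \<alpha>"
    unfolding dyadic_admissible_def
  proof (intro conjI allI impI)
    fix j k :: nat assume k: "k < 2 ^ j"
    show "0 \<le> \<alpha> j k" using D by (simp add: \<alpha>_def)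
    show "(\<Sum>i. \<Sum>m<2 ^ i. ennreal (\<alpha> (j + i) (k * 2 ^ i + m))) \<le> ennreal (C * measure lborel (dyad j k))"
    proof (cases "j = 0")
      case True
      then show ?thesis using k tot D by (simp add: ennreal_leI)
    qed (simp add: \<alpha>_def)
  qed (use f tot in auto)
  then show ?thesis by blast
qed

lemma bellman_dom_convex:
  assumes "p > 1" "bellman_dom p C F0 f0 M0" "bellman_dom p C F1 f1 M1" "0 \<le> t" "t \<le> 1"
  shows "bellman_dom p C ((1 - t) * F0 + t * F1) ((1 - t) * f0 + t * f1) ((1 - t) * M0 + t * M1)"
proof -
  note D = assms(2,3)[unfolded bellman_dom_def]
  have "((1 - t) * f0 + t * f1) powr p \<le> (1 - t) * f0 powr p + t * f1 powr p"
    using D assms by (intro powr_convex_combination) auto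
  also have "\<dots> \<le> (1 - t) * F0 + t * F1" using D assms by (intro add_mono mult_left_mono) auto
  finally have 1: "((1 - t) * f0 + t * f1) powr p \<le> (1 - t) * F0 + t * F1" .
  have "(1 - t) * M0 + t * M1 \<le> (1 - t) * C + t * C" using D assms by (intro add_mono mult_left_mono) auto
  then have 2: "(1 - t) * M0 + t * M1 \<le> C" by (simp add: algebra_simps)
  have "(1 - t) * F0 + t * F1 = 0" if "(1 - t) * f0 + t * f1 = 0"
  proof -
    have "(1 - t) * f0 = 0" "t * f1 = 0"
      using that D assms by (simp_all add: add_nonneg_eq_0_iff)
    then show ?thesis using D by auto
  qed
  then show ?thesis using 1 2 D assms by (simp add: bellman_dom_def)
qed

lemma bellman_concave:
  assumes p: "p > 1" and D: "bellman_dom p C F0 f0 M0" "bellman_dom p C F1 f1 M1" and t: "0 < t" "t < 1"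
  shows "ennreal (1 - t) * dyadic_bellman p F0 f0 M0 C + ennreal t * dyadic_bellman p F1 f1 M1 C
    \<le> dyadic_bellman p ((1 - t) * F0 + t * F1) ((1 - t) * f0 + t * f1) ((1 - t) * M0 + t * M1) C"
proof -
  define g where "g t = dyadic_bellman p ((1 - t) * F0 + t * F1) ((1 - t) * f0 + t * f1) ((1 - t) * M0 + t * M1) C" for t
  have "ennreal (1 - t) * g 0 + ennreal t * g 1 \<le> g t"
  proof (rule midpoint_concave_imp_concave[OF _ t])
    fix s t :: real assume st: "s \<in> {0..1}" "t \<in> {0..1}"
    have mid: "((1 - s) * x + s * y + ((1 - t) * x + t * y)) / 2 = (1 - (s + t) / 2) * x + (s + t) / 2 * y" for x y :: real
      by (simp add: field_simps)
    have "bellman_dom p C ((1 - s) * F0 + s * F1) ((1 - s) * f0 + s * f1) ((1 - s) * M0 + s * M1)"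
      "bellman_dom p C ((1 - t) * F0 + t * F1) ((1 - t) * f0 + t * f1) ((1 - t) * M0 + t * M1)"
      using st by (auto intro: bellman_dom_convex[OF p D])
    then show "ennreal (1/2) * g s + ennreal (1/2) * g t \<le> g ((s + t) / 2)"
      unfolding g_def mid[symmetric]
      by (intro bellman_midpoint bellman_dom_nonempty p) (auto simp: bellman_dom_def)
  qed
  then show ?thesis by (simp add: g_def)
qed

text \<open>The perspective of the Bellman function: superadditivity on the cone \<open>bellman_cone\<close> is
  Jensen's inequality for finite weighted averages without normalisation.\<close>

definition bellman_persp :: "real \<Rightarrow> real \<Rightarrow> real \<Rightarrow> real \<Rightarrow> real \<Rightarrow> real \<Rightarrow> ennreal" where
  "bellman_persp p C w F ff M = ennreal w * dyadic_bellman p (F / w) (ff / w) (M / w) C"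

text \<open>The vertex \<open>w = 0\<close> is included so that null pieces of a partition need no
  separate treatment.\<close>

definition bellman_cone :: "real \<Rightarrow> real \<Rightarrow> real \<Rightarrow> real \<Rightarrow> real \<Rightarrow> real \<Rightarrow> bool" where
  "bellman_cone p C w F ff M \<longleftrightarrow>
     (w = 0 \<and> F = 0 \<and> ff = 0 \<and> M = 0) \<or> (0 < w \<and> bellman_dom p C (F / w) (ff / w) (M / w))"

lemma bellman_persp_superadd:
  assumes p: "p > 1" and K: "bellman_cone p C w F ff M" "bellman_cone p C w' F' ff' M'"
  shows "bellman_persp p C w F ff M + bellman_persp p C w' F' ff' M' \<le> bellman_persp p C (w + w') (F + F') (ff + ff') (M + M')"
    "bellman_cone p C (w + w') (F + F') (ff + ff') (M + M')"
proof -
  have "bellman_persp p C w F ff M + bellman_persp p C w' F' ff' M' \<le> bellman_persp p C (w + w') (F + F') (ff + ff') (M + M') \<and>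
    bellman_cone p C (w + w') (F + F') (ff + ff') (M + M')"
  proof (cases "w = 0 \<or> w' = 0")
    case True
    then show ?thesis using K by (auto simp: bellman_persp_def bellman_cone_def)
  next
    case False
    then have w: "0 < w" "0 < w'" and D: "bellman_dom p C (F / w) (ff / w) (M / w)" "bellman_dom p C (F' / w') (ff' / w') (M' / w')"
      using K by (auto simp: bellman_cone_def)
    define t where "t = w' / (w + w')"
    have t: "0 < t" "t < 1" using w by (auto simp: t_def field_simps)
    have t1: "1 - t = w / (w + w')" using w by (simp add: t_def field_simps)
    have comb: "(1 - t) * (a / w) + t * (b / w') = (a + b) / (w + w')" for a b
      using w unfolding t1 by (simp add: t_def add_divide_distrib)
    have "bellman_persp p C w F ff M + bellman_persp p C w' F' ff' M'
      = ennreal (w + w') * (ennreal (1 - t) * dyadic_bellman p (F / w) (ff / w) (M / w) C + ennreal t * dyadic_bellman p (F' / w') (ff' / w') (M' / w') C)"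
    proof -
      have "ennreal (w + w') * ennreal (1 - t) = ennreal w" "ennreal (w + w') * ennreal t = ennreal w'"
        using w t by (simp_all add: ennreal_mult[symmetric] t1 del: ennreal_plus) (simp add: t_def)
      then show ?thesis by (simp add: bellman_persp_def distrib_left mult.assoc[symmetric] del: ennreal_plus)
    qed
    also have "\<dots> \<le> bellman_persp p C (w + w') (F + F') (ff + ff') (M + M')"
      using bellman_concave[OF p D t] unfolding bellman_persp_def comb by (rule mult_left_mono) simp
    finally show ?thesis
      using bellman_dom_convex[OF p D, of t] t w unfolding comb by (simp add: bellman_cone_def)
  qed
  then show "bellman_persp p C w F ff M + bellman_persp p C w' F' ff' M' \<le> bellman_persp p C (w + w') (F + F') (ff + ff') (M + M')"
    "bellman_cone p C (w + w') (F + F') (ff + ff') (M + M')" by auto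
qed

lemma bellman_persp_sum:
  assumes p: "p > 1" and "finite I" "\<And>i. i \<in> I \<Longrightarrow> bellman_cone p C (w i) (F i) (ff i) (M i)"
  shows "(\<Sum>i\<in>I. bellman_persp p C (w i) (F i) (ff i) (M i))
      \<le> bellman_persp p C (\<Sum>i\<in>I. w i) (\<Sum>i\<in>I. F i) (\<Sum>i\<in>I. ff i) (\<Sum>i\<in>I. M i)"
proof -
  \<comment> \<open>Cone membership of the partial sums is carried through the induction, because
    superadditivity asks for it at the next step.\<close>
  have "(\<Sum>i\<in>I. bellman_persp p C (w i) (F i) (ff i) (M i))
      \<le> bellman_persp p C (\<Sum>i\<in>I. w i) (\<Sum>i\<in>I. F i) (\<Sum>i\<in>I. ff i) (\<Sum>i\<in>I. M i) \<and>
    bellman_cone p C (\<Sum>i\<in>I. w i) (\<Sum>i\<in>I. F i) (\<Sum>i\<in>I. ff i) (\<Sum>i\<in>I. M i)"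
    using assms(2,3)
  proof (induction I rule: finite_induct)
    case empty
    then show ?case by (simp add: bellman_cone_def)
  next
    case (insert i I)
    then show ?case
      using bellman_persp_superadd[OF p, of C "w i" "F i" "ff i" "M i" "\<Sum>i\<in>I. w i" "\<Sum>i\<in>I. F i" "\<Sum>i\<in>I. ff i" "\<Sum>i\<in>I. M i"]
      by (auto intro: order_trans[OF add_left_mono])
  qed
  then show ?thesis by simp
qed

section \<open>Martingales are dominated by the dyadic Bellman function\<close>

text \<open>The number \<open>s\<close> need only lie below the mean \<open>ff / w\<close>. This is
  what lets simple minorants stand in for conditional expectations.\<close>

lemma bellman_persp_jump:
  assumes "p > 1" "bellman_cone p C w F ff M" "0 \<le> a" "M + a * w \<le> C * w" "0 \<le> s" "s * w \<le> ff"
  shows "bellman_persp p C w F ff M + ennreal (a * s powr p * w) \<le> bellman_persp p C w F ff (M + a * w)"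
proof (cases "w = 0")
  case True
  then show ?thesis by (simp add: bellman_persp_def)
next
  case False
  then have w: "0 < w" and D: "bellman_dom p C (F / w) (ff / w) (M / w)"
    using assms(2) by (auto simp: bellman_cone_def)
  have M: "M / w + a = (M + a * w) / w" using w by (simp add: field_simps)
  have "s powr p \<le> (ff / w) powr p"
    using assms w by (intro powr_mono2) (auto simp: field_simps)
  then have "a * s powr p * w \<le> w * (a * (ff / w) powr p)"
    using assms w by (simp add: mult.commute mult_left_mono)
  then have "ennreal (a * s powr p * w) \<le> ennreal w * ennreal (a * (ff / w) powr p)"
    using w assms by (subst ennreal_mult[symmetric]) (auto intro!: ennreal_leI)
  then have "bellman_persp p C w F ff M + ennreal (a * s powr p * w)
    \<le> ennreal w * (dyadic_bellman p (F / w) (ff / w) (M / w) C + ennreal (a * (ff / w) powr p))"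
    by (simp add: bellman_persp_def distrib_left add_left_mono)
  also have "\<dots> \<le> ennreal w * dyadic_bellman p (F / w) (ff / w) (M / w + a) C"
    using assms(3,4) D w
    by (intro mult_left_mono bellman_jump bellman_dom_nonempty assms(1)) (auto simp: bellman_dom_def M divide_le_eq)
  finally show ?thesis by (simp add: bellman_persp_def M)
qed

section \<open>Filtered probability spaces and the Carleson condition tested on sets\<close>

locale filtered_space =
  fixes \<mu> :: "'a measure" and Fn :: "nat \<Rightarrow> 'a measure"
  assumes fps: "filtered_prob_space \<mu> Fn"

sublocale filtered_space \<subseteq> prob_space \<mu>
  using fps by (simp add: filtered_prob_space_def)

context filtered_space
begin

lemma space_Fn [simp]: "space (Fn n) = space \<mu>"
  using fps by (simp add: filtered_prob_space_def filtration_def)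

lemma sets_Fn_mono: "m \<le> n \<Longrightarrow> S \<in> sets (Fn m) \<Longrightarrow> S \<in> sets (Fn n)"
  using fps by (auto simp: filtered_prob_space_def filtration_def)

lemma sets_Fn_0: "sets (Fn 0) = {{}, space \<mu>}"
  using fps by (simp add: filtered_prob_space_def)

lemma subalg: "subalgebra \<mu> (Fn n)"
  using fps by (simp add: filtered_prob_space_def subalgebra_def)

lemma subalg_mono: "m \<le> n \<Longrightarrow> subalgebra (Fn n) (Fn m)"
  using sets_Fn_mono by (auto simp: subalgebra_def)

lemma sets_Fn_subset: "S \<in> sets (Fn n) \<Longrightarrow> S \<in> sets \<mu>"
  using subalg by (auto simp: subalgebra_def)

lemmas measurable_Fn = measurable_from_subalg[OF subalg]

lemma measurable_Fn_mono: "m \<le> n \<Longrightarrow> f \<in> measurable (Fn m) N \<Longrightarrow> f \<in> measurable (Fn n) N"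
  by (rule measurable_from_subalg[OF subalg_mono])

lemma sigma_finite_Fn: "sigma_finite_subalgebra \<mu> (Fn n)"
  by (rule finite_measure_subalgebra_is_sigma_finite)
    (simp add: finite_measure_subalgebra_def finite_measure_subalgebra_axioms_def subalg finite_measure_axioms)

text \<open>Testing on sets of the \<sigma>-algebra removes the conditional expectation from the
  Carleson condition. For the converse, the test set is the one where the pointwise bound
  fails.\<close>

lemma nn_cond_exp_le_iff:
  assumes [measurable]: "U \<in> borel_measurable \<mu>"
  shows "(AE x in \<mu>. nn_cond_exp \<mu> (Fn n) U x \<le> ennreal C) \<longleftrightarrow>
    (\<forall>S\<in>sets (Fn n). (\<integral>\<^sup>+x\<in>S. U x \<partial>\<mu>) \<le> ennreal C * emeasure \<mu> S)"
proof -
  interpret s: sigma_finite_subalgebra \<mu> "Fn n" by (rule sigma_finite_Fn)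
  have eq: "(\<integral>\<^sup>+x\<in>S. U x \<partial>\<mu>) = (\<integral>\<^sup>+x\<in>S. nn_cond_exp \<mu> (Fn n) U x \<partial>\<mu>)" if "S \<in> sets (Fn n)" for S
    using s.nn_cond_exp_intg[of "indicator S" U] that by (simp add: mult.commute)
  have const: "(\<integral>\<^sup>+x\<in>S. ennreal C \<partial>\<mu>) = ennreal C * emeasure \<mu> S" if "S \<in> sets (Fn n)" for S
    using sets_Fn_subset[OF that] by (simp add: nn_integral_cmult_indicator)
  show ?thesis
  proof
    assume AE: "AE x in \<mu>. nn_cond_exp \<mu> (Fn n) U x \<le> ennreal C"
    show "\<forall>S\<in>sets (Fn n). (\<integral>\<^sup>+x\<in>S. U x \<partial>\<mu>) \<le> ennreal C * emeasure \<mu> S"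
    proof
      fix S assume S: "S \<in> sets (Fn n)"
      show "(\<integral>\<^sup>+x\<in>S. U x \<partial>\<mu>) \<le> ennreal C * emeasure \<mu> S"
        unfolding eq[OF S] const[OF S, symmetric]
        by (rule nn_integral_mono_AE, use AE in eventually_elim) (auto intro: mult_right_mono)
    qed
  next
    assume *: "\<forall>S\<in>sets (Fn n). (\<integral>\<^sup>+x\<in>S. U x \<partial>\<mu>) \<le> ennreal C * emeasure \<mu> S"
    define S where "S = {x \<in> space (Fn n). ennreal C < nn_cond_exp \<mu> (Fn n) U x}"
    have S: "S \<in> sets (Fn n)" unfolding S_def by measurable
    note [measurable] = sets_Fn_subset[OF S]
    have "AE x in \<mu>. nn_cond_exp \<mu> (Fn n) U x * indicator S x \<le> ennreal C * indicator S x"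
    proof (rule ccontr)
      assume "\<not> ?thesis"
      then have "(\<integral>\<^sup>+x\<in>S. ennreal C \<partial>\<mu>) < (\<integral>\<^sup>+x\<in>S. nn_cond_exp \<mu> (Fn n) U x \<partial>\<mu>)"
        using const[OF S] by (intro nn_integral_less) (auto simp: S_def indicator_def ennreal_mult_eq_top_iff less_imp_le)
      then show False using * S eq[OF S] const[OF S] by (auto simp: not_less[symmetric])
    qed
    then show "AE x in \<mu>. nn_cond_exp \<mu> (Fn n) U x \<le> ennreal C"
      using AE_space
    proof eventually_elim
      case (elim x)
      then show ?case by (cases "x \<in> S") (auto simp: S_def)
    qed
  qed
qed

lemma carleson_seq_iff:
  "carleson_seq \<mu> Fn C \<alpha> \<longleftrightarrow>
     (\<forall>n. \<alpha> n \<in> borel_measurable (Fn n)) \<and> (\<forall>n. \<forall>x\<in>space \<mu>. 0 \<le> \<alpha> n x) \<and>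
     (\<forall>n. \<forall>S\<in>sets (Fn n). (\<integral>\<^sup>+x\<in>S. (\<Sum>k. ennreal (\<alpha> (n + k) x)) \<partial>\<mu>) \<le> ennreal C * emeasure \<mu> S)"
proof (cases "\<forall>n. \<alpha> n \<in> borel_measurable (Fn n)")
  case True
  then have [measurable]: "\<alpha> n \<in> borel_measurable \<mu>" for n using measurable_Fn by blast
  show ?thesis unfolding carleson_seq_def by (subst nn_cond_exp_le_iff) auto
qed (auto simp: carleson_seq_def)

lemma set_integrable_of_integrable:
  fixes g :: "'a \<Rightarrow> real"
  shows "integrable \<mu> g \<Longrightarrow> S \<in> sets \<mu> \<Longrightarrow> set_integrable \<mu> S g"
  unfolding set_integrable_def by (rule integrable_mult_indicator)

text \<open>Jensen on \<open>S\<close> gives the moment constraint, and zero integral of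
  \<open>f\<close> over \<open>S\<close> forces \<open>f\<close> to vanish almost everywhere there.
  A null set \<open>S\<close> lands on the vertex of the cone.\<close>

lemma bellman_cone_set_integral:
  assumes "p > 1" and f: "\<And>x. x \<in> space \<mu> \<Longrightarrow> 0 \<le> f x" "integrable \<mu> f" "integrable \<mu> (\<lambda>x. f x powr p)"
    and S: "S \<in> sets \<mu>" and M: "0 \<le> M" "M \<le> C * measure \<mu> S"
  shows "bellman_cone p C (measure \<mu> S) (LINT x:S|\<mu>. f x powr p) (LINT x:S|\<mu>. f x) M"
proof (cases "measure \<mu> S = 0")
  case True
  then have null: "AE x in \<mu>. x \<notin> S" using S by (intro AE_not_in) (auto simp: null_sets_def emeasure_eq_measure)
  have "(LINT x:S|\<mu>. g x) = 0" for g :: "'a \<Rightarrow> real"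
    unfolding set_lebesgue_integral_def by (rule integral_eq_zero_AE) (use null in auto)
  then show ?thesis using True M by (simp add: bellman_cone_def)
next
  case False
  then have w: "0 < measure \<mu> S" by (simp add: zero_less_measure_iff)
  have fS: "\<And>x. x \<in> S \<Longrightarrow> 0 \<le> f x" using f(1) sets.sets_into_space[OF S] by auto
  have int: "set_integrable \<mu> S f" "set_integrable \<mu> S (\<lambda>x. f x powr p)"
    using f S by (auto intro: set_integrable_of_integrable)
  have nn: "0 \<le> (LINT x:S|\<mu>. f x)"
    unfolding set_lebesgue_integral_def using fS by (intro integral_nonneg_AE) (auto simp: indicator_def)
  have 1: "((LINT x:S|\<mu>. f x) / measure \<mu> S) powr p \<le> (LINT x:S|\<mu>. f x powr p) / measure \<mu> S"
    using set_integral_powr_ge[OF assms(1) S _ fS int] w by (simp add: field_simps emeasure_eq_measure)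
  have 2: "(LINT x:S|\<mu>. f x powr p) = 0" if "(LINT x:S|\<mu>. f x) = 0"
  proof -
    have "AE x in \<mu>. indicator S x * f x = 0"
      using that int(1) fS unfolding set_lebesgue_integral_def set_integrable_def
      by (subst integral_nonneg_eq_0_iff_AE[symmetric]) (auto simp: indicator_def)
    then have "AE x in \<mu>. indicator S x *\<^sub>R (f x powr p) = 0"
      by eventually_elim auto
    then show ?thesis unfolding set_lebesgue_integral_def by (rule integral_eq_zero_AE)
  qed
  show ?thesis
    using w nn 1 2 M by (auto simp: bellman_cone_def bellman_dom_def divide_le_eq)
qed

lemma integrable_simple_Fn:
  fixes g :: "'a \<Rightarrow> real"
  assumes "simple_function (Fn k) g"
  shows "integrable \<mu> g"
proof -
  have fin: "finite (g ` space \<mu>)" using assms by (simp add: simple_function_def)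
  have [measurable]: "g \<in> borel_measurable \<mu>"
    using borel_measurable_simple_function[OF assms] measurable_Fn by blast
  show ?thesis
    by (rule integrable_const_bound[where B = "Max (abs ` (g ` space \<mu>))"]) (use fin in auto)
qed

lemma set_integral_partition:
  fixes g :: "'a \<Rightarrow> real" and Y :: "'a \<Rightarrow> 'b"
  assumes "integrable \<mu> g" "finite (Y ` S)" "\<And>y. y \<in> Y ` S \<Longrightarrow> {x \<in> S. Y x = y} \<in> sets \<mu>"
  shows "(LINT x:S|\<mu>. g x) = (\<Sum>y\<in>Y ` S. LINT x:{x \<in> S. Y x = y}|\<mu>. g x)"
proof -
  have "S = (\<Union>y\<in>Y ` S. {x \<in> S. Y x = y})" by auto
  then have "(LINT x:S|\<mu>. g x) = (LINT x:(\<Union>y\<in>Y ` S. {x \<in> S. Y x = y})|\<mu>. g x)" by simp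
  also have "\<dots> = (\<Sum>y\<in>Y ` S. LINT x:{x \<in> S. Y x = y}|\<mu>. g x)"
    using assms by (intro set_integral_finite_Union) (auto simp: disjoint_family_on_def intro: set_integrable_of_integrable)
  finally show ?thesis .
qed

text \<open>Backward induction on \<open>n\<close>: a set \<open>S\<close> of the \<open>n\<close>-th \<open>\<sigma>\<close>-algebra is split into the finitely many
  pieces on which \<open>a n\<close> and \<open>s n\<close> are constant; each piece also lies in the next \<open>\<sigma>\<close>-algebra,
  so that no conditional expectations are needed.\<close>

lemma simple_tree_bound:
  assumes p: "p > 1" and f: "\<And>x. x \<in> space \<mu> \<Longrightarrow> 0 \<le> f x" "integrable \<mu> f" "integrable \<mu> (\<lambda>x. f x powr p)"
    and simple: "\<And>k. simple_function (Fn k) (a k)" "\<And>k. simple_function (Fn k) (s k)"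
    and nn: "\<And>k x. 0 \<le> a k x" "\<And>k x. 0 \<le> s k x"
    and car: "\<And>n S. S \<in> sets (Fn n) \<Longrightarrow> (LINT x:S|\<mu>. (\<Sum>k=n..<N. a k x)) \<le> C * measure \<mu> S"
    and below: "\<And>n S. S \<in> sets (Fn n) \<Longrightarrow> (LINT x:S|\<mu>. s n x) \<le> (LINT x:S|\<mu>. f x)"
    and "n \<le> N" "S \<in> sets (Fn n)"
  shows "ennreal (LINT x:S|\<mu>. (\<Sum>k=n..<N. a k x * s k x powr p))
    \<le> bellman_persp p C (measure \<mu> S) (LINT x:S|\<mu>. f x powr p) (LINT x:S|\<mu>. f x) (LINT x:S|\<mu>. (\<Sum>k=n..<N. a k x))"
  using assms(11,12)
proof (induction arbitrary: S rule: inc_induct)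
  case base
  then show ?case by simp
next
  case (step n)
  define Y where "Y x = (s n x, a n x)" for x
  define T where "T y = {x \<in> S. Y x = y}" for y
  have Ssub: "S \<subseteq> space \<mu>" using sets.sets_into_space[OF step.prems] by simp
  have simpY: "simple_function (Fn n) Y" unfolding Y_def by (intro simple_function_Pair simple)
  have finY: "finite (Y ` S)"
    using simpY Ssub by (auto simp: simple_function_def intro: finite_subset[OF image_mono])
  have Tn: "T y \<in> sets (Fn n)" for y
  proof -
    have "T y = S \<inter> (Y -` {y} \<inter> space (Fn n))" using Ssub by (auto simp: T_def)
    then show ?thesis using step.prems simple_functionD(2)[OF simpY, of "{y}"] by auto
  qed
  note T\<mu> = sets_Fn_subset[OF Tn]
  have ia: "integrable \<mu> (a k)" for k by (rule integrable_simple_Fn[OF simple(1)])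
  have iv: "integrable \<mu> (\<lambda>x. a k x * s k x powr p)" for k
    using simple by (intro integrable_simple_Fn[of k] simple_function_mult simple_function_compose1[where g = "\<lambda>x. x powr p"])
  define E where "E n S = (LINT x:S|\<mu>. (\<Sum>k=n..<N. a k x * s k x powr p))" for n S
  define A where "A n S = (LINT x:S|\<mu>. (\<Sum>k=n..<N. a k x))" for n S
  have nonneg: "0 \<le> E n S" "0 \<le> A n S" for n S
    unfolding E_def A_def set_lebesgue_integral_def using nn
    by (auto intro!: integral_nonneg_AE mult_nonneg_nonneg sum_nonneg)
  have upt: "(\<Sum>k=n..<N. g k) = g n + (\<Sum>k=Suc n..<N. g k)" for g :: "nat \<Rightarrow> real"
    using step.hyps by (simp add: sum.atLeast_Suc_lessThan)
  have split: "(LINT x:T y|\<mu>. g x + h x) = c * measure \<mu> (T y) + (LINT x:T y|\<mu>. h x)"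
    if "integrable \<mu> g" "integrable \<mu> h" "\<And>x. x \<in> T y \<Longrightarrow> g x = c" for g h y c
  proof -
    have "(LINT x:T y|\<mu>. g x) = (LINT x:T y|\<mu>. c)"
      using that(3) T\<mu>[of y] by (intro set_lebesgue_integral_cong) auto
    also have "\<dots> = c * measure \<mu> (T y)"
      using T\<mu>[of y] by (simp add: set_integral_const emeasure_eq_measure)
    finally show ?thesis
      using that(1,2) T\<mu>[of y] by (subst set_integral_add) (auto intro: set_integrable_of_integrable)
  qed
  have piece: "ennreal (E n (T y)) \<le> bellman_persp p C (measure \<mu> (T y)) (LINT x:T y|\<mu>. f x powr p) (LINT x:T y|\<mu>. f x) (A n (T y))"
    and cone: "bellman_cone p C (measure \<mu> (T y)) (LINT x:T y|\<mu>. f x powr p) (LINT x:T y|\<mu>. f x) (A n (T y))"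
    if "y \<in> Y ` S" for y
  proof -
    obtain s0 a0 where y: "y = (s0, a0)" by (cases y)
    have pos: "0 \<le> s0" "0 \<le> a0" using that nn y by (auto simp: Y_def)
    have Tv: "s n x = s0" "a n x = a0" if "x \<in> T y" for x using that by (auto simp: T_def Y_def y)
    have E: "E n (T y) = a0 * s0 powr p * measure \<mu> (T y) + E (Suc n) (T y)"
      unfolding E_def upt using Tv iv by (intro split) auto
    have A: "A n (T y) = a0 * measure \<mu> (T y) + A (Suc n) (T y)"
      unfolding A_def upt using Tv ia by (intro split) auto
    \<comment> \<open>On the piece \<open>s n\<close> equals \<open>s0\<close>, so
      \<open>below\<close>, tested on the piece itself, puts \<open>s0\<close> under the mean of
      \<open>f\<close> there.\<close>
    have s0: "s0 * measure \<mu> (T y) \<le> (LINT x:T y|\<mu>. f x)"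
      using below[OF Tn, of y] split[of "s n" "\<lambda>_. 0" y s0] Tv integrable_simple_Fn[OF simple(2)]
      by (simp add: set_lebesgue_integral_def)
    have A_le: "A n (T y) \<le> C * measure \<mu> (T y)" unfolding A_def by (rule car[OF Tn])
    show "bellman_cone p C (measure \<mu> (T y)) (LINT x:T y|\<mu>. f x powr p) (LINT x:T y|\<mu>. f x) (A n (T y))"
      by (rule bellman_cone_set_integral[OF p f T\<mu> nonneg(2) A_le])
    have "ennreal (E n (T y)) = ennreal (E (Suc n) (T y)) + ennreal (a0 * s0 powr p * measure \<mu> (T y))"
      unfolding E using nonneg pos by (subst ennreal_plus[symmetric]) (auto simp: add.commute)
    also have "\<dots> \<le> bellman_persp p C (measure \<mu> (T y)) (LINT x:T y|\<mu>. f x powr p) (LINT x:T y|\<mu>. f x) (A (Suc n) (T y))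
        + ennreal (a0 * s0 powr p * measure \<mu> (T y))"
      using step.IH[OF sets_Fn_mono[OF _ Tn], of y] unfolding E_def A_def by (intro add_right_mono) auto
    also have "\<dots> \<le> bellman_persp p C (measure \<mu> (T y)) (LINT x:T y|\<mu>. f x powr p) (LINT x:T y|\<mu>. f x) (A (Suc n) (T y) + a0 * measure \<mu> (T y))"
    proof (rule bellman_persp_jump[OF p])
      have A_le': "A (Suc n) (T y) \<le> C * measure \<mu> (T y)"
        using A A_le mult_nonneg_nonneg[OF pos(2) measure_nonneg[of \<mu> "T y"]] by linarith
      show "bellman_cone p C (measure \<mu> (T y)) (LINT x:T y|\<mu>. f x powr p) (LINT x:T y|\<mu>. f x) (A (Suc n) (T y))"
        by (rule bellman_cone_set_integral[OF p f T\<mu> nonneg(2) A_le'])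
    qed (use A A_le pos s0 in auto)
    finally show "ennreal (E n (T y)) \<le> bellman_persp p C (measure \<mu> (T y)) (LINT x:T y|\<mu>. f x powr p) (LINT x:T y|\<mu>. f x) (A n (T y))"
      using A by (simp add: add.commute)
  qed
  have part: "(LINT x:S|\<mu>. g x) = (\<Sum>y\<in>Y ` S. LINT x:T y|\<mu>. g x)" if "integrable \<mu> g" for g :: "'a \<Rightarrow> real"
    unfolding T_def by (rule set_integral_partition[OF that finY]) (use T\<mu> in \<open>simp add: T_def\<close>)
  have meas: "measure \<mu> S = (\<Sum>y\<in>Y ` S. measure \<mu> (T y))"
    using part[of "\<lambda>_. 1"] sets_Fn_subset[OF step.prems] T\<mu>
    by (simp add: set_integral_const emeasure_eq_measure)
  have ES: "E n S = (\<Sum>y\<in>Y ` S. E n (T y))" and AS: "A n S = (\<Sum>y\<in>Y ` S. A n (T y))"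
    unfolding E_def A_def using ia iv by (auto intro!: part)
  have "ennreal (E n S) = (\<Sum>y\<in>Y ` S. ennreal (E n (T y)))"
    unfolding ES using nonneg by (simp add: sum_ennreal)
  also have "\<dots> \<le> (\<Sum>y\<in>Y ` S. bellman_persp p C (measure \<mu> (T y)) (LINT x:T y|\<mu>. f x powr p) (LINT x:T y|\<mu>. f x) (A n (T y)))"
    by (rule sum_mono) (rule piece)
  also have "\<dots> \<le> bellman_persp p C (measure \<mu> S) (LINT x:S|\<mu>. f x powr p) (LINT x:S|\<mu>. f x) (A n S)"
    unfolding meas AS part[OF f(2)] part[OF f(3)] by (rule bellman_persp_sum[OF p finY cone])
  finally show ?case by (simp add: E_def A_def)
qed

end

section \<open>Simple minorants and the passage to the limit\<close>

context filtered_space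
begin

lemma simple_approx_nonneg:
  fixes u :: "'a \<Rightarrow> real"
  assumes "u \<in> borel_measurable (Fn k)" "\<And>x. 0 \<le> u x"
  obtains v where "\<And>i. simple_function (Fn k) (v i)" "\<And>i x. 0 \<le> v i x" "\<And>x. incseq (\<lambda>i. v i x)"
    "\<And>x. (\<lambda>i. v i x) \<longlonglongrightarrow> u x" "\<And>i x. v i x \<le> u x"
proof -
  obtain v where v: "incseq v" "\<And>i. simple_function (Fn k) (v i)" "\<And>x. bdd_above (range (\<lambda>i. v i x))"
    "\<And>i x. 0 \<le> v i x" "u = (SUP i. v i)"
    using borel_measurable_implies_simple_function_sequence_real[OF assms] by blast
  have inc: "incseq (\<lambda>i. v i x)" for x using v(1) by (auto simp: incseq_def le_fun_def)
  have "u x = (SUP i. v i x)" for x unfolding v(5) by (simp add: image_image)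
  then have lim: "(\<lambda>i. v i x) \<longlonglongrightarrow> u x" for x using LIMSEQ_incseq_SUP[OF v(3) inc] by simp
  show ?thesis by (rule that[OF v(2,4) inc lim incseq_le[OF inc lim]])
qed

lemma mart_value_le_bellman:
  assumes p: "p > 1" and C: "C > 0" and M: "0 \<le> M" "M \<le> C" and adm: "mart_admissible \<mu> Fn p F ff M C f \<alpha>"
  shows "(\<integral>\<^sup>+x. (\<Sum>n. ennreal (\<alpha> n x * real_cond_exp \<mu> (Fn n) f x powr p)) \<partial>\<mu>) \<le> dyadic_bellman p F ff M C"
proof -
  note ad = adm[unfolded mart_admissible_def]
  have [measurable]: "f \<in> borel_measurable \<mu>" using ad by simp
  have f: "\<And>x. x \<in> space \<mu> \<Longrightarrow> 0 \<le> f x" "integrable \<mu> f" "integrable \<mu> (\<lambda>x. f x powr p)"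
    using ad by auto
  have car: "\<alpha> n \<in> borel_measurable (Fn n)" "\<And>x. x \<in> space \<mu> \<Longrightarrow> 0 \<le> \<alpha> n x"
    "\<And>S. S \<in> sets (Fn n) \<Longrightarrow> (\<integral>\<^sup>+x\<in>S. (\<Sum>k. ennreal (\<alpha> (n + k) x)) \<partial>\<mu>) \<le> ennreal C * emeasure \<mu> S" for n
    using ad unfolding carleson_seq_iff by auto
  have tot: "(\<integral>\<^sup>+x. (\<Sum>n. ennreal (\<alpha> n x)) \<partial>\<mu>) = ennreal M" using ad by simp
  note [measurable] = measurable_Fn[OF car(1)]
  \<comment> \<open>Conditional expectations are known to be non-negative only almost everywhere,
    and \<open>\<alpha>\<close> only on the space. Truncation at 0 makes both non-negative
    everywhere, as the simple approximation demands.\<close>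
  define g where "g n x = max 0 (real_cond_exp \<mu> (Fn n) f x)" for n x
  define b where "b n x = max 0 (\<alpha> n x)" for n x
  have [measurable]: "g n \<in> borel_measurable \<mu>" for n unfolding g_def by measurable
  have g_eq: "AE x in \<mu>. g n x = real_cond_exp \<mu> (Fn n) f x" for n
    using sigma_finite_subalgebra.real_cond_exp_pos[OF sigma_finite_Fn, of f n] f
    by (auto simp: g_def elim!: eventually_mono)
  have b_eq: "b n x = \<alpha> n x" if "x \<in> space \<mu>" for n x using car(2)[OF that] by (simp add: b_def)
  have gF: "g n \<in> borel_measurable (Fn n)" and bF: "b n \<in> borel_measurable (Fn n)" for n
    using car(1)[of n] unfolding g_def b_def by measurable
  note [measurable] = measurable_Fn[OF bF]
  have "\<exists>v. (\<forall>i. simple_function (Fn n) (v i)) \<and> (\<forall>i x. 0 \<le> v i x) \<and> (\<forall>x. incseq (\<lambda>i. v i x)) \<and>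
    (\<forall>x. (\<lambda>i. v i x) \<longlonglongrightarrow> g n x) \<and> (\<forall>i x. v i x \<le> g n x)" for n
    using simple_approx_nonneg[OF gF[of n]] by (simp add: g_def) metis
  then obtain v where v: "\<And>n i. simple_function (Fn n) (v n i)" "\<And>n i x. 0 \<le> v n i x" "\<And>n x. incseq (\<lambda>i. v n i x)"
    "\<And>n x. (\<lambda>i. v n i x) \<longlonglongrightarrow> g n x" "\<And>n i x. v n i x \<le> g n x" by metis
  have "\<exists>v. (\<forall>i. simple_function (Fn n) (v i)) \<and> (\<forall>i x. 0 \<le> v i x) \<and> (\<forall>x. incseq (\<lambda>i. v i x)) \<and>
    (\<forall>x. (\<lambda>i. v i x) \<longlonglongrightarrow> b n x) \<and> (\<forall>i x. v i x \<le> b n x)" for n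
    using simple_approx_nonneg[OF bF[of n]] by (simp add: b_def) metis
  then obtain u where u: "\<And>n i. simple_function (Fn n) (u n i)" "\<And>n i x. 0 \<le> u n i x" "\<And>n x. incseq (\<lambda>i. u n i x)"
    "\<And>n x. (\<lambda>i. u n i x) \<longlonglongrightarrow> b n x" "\<And>n i x. u n i x \<le> b n x" by metis
  have iu: "integrable \<mu> (u n i)" for n i by (rule integrable_simple_Fn[OF u(1)])
  have iv: "integrable \<mu> (v n i)" for n i by (rule integrable_simple_Fn[OF v(1)])
  have iuv: "integrable \<mu> (\<lambda>x. u n i x * v n i x powr p)" for n i
    using u(1)[of n i] v(1)[of n i]
    by (intro integrable_simple_Fn[of n] simple_function_mult simple_function_compose1[where g = "\<lambda>x. x powr p"])
  note [measurable] = borel_measurable_integrable[OF iu] borel_measurable_integrable[OF iv]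
  have u_le: "ennreal (LINT x:S|\<mu>. (\<Sum>k=n..<N. u k i x)) \<le> (\<integral>\<^sup>+x\<in>S. (\<Sum>k. ennreal (\<alpha> (n + k) x)) \<partial>\<mu>)"
    if S: "S \<in> sets \<mu>" for S n N i
  proof -
    have "ennreal (LINT x:S|\<mu>. (\<Sum>k=n..<N. u k i x)) = (\<integral>\<^sup>+x. ennreal (indicator S x * (\<Sum>k=n..<N. u k i x)) \<partial>\<mu>)"
      unfolding set_lebesgue_integral_def real_scaleR_def using iu S u(2)
      by (intro nn_integral_eq_integral[symmetric]) (auto intro!: integrable_real_mult_indicator sum_nonneg mult_nonneg_nonneg simp: mult.commute[of "indicator S _"])
    also have "\<dots> \<le> (\<integral>\<^sup>+x\<in>S. (\<Sum>k. ennreal (\<alpha> (n + k) x)) \<partial>\<mu>)"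
    proof (rule nn_integral_mono)
      fix x assume x: "x \<in> space \<mu>"
      have "ennreal (\<Sum>k=n..<N. u k i x) \<le> ennreal (\<Sum>k=n..<N. \<alpha> k x)"
        using u(5)[of _ i x] b_eq[OF x] by (intro ennreal_leI sum_mono) metis
      also have "\<dots> = (\<Sum>k<N - n. ennreal (\<alpha> (n + k) x))"
        using car(2)[OF x] by (simp add: sum.atLeastLessThan_shift_0[of _ n] sum_ennreal atLeast0LessThan add.commute)
      also have "\<dots> \<le> (\<Sum>k. ennreal (\<alpha> (n + k) x))"
        by (rule sum_le_suminf) (auto intro: summableI)
      finally show "ennreal (indicator S x * (\<Sum>k=n..<N. u k i x)) \<le> (\<Sum>k. ennreal (\<alpha> (n + k) x)) * indicator S x"
        by (simp add: indicator_def)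
    qed
    finally show ?thesis .
  qed
  have bound: "ennreal (LINT x|\<mu>. (\<Sum>k<N. u k i x * v k i x powr p)) \<le> dyadic_bellman p F ff M C" for N i
  proof -
    define M' where "M' = (LINT x|\<mu>. (\<Sum>k<N. u k i x))"
    have sp: "(LINT x:space \<mu>|\<mu>. h x) = (LINT x|\<mu>. h x)" for h :: "'a \<Rightarrow> real"
      unfolding set_lebesgue_integral_def by (intro Bochner_Integration.integral_cong) auto
    have carl: "(LINT x:S|\<mu>. (\<Sum>k=n..<N. u k i x)) \<le> C * measure \<mu> S" if S: "S \<in> sets (Fn n)" for n S
    proof -
      have "ennreal (LINT x:S|\<mu>. (\<Sum>k=n..<N. u k i x)) \<le> ennreal C * emeasure \<mu> S"
        using u_le[OF sets_Fn_subset[OF S]] car(3)[OF S] by (rule order_trans)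
      then show ?thesis using C by (simp add: emeasure_eq_measure ennreal_mult[symmetric])
    qed
    have below: "(LINT x:S|\<mu>. v n i x) \<le> (LINT x:S|\<mu>. f x)" if S: "S \<in> sets (Fn n)" for n S
    proof -
      note S\<mu> = sets_Fn_subset[OF S]
      have ic: "integrable \<mu> (real_cond_exp \<mu> (Fn n) f)"
        by (rule sigma_finite_subalgebra.real_cond_exp_int(1)[OF sigma_finite_Fn f(2)])
      have "(LINT x:S|\<mu>. v n i x) \<le> (LINT x:S|\<mu>. real_cond_exp \<mu> (Fn n) f x)"
      proof (rule set_integral_mono_AE)
        show "AE x \<in> S in \<mu>. v n i x \<le> real_cond_exp \<mu> (Fn n) f x"
          using g_eq[of n] by eventually_elim (use v(5)[of n i] in metis)
      qed (use iv ic S\<mu> in \<open>auto intro: set_integrable_of_integrable\<close>)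
      also have "\<dots> = (LINT x:S|\<mu>. f x)"
        by (rule sigma_finite_subalgebra.real_cond_exp_intA[OF sigma_finite_Fn f(2) S, symmetric])
      finally show ?thesis .
    qed
    have M'0: "0 \<le> M'" unfolding M'_def using u(2) by (auto intro!: integral_nonneg_AE sum_nonneg)
    have "ennreal M' \<le> ennreal M"
      using u_le[of "space \<mu>" i 0 N] tot by (simp add: M'_def sp atLeast0LessThan)
    then have M': "M' \<le> M" using M by simp
    have "ennreal (LINT x:space \<mu>|\<mu>. (\<Sum>k=0..<N. u k i x * v k i x powr p))
      \<le> bellman_persp p C (measure \<mu> (space \<mu>)) (LINT x:space \<mu>|\<mu>. f x powr p) (LINT x:space \<mu>|\<mu>. f x) (LINT x:space \<mu>|\<mu>. (\<Sum>k=0..<N. u k i x))"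
      by (rule simple_tree_bound[OF p f u(1) v(1) u(2) v(2) carl below]) (auto simp: sets_Fn_0)
    then have "ennreal (LINT x|\<mu>. (\<Sum>k<N. u k i x * v k i x powr p)) \<le> dyadic_bellman p F ff M' C"
      using ad by (simp add: sp bellman_persp_def atLeast0LessThan prob_space M'_def)
    \<comment> \<open>The minorants carry a mass \<open>M'\<close> possibly below \<open>M\<close>;
      the jump inequality makes the Bellman function increasing in the mass.\<close>
    also have "\<dots> \<le> dyadic_bellman p F ff (M' + (M - M')) C"
    proof -
      have "bellman_cone p C (measure \<mu> (space \<mu>)) (LINT x:space \<mu>|\<mu>. f x powr p) (LINT x:space \<mu>|\<mu>. f x) M'"
        by (rule bellman_cone_set_integral[OF p f]) (use M M' M'0 in \<open>auto simp: prob_space\<close>)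
      then have "bellman_dom p C F ff M'" using ad by (simp add: bellman_cone_def prob_space sp)
      then show ?thesis
        using bellman_jump[OF bellman_dom_nonempty[OF p], of C F ff M' "M - M'"] M M' M'0
        by (intro order_trans[OF _ bellman_jump[OF bellman_dom_nonempty[OF p]]]) auto
    qed
    finally show ?thesis by simp
  qed
  have "(\<Sum>k<N. \<integral>\<^sup>+x. ennreal (\<alpha> k x * real_cond_exp \<mu> (Fn k) f x powr p) \<partial>\<mu>) \<le> dyadic_bellman p F ff M C" for N
  proof -
    have "(\<Sum>k<N. \<integral>\<^sup>+x. ennreal (\<alpha> k x * real_cond_exp \<mu> (Fn k) f x powr p) \<partial>\<mu>)
        = (\<Sum>k<N. \<integral>\<^sup>+x. ennreal (b k x * g k x powr p) \<partial>\<mu>)"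
    proof (intro sum.cong refl nn_integral_cong_AE)
      fix k
      show "AE x in \<mu>. ennreal (\<alpha> k x * real_cond_exp \<mu> (Fn k) f x powr p) = ennreal (b k x * g k x powr p)"
        using g_eq[of k] AE_space by eventually_elim (simp add: b_eq)
    qed
    also have "\<dots> = (\<integral>\<^sup>+x. (\<Sum>k<N. ennreal (b k x * g k x powr p)) \<partial>\<mu>)"
      by (rule nn_integral_sum[symmetric]) auto
    finally have eq: "(\<Sum>k<N. \<integral>\<^sup>+x. ennreal (\<alpha> k x * real_cond_exp \<mu> (Fn k) f x powr p) \<partial>\<mu>)
        = (\<integral>\<^sup>+x. (\<Sum>k<N. ennreal (b k x * g k x powr p)) \<partial>\<mu>)" .
    have "(\<lambda>i. \<integral>\<^sup>+x. (\<Sum>k<N. ennreal (u k i x * v k i x powr p)) \<partial>\<mu>) \<longlonglongrightarrow> (\<integral>\<^sup>+x. (\<Sum>k<N. ennreal (b k x * g k x powr p)) \<partial>\<mu>)"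
    proof (rule nn_integral_LIMSEQ)
      show "incseq (\<lambda>i x. \<Sum>k<N. ennreal (u k i x * v k i x powr p))"
        unfolding incseq_def le_fun_def
      proof (intro allI impI sum_mono ennreal_leI mult_mono powr_mono2)
        fix i j :: nat and x k assume "i \<le> j"
        then show "u k i x \<le> u k j x" "v k i x \<le> v k j x" using u(3) v(3) by (auto simp: incseq_def)
      qed (use p u(2) v(2) in auto)
      show "(\<lambda>i. \<Sum>k<N. ennreal (u k i x * v k i x powr p)) \<longlonglongrightarrow> (\<Sum>k<N. ennreal (b k x * g k x powr p))" for x
        using u(4) v(4) v(2) p by (intro tendsto_sum tendsto_ennrealI tendsto_mult tendsto_powr2) auto
    qed auto
    moreover have "(\<integral>\<^sup>+x. (\<Sum>k<N. ennreal (u k i x * v k i x powr p)) \<partial>\<mu>) \<le> dyadic_bellman p F ff M C" for i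
    proof -
      have "(\<integral>\<^sup>+x. (\<Sum>k<N. ennreal (u k i x * v k i x powr p)) \<partial>\<mu>) = (\<integral>\<^sup>+x. ennreal (\<Sum>k<N. u k i x * v k i x powr p) \<partial>\<mu>)"
        using u(2) by (simp add: sum_ennreal)
      also have "\<dots> = ennreal (LINT x|\<mu>. (\<Sum>k<N. u k i x * v k i x powr p))"
        using iuv u(2) by (intro nn_integral_eq_integral) (auto intro!: sum_nonneg)
      finally show ?thesis using bound by simp
    qed
    ultimately show ?thesis unfolding eq by (intro LIMSEQ_le_const2) auto
  qed
  then have "(\<Sum>n. \<integral>\<^sup>+x. ennreal (\<alpha> n x * real_cond_exp \<mu> (Fn n) f x powr p) \<partial>\<mu>) \<le> dyadic_bellman p F ff M C"
    by (intro suminf_le_const summableI)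
  then show ?thesis by (subst nn_integral_suminf) auto
qed

lemma mart_bellman_le:
  assumes "p > 1" "C > 0" "0 \<le> M" "M \<le> C"
  shows "mart_bellman \<mu> Fn p F ff M C \<le> dyadic_bellman p F ff M C"
  unfolding mart_bellman_def using mart_value_le_bellman[OF assms] by (auto intro!: Sup_least)

end

section \<open>Almost independent signs in an infinitely refining filtration\<close>

text \<open>The conditional expectation of \<open>\<phi>\<close> after \<open>i\<close> further
  steps of a fair binary walk now at \<open>k\<close>: the ideal value against which the actual walk
  is compared.\<close>

definition descendant_avg :: "nat \<Rightarrow> (nat \<Rightarrow> real) \<Rightarrow> nat \<Rightarrow> real" where
  "descendant_avg i \<phi> k = (\<Sum>m<2 ^ i. \<phi> (k * 2 ^ i + m)) / 2 ^ i"

lemma descendant_avg_0 [simp]: "descendant_avg 0 \<phi> k = \<phi> k"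
  by (simp add: descendant_avg_def)

lemma sum_lessThan_even_odd:
  fixes g :: "nat \<Rightarrow> 'b::comm_monoid_add"
  shows "(\<Sum>m<2 * n. g m) = (\<Sum>m<n. g (2 * m) + g (2 * m + 1))"
  by (induction n) (simp_all add: add.assoc)

text \<open>The last generation is averaged first, in step with the tower property, which integrates
  out the last sign first.\<close>

lemma descendant_avg_Suc:
  "descendant_avg (Suc i) \<phi> k = descendant_avg i (\<lambda>k. (\<phi> (2 * k) + \<phi> (2 * k + 1)) / 2) k"
proof -
  have "(\<Sum>m<2 ^ Suc i. \<phi> (k * 2 ^ Suc i + m)) = (\<Sum>m<2 ^ i. \<phi> (2 * (k * 2 ^ i + m)) + \<phi> (2 * (k * 2 ^ i + m) + 1))"
    unfolding power_Suc sum_lessThan_even_odd by (intro sum.cong refl) (simp add: algebra_simps)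
  then show ?thesis by (simp add: descendant_avg_def sum_divide_distrib[symmetric])
qed

lemma descendant_avg_mono:
  assumes "\<And>k. \<phi> k \<le> \<psi> k"
  shows "descendant_avg i \<phi> k \<le> descendant_avg i \<psi> k"
  unfolding descendant_avg_def by (intro divide_right_mono sum_mono assms) auto

lemma descendant_avg_const [simp]: "descendant_avg i (\<lambda>_. c) k = c"
  by (simp add: descendant_avg_def)

lemma abs_descendant_avg_le:
  assumes "\<And>k. \<bar>\<phi> k\<bar> \<le> L"
  shows "\<bar>descendant_avg i \<phi> k\<bar> \<le> L"
proof -
  have "\<phi> k \<le> L" "- L \<le> \<phi> k" for k using assms[of k] by auto
  then show ?thesis
    using descendant_avg_mono[of \<phi> "\<lambda>_. L" i k] descendant_avg_mono[of "\<lambda>_. - L" \<phi> i k] by simp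
qed

text \<open>The index of the dyadic interval of generation \<open>j\<close> reached by reading \<open>h 1, \<dots>, h j\<close> as binary digits.\<close>

primrec walk :: "(nat \<Rightarrow> 'a \<Rightarrow> real) \<Rightarrow> nat \<Rightarrow> 'a \<Rightarrow> nat" where
  "walk h 0 x = 0"
| "walk h (Suc j) x = 2 * walk h j x + (if h (Suc j) x = 1 then 1 else 0)"

lemma walk_less: "walk h j x < 2 ^ j"
  by (induction j) auto

context filtered_space
begin

lemma integrable_bounded:
  fixes g :: "'a \<Rightarrow> real"
  assumes "g \<in> borel_measurable \<mu>" "\<And>x. x \<in> space \<mu> \<Longrightarrow> \<bar>g x\<bar> \<le> B"
  shows "integrable \<mu> g"
  by (rule integrable_const_bound[where B = B]) (use assms in auto)

text \<open>Contraction in L1: an error made at a later level does not grow when conditioned on an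
  earlier one.\<close>

lemma integral_abs_cond_exp_le:
  assumes "integrable \<mu> Z"
  shows "(LINT x|\<mu>. \<bar>real_cond_exp \<mu> (Fn n) Z x\<bar>) \<le> (LINT x|\<mu>. \<bar>Z x\<bar>)"
proof -
  interpret s: sigma_finite_subalgebra \<mu> "Fn n" by (rule sigma_finite_Fn)
  have "AE x in \<mu>. real_cond_exp \<mu> (Fn n) Z x \<le> real_cond_exp \<mu> (Fn n) (\<lambda>x. \<bar>Z x\<bar>) x"
    by (rule s.real_cond_exp_mono) (use assms in auto)
  moreover have "AE x in \<mu>. real_cond_exp \<mu> (Fn n) (\<lambda>x. - 1 * Z x) x \<le> real_cond_exp \<mu> (Fn n) (\<lambda>x. \<bar>Z x\<bar>) x"
    by (rule s.real_cond_exp_mono) (use assms in auto)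
  moreover have "AE x in \<mu>. real_cond_exp \<mu> (Fn n) (\<lambda>x. - 1 * Z x) x = - 1 * real_cond_exp \<mu> (Fn n) Z x"
    by (rule s.real_cond_exp_cmult[OF assms])
  ultimately have "AE x in \<mu>. \<bar>real_cond_exp \<mu> (Fn n) Z x\<bar> \<le> real_cond_exp \<mu> (Fn n) (\<lambda>x. \<bar>Z x\<bar>) x"
    by eventually_elim auto
  then have "(LINT x|\<mu>. \<bar>real_cond_exp \<mu> (Fn n) Z x\<bar>) \<le> (LINT x|\<mu>. real_cond_exp \<mu> (Fn n) (\<lambda>x. \<bar>Z x\<bar>) x)"
    using assms by (intro integral_mono_AE) auto
  then show ?thesis using s.real_cond_exp_int(2)[of "\<lambda>x. \<bar>Z x\<bar>"] assms by simp
qed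

text \<open>Dependent choice: the level that makes one sign measurable is the level given which the
  next sign must have small conditional mean. Starting at level 0, with its trivial
  \<sigma>-algebra, will turn the first conditional expectations into plain expectations.\<close>

lemma ex_near_rademacher:
  assumes "infinitely_refining \<mu> Fn" "\<eta> > 0"
  obtains n h where "n 0 = (0::nat)" "strict_mono n" "\<And>j. h j \<in> borel_measurable (Fn (n j))"
    "\<And>j x. x \<in> space \<mu> \<Longrightarrow> \<bar>h j x :: real\<bar> = 1"
    "\<And>j. (LINT x|\<mu>. \<bar>real_cond_exp \<mu> (Fn (n j)) (h (Suc j)) x\<bar>) \<le> \<eta>"
proof -
  define P where "P j y \<longleftrightarrow> (case y of (n, h) \<Rightarrow> (j = 0 \<longrightarrow> n = 0) \<and> h \<in> borel_measurable (Fn n) \<and> (\<forall>x\<in>space \<mu>. \<bar>h x :: real\<bar> = 1))"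
    for j :: nat and y
  define Q where "Q j y y' \<longleftrightarrow> (case y of (n, h) \<Rightarrow> case y' of (n', h') \<Rightarrow>
    n < n' \<and> (LINT x|\<mu>. \<bar>real_cond_exp \<mu> (Fn n) h' x\<bar>) \<le> \<eta>)" for j :: nat and y :: "nat \<times> ('a \<Rightarrow> real)" and y' :: "nat \<times> ('a \<Rightarrow> real)"
  have step: "\<exists>y'. P (Suc j) y' \<and> Q j y y'" for j y
  proof (cases y)
    case (Pair n h)
    have "space \<mu> \<in> sets (Fn n)" using sets.top[of "Fn n"] by simp
    then obtain k h' where k: "k > n" "h' \<in> borel_measurable (Fn k)"
      "\<And>x. x \<in> space \<mu> \<Longrightarrow> \<bar>h' x * indicator (space \<mu>) x :: real\<bar> = indicator (space \<mu>) x"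
      "(LINT x|\<mu>. \<bar>real_cond_exp \<mu> (Fn n) h' x\<bar> * indicator (space \<mu>) x) \<le> \<eta>"
      using assms(1)[unfolded infinitely_refining_def, rule_format, OF assms(2), of "space \<mu>" n] by blast
    have "(LINT x|\<mu>. \<bar>real_cond_exp \<mu> (Fn n) h' x\<bar> * indicator (space \<mu>) x) = (LINT x|\<mu>. \<bar>real_cond_exp \<mu> (Fn n) h' x\<bar>)"
      by (intro Bochner_Integration.integral_cong) auto
    then have "P (Suc j) (k, h') \<and> Q j y (k, h')" using k by (simp add: P_def Q_def Pair)
    then show ?thesis by blast
  qed
  \<comment> \<open>The entry at index 0 is a placeholder; the walk reads only
    \<open>h 1, h 2, \<dots>\<close>.\<close>
  have "\<exists>y. P 0 y" by (rule exI[of _ "(0, \<lambda>_. 1)"]) (simp add: P_def)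
  then obtain y where y: "\<And>j. P j (y j)" "\<And>j. Q j (y j) (y (Suc j))"
    using dependent_nat_choice[of P Q] step by metis
  define n where "n = (\<lambda>j. fst (y j))"
  define h where "h = (\<lambda>j. snd (y j))"
  show ?thesis
  proof (rule that[of n h])
    show "n 0 = 0" using y(1)[of 0] by (simp add: P_def n_def split: prod.splits)
    have "n j < n (Suc j)" for j using y(2)[of j] by (simp add: Q_def n_def split: prod.splits)
    then show "strict_mono n" by (simp add: strict_mono_Suc_iff)
    show "h j \<in> borel_measurable (Fn (n j))" "\<And>x. x \<in> space \<mu> \<Longrightarrow> \<bar>h j x\<bar> = 1" for j
      using y(1)[of j] by (auto simp: P_def n_def h_def split: prod.splits)
    show "(LINT x|\<mu>. \<bar>real_cond_exp \<mu> (Fn (n j)) (h (Suc j)) x\<bar>) \<le> \<eta>" for j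
      using y(2)[of j] by (simp add: Q_def n_def h_def split: prod.splits)
  qed
qed

end

locale near_rademacher = filtered_space +
  fixes n :: "nat \<Rightarrow> nat" and h :: "nat \<Rightarrow> 'a \<Rightarrow> real" and \<eta> :: real
  assumes n: "strict_mono n"
    and h_meas: "\<And>j. h j \<in> borel_measurable (Fn (n j))"
    and h_abs: "\<And>j x. x \<in> space \<mu> \<Longrightarrow> \<bar>h j x\<bar> = 1"
    and h_small: "\<And>j. (LINT x|\<mu>. \<bar>real_cond_exp \<mu> (Fn (n j)) (h (Suc j)) x\<bar>) \<le> \<eta>"
begin

lemma walk_measurable: "walk h j \<in> measurable (Fn (n j)) (count_space UNIV)"
proof (induction j)
  case 0
  then show ?case by simp
next
  case (Suc j)
  have [measurable]: "walk h j \<in> measurable (Fn (n (Suc j))) (count_space UNIV)"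
    by (rule measurable_Fn_mono[OF _ Suc]) (use n in \<open>auto simp: strict_mono_def less_imp_le\<close>)
  note [measurable] = h_meas[of "Suc j"]
  show ?case by simp
qed

lemma walk_comp_measurable:
  fixes \<phi> :: "nat \<Rightarrow> real"
  shows "(\<lambda>x. \<phi> (walk h j x)) \<in> borel_measurable (Fn (n j))"
  using measurable_compose[OF walk_measurable, of \<phi> borel] by simp

text \<open>Each step costs at most \<open>L * \<eta>\<close>. The value of \<open>\<phi>\<close> at
  the next position is the mean \<open>\<psi>\<close> over the two children plus \<open>D\<close>
  times the sign; \<open>D\<close> is measurable at the earlier level and bounded by
  \<open>L\<close>, so it can be pulled out of the conditional expectation. By contraction in L1 the
  costs of the \<open>i\<close> steps add up.\<close>

lemma cond_exp_walk:
  fixes \<phi> :: "nat \<Rightarrow> real"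
  assumes "\<And>k. \<bar>\<phi> k\<bar> \<le> L"
  shows "(LINT x|\<mu>. \<bar>real_cond_exp \<mu> (Fn (n j)) (\<lambda>x. \<phi> (walk h (j + i) x)) x - descendant_avg i \<phi> (walk h j x)\<bar>) \<le> real i * L * \<eta>"
  using assms
proof (induction i arbitrary: \<phi>)
  case 0
  interpret s: sigma_finite_subalgebra \<mu> "Fn (n j)" by (rule sigma_finite_Fn)
  have "integrable \<mu> (\<lambda>x. \<phi> (walk h j x))"
    using 0 by (intro integrable_bounded measurable_Fn[OF walk_comp_measurable])
  then have "AE x in \<mu>. real_cond_exp \<mu> (Fn (n j)) (\<lambda>x. \<phi> (walk h j x)) x = \<phi> (walk h j x)"
    using walk_comp_measurable by (intro s.real_cond_exp_F_meas)
  then have "(LINT x|\<mu>. \<bar>real_cond_exp \<mu> (Fn (n j)) (\<lambda>x. \<phi> (walk h j x)) x - \<phi> (walk h j x)\<bar>) = 0"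
    by (intro integral_eq_zero_AE) auto
  then show ?case by simp
next
  case (Suc i)
  interpret s: sigma_finite_subalgebra \<mu> "Fn (n j)" by (rule sigma_finite_Fn)
  define m where "m = j + i"
  interpret m: sigma_finite_subalgebra \<mu> "Fn (n m)" by (rule sigma_finite_Fn)
  have nm: "n j \<le> n m" using n by (simp add: m_def strict_mono_less_eq)
  define \<psi> where "\<psi> k = (\<phi> (2 * k) + \<phi> (2 * k + 1)) / 2" for k
  define D where "D k = (\<phi> (2 * k + 1) - \<phi> (2 * k)) / 2" for k
  have \<psi>: "\<bar>\<psi> k\<bar> \<le> L" and D: "\<bar>D k\<bar> \<le> L" for k
    using Suc.prems[of "2 * k"] Suc.prems[of "2 * k + 1"] by (auto simp: \<psi>_def D_def abs_le_iff field_simps)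
  have L: "0 \<le> L" using abs_ge_zero[of "\<phi> 0"] Suc.prems[of 0] by linarith
  note [measurable] = measurable_Fn[OF walk_comp_measurable] measurable_Fn[OF h_meas]
  have h_int: "integrable \<mu> (h k)" for k
    by (rule integrable_bounded[where B = 1]) (use h_abs in auto)
  have Dh_le: "\<bar>D (walk h m x) * h (Suc m) x\<bar> \<le> L" if "x \<in> space \<mu>" for x
    using D h_abs[OF that] by (simp add: abs_mult)
  have int1: "integrable \<mu> (\<lambda>x. \<psi> (walk h m x))" using \<psi> by (intro integrable_bounded) auto
  have int2: "integrable \<mu> (\<lambda>x. D (walk h m x) * h (Suc m) x)" using Dh_le by (intro integrable_bounded) auto
  have eq: "\<phi> (walk h (Suc m) x) = \<psi> (walk h m x) + D (walk h m x) * h (Suc m) x" if "x \<in> space \<mu>" for x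
  proof -
    have "h (Suc m) x = 1 \<or> h (Suc m) x = - 1" using h_abs[OF that, of "Suc m"] by linarith
    then show ?thesis by (elim disjE) (simp_all add: \<psi>_def D_def add_divide_distrib diff_divide_distrib)
  qed
  have "AE x in \<mu>. real_cond_exp \<mu> (Fn (n j)) (\<lambda>x. \<phi> (walk h (Suc m) x)) x
      = real_cond_exp \<mu> (Fn (n j)) (\<lambda>x. \<psi> (walk h m x) + D (walk h m x) * h (Suc m) x) x"
    by (rule s.real_cond_exp_cong, rule AE_I2, erule eq) measurable
  moreover have "AE x in \<mu>. real_cond_exp \<mu> (Fn (n j)) (\<lambda>x. \<psi> (walk h m x) + D (walk h m x) * h (Suc m) x) x
      = real_cond_exp \<mu> (Fn (n j)) (\<lambda>x. \<psi> (walk h m x)) x + real_cond_exp \<mu> (Fn (n j)) (\<lambda>x. D (walk h m x) * h (Suc m) x) x"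
    by (rule s.real_cond_exp_add[OF int1 int2])
  moreover have "AE x in \<mu>. real_cond_exp \<mu> (Fn (n j)) (real_cond_exp \<mu> (Fn (n m)) (\<lambda>x. D (walk h m x) * h (Suc m) x)) x
      = real_cond_exp \<mu> (Fn (n j)) (\<lambda>x. D (walk h m x) * h (Suc m) x) x"
    by (rule s.real_cond_exp_nested_subalg[OF subalg subalg_mono[OF nm] int2])
  ultimately have AE1: "AE x in \<mu>. \<bar>real_cond_exp \<mu> (Fn (n j)) (\<lambda>x. \<phi> (walk h (Suc m) x)) x - descendant_avg i \<psi> (walk h j x)\<bar>
    \<le> \<bar>real_cond_exp \<mu> (Fn (n j)) (\<lambda>x. \<psi> (walk h m x)) x - descendant_avg i \<psi> (walk h j x)\<bar>
      + \<bar>real_cond_exp \<mu> (Fn (n j)) (real_cond_exp \<mu> (Fn (n m)) (\<lambda>x. D (walk h m x) * h (Suc m) x)) x\<bar>"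
    by eventually_elim linarith
  have avg_int: "integrable \<mu> (\<lambda>x. descendant_avg i \<psi> (walk h j x))"
    by (rule integrable_bounded[OF measurable_Fn[OF walk_comp_measurable] abs_descendant_avg_le[OF \<psi>]])
  have \<phi>_int: "integrable \<mu> (\<lambda>x. \<phi> (walk h (Suc m) x))"
    by (rule integrable_bounded[OF measurable_Fn[OF walk_comp_measurable] Suc.prems])
  note ci = s.real_cond_exp_int(1) m.real_cond_exp_int(1)
  have ciDh: "integrable \<mu> (real_cond_exp \<mu> (Fn (n m)) (\<lambda>x. D (walk h m x) * h (Suc m) x))" by (rule ci[OF int2])
  have AE2: "AE x in \<mu>. \<bar>real_cond_exp \<mu> (Fn (n m)) (\<lambda>x. D (walk h m x) * h (Suc m) x) x\<bar>
      \<le> L * \<bar>real_cond_exp \<mu> (Fn (n m)) (h (Suc m)) x\<bar>"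
  proof -
    have "AE x in \<mu>. real_cond_exp \<mu> (Fn (n m)) (\<lambda>x. D (walk h m x) * h (Suc m) x) x
      = D (walk h m x) * real_cond_exp \<mu> (Fn (n m)) (h (Suc m)) x"
      by (rule m.real_cond_exp_mult[OF walk_comp_measurable _ int2]) measurable
    then show ?thesis
    proof eventually_elim
      case (elim x)
      show ?case unfolding elim abs_mult by (intro mult_right_mono D) simp
    qed
  qed
  have "(LINT x|\<mu>. \<bar>real_cond_exp \<mu> (Fn (n j)) (\<lambda>x. \<phi> (walk h (Suc m) x)) x - descendant_avg i \<psi> (walk h j x)\<bar>)
    \<le> (LINT x|\<mu>. \<bar>real_cond_exp \<mu> (Fn (n j)) (\<lambda>x. \<psi> (walk h m x)) x - descendant_avg i \<psi> (walk h j x)\<bar>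
      + \<bar>real_cond_exp \<mu> (Fn (n j)) (real_cond_exp \<mu> (Fn (n m)) (\<lambda>x. D (walk h m x) * h (Suc m) x)) x\<bar>)"
    using AE1 by (rule integral_mono_AE[rotated 2])
      (intro Bochner_Integration.integrable_add integrable_abs Bochner_Integration.integrable_diff ci \<phi>_int int1 avg_int ciDh)+
  also have "\<dots> = (LINT x|\<mu>. \<bar>real_cond_exp \<mu> (Fn (n j)) (\<lambda>x. \<psi> (walk h m x)) x - descendant_avg i \<psi> (walk h j x)\<bar>)
      + (LINT x|\<mu>. \<bar>real_cond_exp \<mu> (Fn (n j)) (real_cond_exp \<mu> (Fn (n m)) (\<lambda>x. D (walk h m x) * h (Suc m) x)) x\<bar>)"
    by (rule Bochner_Integration.integral_add)
      (intro integrable_abs Bochner_Integration.integrable_diff ci int1 avg_int ciDh)+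
  also have "\<dots> \<le> real i * L * \<eta> + L * \<eta>"
  proof (rule add_mono)
    show "(LINT x|\<mu>. \<bar>real_cond_exp \<mu> (Fn (n j)) (\<lambda>x. \<psi> (walk h m x)) x - descendant_avg i \<psi> (walk h j x)\<bar>) \<le> real i * L * \<eta>"
      unfolding m_def by (rule Suc.IH[OF \<psi>])
    have "(LINT x|\<mu>. \<bar>real_cond_exp \<mu> (Fn (n j)) (real_cond_exp \<mu> (Fn (n m)) (\<lambda>x. D (walk h m x) * h (Suc m) x)) x\<bar>)
      \<le> (LINT x|\<mu>. \<bar>real_cond_exp \<mu> (Fn (n m)) (\<lambda>x. D (walk h m x) * h (Suc m) x) x\<bar>)"
      by (rule integral_abs_cond_exp_le[OF ciDh])
    also have "\<dots> \<le> (LINT x|\<mu>. L * \<bar>real_cond_exp \<mu> (Fn (n m)) (h (Suc m)) x\<bar>)"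
      by (rule integral_mono_AE[OF _ _ AE2]) (intro integrable_abs integrable_mult_right ciDh ci h_int)+
    also have "\<dots> = L * (LINT x|\<mu>. \<bar>real_cond_exp \<mu> (Fn (n m)) (h (Suc m)) x\<bar>)" by simp
    also have "\<dots> \<le> L * \<eta>" using L h_small by (intro mult_left_mono) auto
    finally show "(LINT x|\<mu>. \<bar>real_cond_exp \<mu> (Fn (n j)) (real_cond_exp \<mu> (Fn (n m)) (\<lambda>x. D (walk h m x) * h (Suc m) x)) x\<bar>) \<le> L * \<eta>" .
  qed
  finally show ?case
    unfolding descendant_avg_Suc \<psi>_def[symmetric] m_def by (simp add: algebra_simps)
qed

end

context filtered_space
begin

text \<open>The walk is chosen before \<open>\<phi>\<close> and the levels, so a single walk
  transports the function and all coefficients at once.\<close>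

lemma ex_approximate_walk:
  fixes L \<epsilon> :: real and N :: nat
  assumes "infinitely_refining \<mu> Fn" "\<epsilon> > 0" "L \<ge> 0"
  obtains n w where "n 0 = (0::nat)" "strict_mono n" "\<And>j. w j \<in> measurable (Fn (n j)) (count_space (UNIV :: nat set))"
    "\<And>j x. w j x < 2 ^ j"
    "\<forall>\<phi> i j. (\<forall>k. \<bar>\<phi> k\<bar> \<le> L) \<longrightarrow> j + i \<le> N \<longrightarrow>
      (LINT x|\<mu>. \<bar>real_cond_exp \<mu> (Fn (n j)) (\<lambda>x. \<phi> (w (j + i) x)) x - descendant_avg i \<phi> (w j x)\<bar>) \<le> \<epsilon>"
proof -
  \<comment> \<open>At most \<open>N\<close> steps of cost \<open>L * \<eta>\<close> each are taken;
    the added 1 keeps the denominator positive when \<open>N * L = 0\<close>.\<close>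
  define \<eta> where "\<eta> = \<epsilon> / (real N * L + 1)"
  have pos: "real N * L + 1 > 0" using assms by (simp add: add_nonneg_pos)
  then have "\<eta> > 0" using assms by (simp add: \<eta>_def)
  then obtain n h where nh: "n 0 = (0::nat)" "strict_mono n" "\<And>j. h j \<in> borel_measurable (Fn (n j))"
    "\<And>j x. x \<in> space \<mu> \<Longrightarrow> \<bar>h j x :: real\<bar> = 1"
    "\<And>j. (LINT x|\<mu>. \<bar>real_cond_exp \<mu> (Fn (n j)) (h (Suc j)) x\<bar>) \<le> \<eta>"
    using ex_near_rademacher[OF assms(1)] by metis
  interpret near_rademacher \<mu> Fn n h \<eta> by unfold_locales (use nh in auto)
  show ?thesis
  proof (rule that[of n "walk h"], goal_cases)
    case 5
    show ?case
    proof (intro allI impI)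
      fix \<phi> :: "nat \<Rightarrow> real" and i j assume \<phi>: "\<forall>k. \<bar>\<phi> k\<bar> \<le> L" and ij: "j + i \<le> N"
      have "real i * L * \<eta> \<le> (real N * L + 1) * \<eta>"
        using ij assms \<open>\<eta> > 0\<close> by (intro mult_right_mono) (auto intro!: mult_right_mono add_increasing2)
      also have "\<dots> = \<epsilon>" using pos by (simp add: \<eta>_def)
      finally have "real i * L * \<eta> \<le> \<epsilon>" .
      moreover have "(LINT x|\<mu>. \<bar>real_cond_exp \<mu> (Fn (n j)) (\<lambda>x. \<phi> (walk h (j + i) x)) x - descendant_avg i \<phi> (walk h j x)\<bar>) \<le> real i * L * \<eta>"
        by (rule cond_exp_walk) (simp add: \<phi>)
      ultimately show "(LINT x|\<mu>. \<bar>real_cond_exp \<mu> (Fn (n j)) (\<lambda>x. \<phi> (walk h (j + i) x)) x - descendant_avg i \<phi> (walk h j x)\<bar>) \<le> \<epsilon>"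
        by linarith
    qed
  qed (use nh walk_measurable walk_less in auto)
qed

end

section \<open>Correcting moments and the Carleson condition\<close>

context filtered_space
begin

lemma abs_expectation_diff_le:
  assumes "integrable \<mu> X" "integrable \<mu> Y" "(LINT x|\<mu>. \<bar>real_cond_exp \<mu> (Fn n) X x - Y x\<bar>) \<le> \<epsilon>"
  shows "\<bar>(LINT x|\<mu>. X x) - (LINT x|\<mu>. Y x)\<bar> \<le> \<epsilon>"
proof -
  interpret s: sigma_finite_subalgebra \<mu> "Fn n" by (rule sigma_finite_Fn)
  have "(LINT x|\<mu>. X x) - (LINT x|\<mu>. Y x) = (LINT x|\<mu>. real_cond_exp \<mu> (Fn n) X x - Y x)"
    using assms(1,2) s.real_cond_exp_int[OF assms(1)] by simp
  then show ?thesis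
    using order_trans[OF integral_abs_bound[of \<mu> "\<lambda>x. real_cond_exp \<mu> (Fn n) X x - Y x"] assms(3)] by (simp only:)
qed

text \<open>The event that the walk is at 0 in generation \<open>J\<close> has probability within
  \<open>q / 2\<close> of \<open>q\<close>, the J-th power of 1/2. Such sets will carry concentrated
  mass.\<close>

lemma ex_small_set:
  assumes "infinitely_refining \<mu> Fn" "0 < \<kappa>"
  obtains S where "S \<in> sets \<mu>" "0 < measure \<mu> S" "measure \<mu> S < \<kappa>"
proof -
  obtain J where J: "(1/2 :: real) ^ J < \<kappa> / 2"
    using real_arch_pow_inv[of "\<kappa> / 2" "1/2"] assms(2) by auto
  define q :: real where "q = (1/2) ^ J"
  have q: "0 < q" "q < \<kappa> / 2" "q \<le> 1" using J by (auto simp: q_def power_le_one)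
  obtain n w where "n 0 = (0::nat)" "strict_mono n" and nw: "\<And>j. w j \<in> measurable (Fn (n j)) (count_space (UNIV :: nat set))" "\<And>j x. w j x < 2 ^ j"
    "\<forall>\<phi> i j. (\<forall>k. \<bar>\<phi> k\<bar> \<le> 1) \<longrightarrow> j + i \<le> J \<longrightarrow>
      (LINT x|\<mu>. \<bar>real_cond_exp \<mu> (Fn (n j)) (\<lambda>x. \<phi> (w (j + i) x)) x - descendant_avg i \<phi> (w j x)\<bar>) \<le> q / 2"
  proof (rule ex_approximate_walk[OF assms(1), of "q / 2" 1 J])
    show "0 < q / 2" using q by simp
  qed (simp, rule that)
  define \<phi> :: "nat \<Rightarrow> real" where "\<phi> = indicator {0}"
  have w0: "w 0 x = 0" for x using nw(2)[of 0 x] by simp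
  have avg: "descendant_avg J \<phi> 0 = q"
    by (simp add: descendant_avg_def \<phi>_def q_def indicator_def power_one_over)
  note [measurable] = measurable_Fn[OF nw(1)]
  define S where "S = {x \<in> space \<mu>. w J x = 0}"
  have S: "S \<in> sets \<mu>" unfolding S_def by measurable
  have "(LINT x|\<mu>. \<bar>real_cond_exp \<mu> (Fn (n 0)) (\<lambda>x. \<phi> (w J x)) x - q\<bar>) \<le> q / 2"
  proof -
    have "\<forall>k. \<bar>\<phi> k\<bar> \<le> 1" by (simp add: \<phi>_def indicator_def)
    then show ?thesis
      using nw(3)[THEN spec[of _ \<phi>], THEN spec[of _ J], THEN spec[of _ 0]] by (simp add: w0 avg)
  qed
  then have "\<bar>(LINT x|\<mu>. \<phi> (w J x)) - (LINT x|\<mu>. q)\<bar> \<le> q / 2"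
    by (intro abs_expectation_diff_le[where n = "n 0"] integrable_bounded[where B = 1]) (use q in \<open>auto simp: \<phi>_def indicator_def\<close>)
  moreover have "(LINT x|\<mu>. \<phi> (w J x)) = measure \<mu> S"
  proof -
    have "(LINT x|\<mu>. \<phi> (w J x)) = (LINT x|\<mu>. indicator S x)"
      by (intro Bochner_Integration.integral_cong) (auto simp: \<phi>_def S_def indicator_def)
    then show ?thesis using S by simp
  qed
  ultimately have "\<bar>measure \<mu> S - q\<bar> \<le> q / 2" by (simp add: prob_space)
  then have "0 < measure \<mu> S" "measure \<mu> S < \<kappa>" using q by linarith+
  then show ?thesis by (rule that[OF S])
qed

text \<open>Spreading the missing mean \<open>m\<close> over the whole space gives too small a \<open>p\<close>-th moment,
  concentrating it on a small set gives too large a one; the mixture is found by the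
  intermediate value theorem.\<close>

lemma ex_exact_moments:
  fixes u :: "'a \<Rightarrow> real"
  assumes "infinitely_refining \<mu> Fn" and p: "p > 1" and u: "u \<in> borel_measurable \<mu>" "\<And>x. x \<in> space \<mu> \<Longrightarrow> 0 \<le> u x" "\<And>x. x \<in> space \<mu> \<Longrightarrow> u x \<le> B"
    and m: "0 < m" and F: "(LINT x|\<mu>. (u x + m) powr p) \<le> F"
  obtains f where "f \<in> borel_measurable \<mu>" "\<And>x. x \<in> space \<mu> \<Longrightarrow> u x \<le> f x" "integrable \<mu> f" "integrable \<mu> (\<lambda>x. f x powr p)"
    "(LINT x|\<mu>. f x) = (LINT x|\<mu>. u x) + m" "(LINT x|\<mu>. f x powr p) = F"
proof -
  note [measurable] = u(1)
  obtain x0 where "x0 \<in> space \<mu>" using not_empty by auto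
  then have B: "0 \<le> B" using u(2,3) by (meson order_trans)
  have bdd_powr: "integrable \<mu> (\<lambda>x. g x powr p)"
    if "g \<in> borel_measurable \<mu>" "\<And>x. x \<in> space \<mu> \<Longrightarrow> 0 \<le> g x" "\<And>x. x \<in> space \<mu> \<Longrightarrow> g x \<le> R" for g R
    using that p by (intro integrable_bounded[where B = "R powr p"]) (auto intro!: powr_mono2)
  have "m powr p = (LINT x|\<mu>. m powr p)" by (simp add: prob_space)
  also have "\<dots> \<le> (LINT x|\<mu>. (u x + m) powr p)"
    using u m p B by (intro integral_mono bdd_powr[of _ "B + m"]) (auto intro!: powr_mono2)
  finally have "m powr p \<le> F" using F by simp
  moreover have mp: "0 < m powr p" using m by simp
  ultimately have Fpos: "0 < F" by linarith
  \<comment> \<open>The threshold is the measure \<open>q\<close> for which height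
    \<open>m / q\<close> on a set of measure \<open>q\<close> has p-th moment exactly
    \<open>F\<close>; smaller sets give at least \<open>F\<close>.\<close>
  have "0 < (m powr p / F) powr (1 / (p - 1))" using mp Fpos by simp
  then obtain S where S [measurable]: "S \<in> sets \<mu>" and S': "0 < measure \<mu> S" "measure \<mu> S < (m powr p / F) powr (1 / (p - 1))"
    using ex_small_set[OF assms(1)] by metis
  define q where "q = measure \<mu> S"
  have q: "0 < q" using S' by (simp add: q_def)
  have "q powr (p - 1) \<le> ((m powr p / F) powr (1 / (p - 1))) powr (p - 1)"
    using S' p by (intro powr_mono2) (auto simp: q_def)
  also have "\<dots> = m powr p / F" using mp Fpos p by (simp add: powr_powr)
  finally have "F * q powr (p - 1) \<le> m powr p" using Fpos by (simp add: field_simps)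
  then have Fq: "F \<le> (m / q) powr p * q"
    using q m by (simp add: powr_divide powr_diff field_simps)
  \<comment> \<open>For \<open>s\<close> in the unit interval the added function is non-negative
    with integral \<open>m\<close>: the mean is right throughout and only the p-th moment moves with
    \<open>s\<close>.\<close>
  define g where "g s x = u x + m * ((1 - s) + s * (indicator S x / q))" for s x
  define R where "R = B + m * (1 + 1 / q)"
  have [measurable]: "g s \<in> borel_measurable \<mu>" for s unfolding g_def by measurable
  have g_ge: "u x \<le> g s x" if "s \<in> {0..1}" for s x
    using that m q by (auto simp: g_def)
  have g_le: "g s x \<le> R" if "s \<in> {0..1}" "x \<in> space \<mu>" for s x
  proof -
    have "(1 - s) + s * (indicator S x / q) \<le> 1 + 1 * (1 / q)"
      using that q by (intro add_mono mult_mono divide_right_mono) (auto simp: indicator_def)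
    then show ?thesis using u(3)[OF that(2)] m by (auto simp: g_def R_def intro!: add_mono)
  qed
  have g_nn: "0 \<le> g s x" if "s \<in> {0..1}" "x \<in> space \<mu>" for s x
    using g_ge[OF that(1), of x] u(2)[OF that(2)] by linarith
  have g_int: "integrable \<mu> (\<lambda>x. g s x powr p)" if "s \<in> {0..1}" for s
    using g_nn[OF that] g_le[OF that] by (intro bdd_powr) auto
  define Phi where "Phi s = (LINT x|\<mu>. g s x powr p)" for s
  define Lc where "Lc = p * R powr (p - 1) * (m * (1 + 1 / q))"
  have lip: "Lc-lipschitz_on {0..1} Phi"
  proof (rule lipschitz_onI)
    show "0 \<le> Lc" using p m q by (simp add: Lc_def)
    fix s t :: real assume st: "s \<in> {0..1}" "t \<in> {0..1}"
    have "\<bar>g s x powr p - g t x powr p\<bar> \<le> Lc * \<bar>s - t\<bar>" if x: "x \<in> space \<mu>" for x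
    proof -
      have "\<bar>g s x powr p - g t x powr p\<bar> \<le> p * R powr (p - 1) * \<bar>g s x - g t x\<bar>"
        using g_nn g_le st x by (intro abs_powr_diff_le p) auto
      also have "g s x - g t x = m * (indicator S x / q - 1) * (s - t)"
        by (simp add: g_def algebra_simps diff_divide_distrib)
      also have "p * R powr (p - 1) * \<bar>m * (indicator S x / q - 1) * (s - t)\<bar>
        = p * R powr (p - 1) * (m * \<bar>indicator S x / q - 1\<bar> * \<bar>s - t\<bar>)"
        using m by (simp add: abs_mult)
      also have "\<dots> \<le> p * R powr (p - 1) * (m * (1 + 1 / q) * \<bar>s - t\<bar>)"
        using p m q by (intro mult_left_mono mult_right_mono) (auto simp: indicator_def abs_le_iff)
      finally show ?thesis by (simp add: Lc_def mult.assoc)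
    qed
    then have "(LINT x|\<mu>. \<bar>g s x powr p - g t x powr p\<bar>) \<le> (LINT x|\<mu>. Lc * \<bar>s - t\<bar>)"
      using g_int st by (intro integral_mono) auto
    moreover have "\<bar>Phi s - Phi t\<bar> \<le> (LINT x|\<mu>. \<bar>g s x powr p - g t x powr p\<bar>)"
    proof -
      have "Phi s - Phi t = (LINT x|\<mu>. g s x powr p - g t x powr p)" using g_int st by (simp add: Phi_def)
      then show ?thesis by (simp only: integral_abs_bound)
    qed
    ultimately show "dist (Phi s) (Phi t) \<le> Lc * dist s t" by (simp add: dist_real_def prob_space)
  qed
  have "Phi 0 \<le> F" using F by (simp add: Phi_def g_def)
  moreover have "F \<le> Phi 1"
  proof -
    have "(m / q) powr p * q = (LINT x|\<mu>. (m / q) powr p * indicator S x)"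
      using S by (simp add: q_def)
    also have "\<dots> \<le> Phi 1"
      unfolding Phi_def
    proof (rule integral_mono)
      fix x assume x: "x \<in> space \<mu>"
      show "(m / q) powr p * indicator S x \<le> g 1 x powr p"
        using u(2)[OF x] m q p by (auto simp: g_def indicator_def intro!: powr_mono2)
    qed (use g_int[of 1] S in \<open>auto simp: emeasure_eq_measure\<close>)
    finally show ?thesis using Fq by simp
  qed
  ultimately obtain s where s: "0 \<le> s" "s \<le> 1" "Phi s = F"
    using IVT'[of Phi 0 F 1] lipschitz_on_continuous_on[OF lip] by auto
  have gs_int: "integrable \<mu> (g s)"
    using g_nn g_le s by (intro integrable_bounded[where B = R]) auto
  have u_int: "integrable \<mu> u"
    using u by (intro integrable_bounded[where B = B]) auto
  have "(LINT x|\<mu>. g s x) = (LINT x|\<mu>. u x) + (LINT x|\<mu>. m * (1 - s) + m * s / q * indicator S x)"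
  proof -
    have "g s = (\<lambda>x. u x + (m * (1 - s) + m * s / q * indicator S x))" by (auto simp: g_def algebra_simps)
    then show ?thesis using u_int S by (simp add: emeasure_eq_measure)
  qed
  also have "(LINT x|\<mu>. m * (1 - s) + m * s / q * indicator S x) = m * (1 - s) + m * s / q * q"
    using S by (subst Bochner_Integration.integral_add) (auto simp: prob_space q_def emeasure_eq_measure)
  also have "\<dots> = m" using q by (simp add: algebra_simps)
  finally have "(LINT x|\<mu>. g s x) = (LINT x|\<mu>. u x) + m" .
  then show ?thesis
    using s gs_int g_int[of s] g_ge[of s] by (intro that[of "g s"]) (auto simp: Phi_def)
qed

lemma (in -) suminf_if_single:
  fixes c :: ennreal
  shows "(\<Sum>k. if r = m + k then c else 0) = (if m \<le> r then c else 0)"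
proof (cases "m \<le> r")
  case True
  then have "(\<Sum>k. if r = m + k then c else 0) = (\<Sum>k\<in>{r - m}. if r = m + k then c else 0)"
    by (intro suminf_finite) auto
  then show ?thesis using True by simp
qed auto

text \<open>\<open>\<beta>\<close> is supported on the levels \<open>\<nu> j\<close> and level 0. A
  set of a positive level \<open>m\<close> also belongs to the next chosen level, and the tails of
  \<open>\<beta>\<close> from both levels coincide, so only chosen levels need testing. Level 0 has
  only trivial sets and asks for \<open>M \<le> C\<close>.\<close>

lemma ex_carleson_seq_above:
  fixes \<nu> :: "nat \<Rightarrow> nat"
  assumes \<nu>: "strict_mono \<nu>" "\<nu> 0 = 0" and M: "0 \<le> M" "M \<le> C"
    and meas: "\<And>j. \<gamma> j \<in> borel_measurable (Fn (\<nu> j))" and bd: "\<And>j x. x \<in> space \<mu> \<Longrightarrow> 0 \<le> \<gamma> j x" "\<And>j x. x \<in> space \<mu> \<Longrightarrow> \<gamma> j x \<le> K"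
    and car: "\<And>j S. j \<le> N \<Longrightarrow> S \<in> sets (Fn (\<nu> j)) \<Longrightarrow> (LINT x:S|\<mu>. (\<Sum>i=j..N. \<gamma> i x)) \<le> C * measure \<mu> S"
    and tot: "(LINT x|\<mu>. (\<Sum>i=0..N. \<gamma> i x)) \<le> M"
  obtains \<beta> where "carleson_seq \<mu> Fn C \<beta>" "(\<integral>\<^sup>+x. (\<Sum>n. ennreal (\<beta> n x)) \<partial>\<mu>) = ennreal M"
    "\<And>j x. j \<le> N \<Longrightarrow> x \<in> space \<mu> \<Longrightarrow> \<gamma> j x \<le> \<beta> (\<nu> j) x"
proof -
  note [measurable] = measurable_Fn[OF meas]
  define d where "d = M - (LINT x|\<mu>. (\<Sum>i=0..N. \<gamma> i x))"
  have d: "0 \<le> d" using tot by (simp add: d_def)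
  define \<beta> where "\<beta> n x = (\<Sum>j=0..N. if \<nu> j = n then \<gamma> j x else 0) + (if n = 0 then d else 0)" for n x
  have \<gamma>_int: "integrable \<mu> (\<gamma> j)" for j
    using bd by (intro integrable_bounded[where B = K]) auto
  have \<beta>_meas: "\<beta> n \<in> borel_measurable (Fn n)" for n
  proof -
    have "(\<lambda>x. if \<nu> j = n then \<gamma> j x else 0) \<in> borel_measurable (Fn n)" for j
      using meas[of j] by (cases "\<nu> j = n") auto
    then show ?thesis unfolding \<beta>_def by measurable
  qed
  have \<beta>_nn: "0 \<le> \<beta> n x" if "x \<in> space \<mu>" for n x
    using bd(1)[OF that] d by (auto simp: \<beta>_def intro!: add_nonneg_nonneg sum_nonneg)
  have tail: "(\<Sum>k. ennreal (\<beta> (m + k) x)) = (\<Sum>j=0..N. if m \<le> \<nu> j then ennreal (\<gamma> j x) else 0) + (if m = 0 then ennreal d else 0)"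
    if x: "x \<in> space \<mu>" for m x
  proof -
    have "ennreal (\<beta> (m + k) x) = (\<Sum>j=0..N. if \<nu> j = m + k then ennreal (\<gamma> j x) else 0) + (if 0 = m + k then ennreal d else 0)" for k
    proof -
      have "ennreal (\<beta> (m + k) x) = ennreal (\<Sum>j=0..N. if \<nu> j = m + k then \<gamma> j x else 0) + ennreal (if m + k = 0 then d else 0)"
        unfolding \<beta>_def using bd(1)[OF x] d by (intro ennreal_plus sum_nonneg) auto
      also have "ennreal (\<Sum>j=0..N. if \<nu> j = m + k then \<gamma> j x else 0) = (\<Sum>j=0..N. ennreal (if \<nu> j = m + k then \<gamma> j x else 0))"
        using bd(1)[OF x] by (intro sum_ennreal[symmetric]) auto
      also have "\<dots> = (\<Sum>j=0..N. if \<nu> j = m + k then ennreal (\<gamma> j x) else 0)"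
        by (intro sum.cong) auto
      finally show ?thesis by simp
    qed
    then have "(\<Sum>k. ennreal (\<beta> (m + k) x)) = (\<Sum>k. (\<Sum>j=0..N. if \<nu> j = m + k then ennreal (\<gamma> j x) else 0) + (if 0 = m + k then ennreal d else 0))"
      by presburger
    also have "\<dots> = (\<Sum>k. \<Sum>j=0..N. if \<nu> j = m + k then ennreal (\<gamma> j x) else 0) + (\<Sum>k. if 0 = m + k then ennreal d else 0)"
      by (rule suminf_add[symmetric]) (rule summableI)+
    also have "(\<Sum>k. \<Sum>j=0..N. if \<nu> j = m + k then ennreal (\<gamma> j x) else 0) = (\<Sum>j=0..N. \<Sum>k. if \<nu> j = m + k then ennreal (\<gamma> j x) else 0)"
      by (rule suminf_sum) (rule summableI)
    finally show ?thesis unfolding suminf_if_single by simp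
  qed
  have nn_tail: "(\<integral>\<^sup>+x\<in>S. (\<Sum>j=i..N. ennreal (\<gamma> j x)) \<partial>\<mu>) = ennreal (LINT x:S|\<mu>. (\<Sum>j=i..N. \<gamma> j x))" if S: "S \<in> sets \<mu>" for S i
  proof -
    have "(\<integral>\<^sup>+x\<in>S. (\<Sum>j=i..N. ennreal (\<gamma> j x)) \<partial>\<mu>) = (\<integral>\<^sup>+x. ennreal (indicator S x *\<^sub>R (\<Sum>j=i..N. \<gamma> j x)) \<partial>\<mu>)"
      using bd(1) by (intro nn_integral_cong) (auto simp: indicator_def sum_ennreal)
    also have "\<dots> = ennreal (LINT x:S|\<mu>. (\<Sum>j=i..N. \<gamma> j x))"
      unfolding set_lebesgue_integral_def using S \<gamma>_int bd(1)
      by (intro nn_integral_eq_integral integrable_mult_indicator) (auto intro!: AE_I2 sum_nonneg mult_nonneg_nonneg)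
    finally show ?thesis .
  qed
  have total: "(\<integral>\<^sup>+x. (\<Sum>n. ennreal (\<beta> n x)) \<partial>\<mu>) = ennreal M"
  proof -
    have "(\<integral>\<^sup>+x. (\<Sum>n. ennreal (\<beta> n x)) \<partial>\<mu>) = (\<integral>\<^sup>+x. (\<Sum>j=0..N. ennreal (\<gamma> j x)) + ennreal d \<partial>\<mu>)"
      using tail[of _ 0] by (intro nn_integral_cong) auto
    also have "\<dots> = (\<integral>\<^sup>+x. (\<Sum>j=0..N. ennreal (\<gamma> j x)) \<partial>\<mu>) + ennreal d"
      by (subst nn_integral_add) (auto simp: emeasure_space_1)
    also have "(\<integral>\<^sup>+x. (\<Sum>j=0..N. ennreal (\<gamma> j x)) \<partial>\<mu>) = ennreal (LINT x|\<mu>. (\<Sum>i=0..N. \<gamma> i x))"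
    proof -
      have "(\<integral>\<^sup>+x. (\<Sum>j=0..N. ennreal (\<gamma> j x)) \<partial>\<mu>) = (\<integral>\<^sup>+x. ennreal (\<Sum>j=0..N. \<gamma> j x) \<partial>\<mu>)"
        using bd(1) by (intro nn_integral_cong) (auto simp: sum_ennreal)
      also have "\<dots> = ennreal (LINT x|\<mu>. (\<Sum>i=0..N. \<gamma> i x))"
        using \<gamma>_int bd(1) by (intro nn_integral_eq_integral) (auto intro!: AE_I2 sum_nonneg)
      finally show ?thesis .
    qed
    also have "ennreal (LINT x|\<mu>. (\<Sum>i=0..N. \<gamma> i x)) + ennreal d = ennreal M"
      using d bd(1) by (subst ennreal_plus[symmetric]) (auto simp: d_def intro!: integral_nonneg_AE AE_I2 sum_nonneg)
    finally show ?thesis .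
  qed
  have "carleson_seq \<mu> Fn C \<beta>"
    unfolding carleson_seq_iff
  proof (intro conjI allI ballI)
    fix m S assume S: "S \<in> sets (Fn m)"
    show "(\<integral>\<^sup>+x\<in>S. (\<Sum>k. ennreal (\<beta> (m + k) x)) \<partial>\<mu>) \<le> ennreal C * emeasure \<mu> S"
    proof (cases "m = 0")
      case True
      then have "S = {} \<or> S = space \<mu>" using S sets_Fn_0 by auto
      then show ?thesis
      proof
        assume "S = space \<mu>"
        then show ?thesis using total True M by (simp add: emeasure_space_1 ennreal_leI)
      qed simp
    next
      case False
      define i where "i = (LEAST i. m \<le> \<nu> i)"
      have "m \<le> \<nu> m" using strict_mono_imp_increasing[OF \<nu>(1)] by blast
      then have mi: "m \<le> \<nu> i" unfolding i_def by (rule LeastI)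
      have iff: "m \<le> \<nu> j \<longleftrightarrow> i \<le> j" for j
      proof
        show "i \<le> j" if "m \<le> \<nu> j" unfolding i_def using that by (rule Least_le)
        show "m \<le> \<nu> j" if "i \<le> j" using mi that \<nu>(1) by (meson order_trans strict_mono_less_eq)
      qed
      have eq: "(\<integral>\<^sup>+x\<in>S. (\<Sum>k. ennreal (\<beta> (m + k) x)) \<partial>\<mu>) = (\<integral>\<^sup>+x\<in>S. (\<Sum>j=i..N. ennreal (\<gamma> j x)) \<partial>\<mu>)"
      proof (rule nn_integral_cong)
        fix x assume x: "x \<in> space \<mu>"
        have "(\<Sum>j=0..N. if m \<le> \<nu> j then ennreal (\<gamma> j x) else 0) = (\<Sum>j=i..N. ennreal (\<gamma> j x))"
          unfolding iff by (intro sum.mono_neutral_cong_right) auto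
        then show "(\<Sum>k. ennreal (\<beta> (m + k) x)) * indicator S x = (\<Sum>j=i..N. ennreal (\<gamma> j x)) * indicator S x"
          using tail[OF x, of m] False by simp
      qed
      show ?thesis
      proof (cases "i \<le> N")
        case True
        have "(LINT x:S|\<mu>. (\<Sum>j=i..N. \<gamma> j x)) \<le> C * measure \<mu> S"
          by (rule car[OF True sets_Fn_mono[OF mi S]])
        then show ?thesis
          unfolding eq nn_tail[OF sets_Fn_subset[OF S]] using M
          by (simp add: emeasure_eq_measure ennreal_mult[symmetric] ennreal_leI)
      next
        case False
        then show ?thesis unfolding eq by simp
      qed
    qed
  qed (use \<beta>_meas \<beta>_nn in auto)
  moreover have "\<gamma> j x \<le> \<beta> (\<nu> j) x" if "j \<le> N" "x \<in> space \<mu>" for j x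
  proof -
    have "\<gamma> j x = (\<Sum>i\<in>{j}. if \<nu> i = \<nu> j then \<gamma> i x else 0)" by simp
    also have "\<dots> \<le> (\<Sum>i=0..N. if \<nu> i = \<nu> j then \<gamma> i x else 0)"
      using that bd(1) by (intro sum_mono2) auto
    also have "\<dots> \<le> \<beta> (\<nu> j) x" using d by (simp add: \<beta>_def)
    finally show ?thesis .
  qed
  ultimately show ?thesis using total that by blast
qed

text \<open>The sequence is switched off for good as soon as its conditional tail exceeds \<open>C / \<theta>\<close>.\<close>

lemma ex_stopping_sets:
  fixes \<nu> :: "nat \<Rightarrow> nat"
  assumes \<nu>: "strict_mono \<nu>" and C: "0 < C" and \<theta>: "0 < \<theta>" "\<theta> < 1"
    and meas: "\<And>j. \<alpha> j \<in> borel_measurable (Fn (\<nu> j))" and bd: "\<And>j x. x \<in> space \<mu> \<Longrightarrow> 0 \<le> \<alpha> j x" "\<And>j x. x \<in> space \<mu> \<Longrightarrow> \<alpha> j x \<le> K"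
    and \<psi>: "\<And>j. integrable \<mu> (\<psi> j)" "\<And>j x. x \<in> space \<mu> \<Longrightarrow> \<psi> j x \<le> C"
    and err: "\<And>j. j \<le> N \<Longrightarrow> (LINT x|\<mu>. \<bar>real_cond_exp \<mu> (Fn (\<nu> j)) (\<lambda>x. \<Sum>i=j..N. \<alpha> i x) x - \<psi> j x\<bar>) \<le> \<epsilon>"
  obtains H where "\<And>j. H j \<in> sets (Fn (\<nu> j))"
    "\<And>j S. j \<le> N \<Longrightarrow> S \<in> sets (Fn (\<nu> j)) \<Longrightarrow> (LINT x:S|\<mu>. (\<Sum>i=j..N. \<theta> * \<alpha> i x * indicator (H i) x)) \<le> C * measure \<mu> S"
    "\<And>j. j \<le> N \<Longrightarrow> measure \<mu> (space \<mu> - H j) \<le> real (Suc N) * \<epsilon> / (C / \<theta> - C)"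
proof -
  note [measurable] = measurable_Fn[OF meas]
  define A where "A j = real_cond_exp \<mu> (Fn (\<nu> j)) (\<lambda>x. \<Sum>i=j..N. \<alpha> i x)" for j
  define G where "G j = {x \<in> space \<mu>. A j x \<le> C / \<theta>}" for j
  define H where "H j = (\<Inter>i\<in>{..j}. G i)" for j
  have G: "G j \<in> sets (Fn (\<nu> j))" for j
    using measurable_sets[of "A j" "Fn (\<nu> j)" borel "{..C / \<theta>}"]
    by (simp add: A_def G_def vimage_def Int_def conj_commute)
  have \<nu>_mono: "i \<le> j \<Longrightarrow> \<nu> i \<le> \<nu> j" for i j using \<nu> by (simp add: strict_mono_less_eq)
  have H: "H j \<in> sets (Fn (\<nu> j))" for j
    unfolding H_def using G sets_Fn_mono[OF \<nu>_mono] by (intro sets.finite_INT) auto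
  have \<alpha>_int: "integrable \<mu> (\<alpha> j)" for j
    using bd by (intro integrable_bounded[where B = K]) auto
  have sum_int: "integrable \<mu> (\<lambda>x. \<Sum>i=j..N. \<alpha> i x)" for j using \<alpha>_int by auto
  have A_int: "integrable \<mu> (A j)" for j
    unfolding A_def by (rule sigma_finite_subalgebra.real_cond_exp_int(1)[OF sigma_finite_Fn sum_int])
  have car: "(LINT x:S|\<mu>. (\<Sum>i=j..N. \<theta> * \<alpha> i x * indicator (H i) x)) \<le> C * measure \<mu> S"
    if S: "S \<in> sets (Fn (\<nu> j))" for j S
  proof -
    have SG: "S \<inter> G j \<in> sets (Fn (\<nu> j))" using S G by auto
    note S\<mu> = sets_Fn_subset[OF S] and SG\<mu> = sets_Fn_subset[OF SG] and H\<mu> = sets_Fn_subset[OF H]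
    have int1: "integrable \<mu> (\<lambda>x. \<Sum>i=j..N. \<theta> * \<alpha> i x * indicator (H i) x)"
      using \<alpha>_int H\<mu> by (intro Bochner_Integration.integrable_sum integrable_real_mult_indicator integrable_mult_right) auto
    \<comment> \<open>Off \<open>G j\<close> all terms from \<open>j\<close> on vanish, since
      \<open>H i\<close> is contained in \<open>G j\<close> for \<open>i \<ge> j\<close>. On
      \<open>G j\<close> the conditional tail is at most \<open>C / \<theta>\<close>, and the factor
      \<open>\<theta>\<close> brings it down to \<open>C\<close>.\<close>
    have "(LINT x:S|\<mu>. (\<Sum>i=j..N. \<theta> * \<alpha> i x * indicator (H i) x)) \<le> (LINT x:S \<inter> G j|\<mu>. \<theta> * (\<Sum>i=j..N. \<alpha> i x))"
      unfolding set_lebesgue_integral_def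
    proof (rule integral_mono)
      show "integrable \<mu> (\<lambda>x. indicator S x *\<^sub>R (\<Sum>i=j..N. \<theta> * \<alpha> i x * indicator (H i) x))"
        using int1 S\<mu> by (intro integrable_mult_indicator)
      show "integrable \<mu> (\<lambda>x. indicator (S \<inter> G j) x *\<^sub>R (\<theta> * (\<Sum>i=j..N. \<alpha> i x)))"
        using sum_int SG\<mu> by (intro integrable_mult_indicator integrable_mult_right)
      fix x assume x: "x \<in> space \<mu>"
      have "(\<Sum>i=j..N. \<theta> * \<alpha> i x * indicator (H i) x) \<le> indicator (G j) x * (\<theta> * (\<Sum>i=j..N. \<alpha> i x))"
      proof (cases "x \<in> G j")
        case True
        have "(\<Sum>i=j..N. \<theta> * \<alpha> i x * indicator (H i) x) \<le> (\<Sum>i=j..N. \<theta> * \<alpha> i x)"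
          using \<theta> bd(1)[OF x] by (intro sum_mono) (auto simp: indicator_def)
        then show ?thesis using True by (simp add: sum_distrib_left)
      next
        case False
        then have "x \<notin> H i" if "j \<le> i" for i using that by (auto simp: H_def)
        then show ?thesis using False by simp
      qed
      then show "indicator S x *\<^sub>R (\<Sum>i=j..N. \<theta> * \<alpha> i x * indicator (H i) x) \<le> indicator (S \<inter> G j) x *\<^sub>R (\<theta> * (\<Sum>i=j..N. \<alpha> i x))"
        by (cases "x \<in> S") (simp_all add: indicator_inter_arith)
    qed
    also have "\<dots> = \<theta> * (LINT x:S \<inter> G j|\<mu>. A j x)"
      unfolding A_def sigma_finite_subalgebra.real_cond_exp_intA[OF sigma_finite_Fn sum_int SG, symmetric] by simp
    also have "(LINT x:S \<inter> G j|\<mu>. A j x) \<le> (LINT x:S \<inter> G j|\<mu>. C / \<theta>)"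
      using A_int SG\<mu> by (intro set_integral_mono) (auto intro!: set_integrable_of_integrable simp: G_def)
    also have "(LINT x:S \<inter> G j|\<mu>. C / \<theta>) = C / \<theta> * measure \<mu> (S \<inter> G j)"
      using SG\<mu> by (simp add: set_integral_const emeasure_eq_measure)
    also have "\<theta> * (C / \<theta> * measure \<mu> (S \<inter> G j)) = C * measure \<mu> (S \<inter> G j)" using \<theta> by simp
    also have "\<dots> \<le> C * measure \<mu> S" using C S\<mu> by (intro mult_left_mono finite_measure_mono) auto
    finally show ?thesis using \<theta> by simp
  qed
  define \<gamma> where "\<gamma> = C / \<theta> - C"
  have \<gamma>: "0 < \<gamma>" using C \<theta> by (simp add: \<gamma>_def field_simps)
  \<comment> \<open>Markov's inequality: off \<open>G j\<close> the conditional tail exceeds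
    \<open>C / \<theta>\<close> whereas \<open>\<psi> j\<close> is at most \<open>C\<close>, so they
    differ by more than \<open>\<gamma>\<close>.\<close>
  have Gc: "measure \<mu> (space \<mu> - G j) \<le> \<epsilon> / \<gamma>" if "j \<le> N" for j
  proof -
    have G\<mu>: "space \<mu> - G j \<in> sets \<mu>" using sets_Fn_subset[OF G] by auto
    have "\<gamma> * measure \<mu> (space \<mu> - G j) = (LINT x|\<mu>. \<gamma> * indicator (space \<mu> - G j) x)" using G\<mu> by simp
    also have "\<dots> \<le> (LINT x|\<mu>. \<bar>A j x - \<psi> j x\<bar>)"
    proof (rule integral_mono)
      fix x assume x: "x \<in> space \<mu>"
      show "\<gamma> * indicator (space \<mu> - G j) x \<le> \<bar>A j x - \<psi> j x\<bar>"
        using \<psi>(2)[OF x, of j] x by (auto simp: indicator_def G_def \<gamma>_def)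
    qed (use A_int \<psi> G\<mu> in \<open>auto simp: emeasure_eq_measure\<close>)
    also have "\<dots> \<le> \<epsilon>" using err[OF that] by (simp add: A_def)
    finally show ?thesis using \<gamma> by (simp add: field_simps)
  qed
  have Hc: "measure \<mu> (space \<mu> - H j) \<le> real (Suc N) * \<epsilon> / \<gamma>" if "j \<le> N" for j
  proof -
    have eq: "space \<mu> - H j = (\<Union>i\<in>{..j}. space \<mu> - G i)" by (auto simp: H_def)
    have "measure \<mu> (space \<mu> - H j) \<le> (\<Sum>i\<le>j. measure \<mu> (space \<mu> - G i))"
      unfolding eq using sets_Fn_subset[OF G] by (intro finite_measure_subadditive_finite) auto
    also have "\<dots> \<le> (\<Sum>i\<le>j. \<epsilon> / \<gamma>)" using that by (intro sum_mono Gc) auto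
    also have "\<dots> = real (Suc j) * (\<epsilon> / \<gamma>)" by simp
    also have "\<dots> \<le> real (Suc N) * (\<epsilon> / \<gamma>)"
      using that order_trans[OF measure_nonneg Gc[OF that]] by (intro mult_right_mono) auto
    finally show ?thesis by simp
  qed
  show ?thesis using that[of H] H car Hc unfolding \<gamma>_def by blast
qed

end

section \<open>Transporting dyadic trees of finite depth\<close>

context filtered_space
begin

lemma ennreal_integral_le_nn_integral:
  fixes g :: "'a \<Rightarrow> real"
  assumes "integrable \<mu> g"
  shows "ennreal (LINT x|\<mu>. g x) \<le> (\<integral>\<^sup>+x. ennreal (g x) \<partial>\<mu>)"
proof -
  have "ennreal (LINT x|\<mu>. g x) \<le> ennreal (LINT x|\<mu>. max 0 (g x))"
    using assms by (intro ennreal_leI integral_mono) auto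
  also have "\<dots> = (\<integral>\<^sup>+x. ennreal (max 0 (g x)) \<partial>\<mu>)"
    using assms by (intro nn_integral_eq_integral[symmetric]) auto
  also have "\<dots> = (\<integral>\<^sup>+x. ennreal (g x) \<partial>\<mu>)"
    by (intro nn_integral_cong) (simp add: max_def ennreal_neg)
  finally show ?thesis .
qed

lemma (in -) sum_inj_le_suminf:
  fixes g :: "nat \<Rightarrow> ennreal" and \<nu> :: "nat \<Rightarrow> nat"
  assumes "inj \<nu>"
  shows "(\<Sum>j=0..N. g (\<nu> j)) \<le> (\<Sum>n. g n)"
proof -
  have "(\<Sum>j=0..N. g (\<nu> j)) = sum g (\<nu> ` {0..N})"
    using assms by (subst sum.reindex) (auto intro: inj_on_subset)
  also have "\<dots> \<le> (\<Sum>n. g n)" by (rule sum_le_suminf) (auto intro: summableI)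
  finally show ?thesis .
qed

text \<open>On \<open>H\<close> the p-th power is Lipschitz between 0 and \<open>K\<close>; off
  \<open>H\<close> the whole term is given up and charged to the complement. Both errors become
  small after integration.\<close>

lemma (in -) powr_lower_perturbation:
  fixes \<alpha> y z K p :: real
  assumes "p > 1" "0 \<le> \<alpha>" "\<alpha> \<le> K" "0 \<le> y" "y \<le> K" "0 \<le> z" "z \<le> K"
  shows "\<alpha> * z powr p - K * (p * K powr (p - 1)) * \<bar>y - z\<bar> - K * K powr p * indicator (- H) x
    \<le> \<alpha> * indicator H x * y powr p"
proof (cases "x \<in> H")
  case True
  have "\<alpha> * (z powr p - y powr p) \<le> \<alpha> * (p * K powr (p - 1) * \<bar>y - z\<bar>)"
    using abs_powr_diff_le[of p y K z] assms by (intro mult_left_mono) auto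
  also have "\<dots> \<le> K * (p * K powr (p - 1) * \<bar>y - z\<bar>)"
    using assms by (intro mult_right_mono) auto
  finally show ?thesis using True by (simp add: algebra_simps)
next
  case False
  have "\<alpha> * z powr p \<le> K * K powr p"
    using assms by (intro mult_mono powr_mono2) auto
  moreover have "0 \<le> K * (p * K powr (p - 1)) * \<bar>y - z\<bar>" using assms by auto
  ultimately show ?thesis using False by simp
qed

text \<open>Every condition other than positivity is strict in the limit
  \<open>\<epsilon> \<rightarrow> 0\<close>. The last one tends to
  \<open>(1 - \<delta>) * F + \<delta> * ff powr p < F\<close>, which uses the strict inequality
  between \<open>ff powr p\<close> and \<open>F\<close>.\<close>

lemma (in -) ex_tolerance:
  fixes p F ff \<delta> M e R Q :: real
  assumes "p > 1" "0 < ff" "ff powr p < F" "0 < \<delta>" "\<delta> < 1" "0 < M" "0 < e"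
  obtains \<epsilon> where "0 < \<epsilon>" "R * \<epsilon> < e" "Q * \<epsilon> < \<delta> * M" "\<epsilon> < \<delta> * ff"
    "(1 - \<delta>) * (F + \<epsilon>) + \<delta> * ((\<delta> * ff + \<epsilon>) / \<delta>) powr p < F"
proof -
  have lim: "((\<lambda>\<epsilon>. r * \<epsilon>) \<longlongrightarrow> r * 0) (at_right 0)" for r :: real by (intro tendsto_intros)
  have "((\<lambda>\<epsilon>. (1 - \<delta>) * (F + \<epsilon>) + \<delta> * ((\<delta> * ff + \<epsilon>) / \<delta>) powr p) \<longlongrightarrow>
    (1 - \<delta>) * (F + 0) + \<delta> * ((\<delta> * ff + 0) / \<delta>) powr p) (at_right 0)"
    using assms by (intro tendsto_intros) auto
  moreover have "\<delta> * ff powr p < \<delta> * F" using assms by simp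
  then have "(1 - \<delta>) * (F + 0) + \<delta> * ((\<delta> * ff + 0) / \<delta>) powr p < F"
    using assms by (simp add: algebra_simps)
  ultimately have ev1: "\<forall>\<^sub>F \<epsilon> in at_right 0. (1 - \<delta>) * (F + \<epsilon>) + \<delta> * ((\<delta> * ff + \<epsilon>) / \<delta>) powr p < F"
    by (rule order_tendstoD(2))
  have ev2: "\<forall>\<^sub>F \<epsilon> in at_right (0::real). R * \<epsilon> < e" "\<forall>\<^sub>F \<epsilon> in at_right (0::real). Q * \<epsilon> < \<delta> * M"
    "\<forall>\<^sub>F \<epsilon> in at_right (0::real). 1 * \<epsilon> < \<delta> * ff"
    by (rule order_tendstoD(2)[OF lim], use assms in simp)+
  have "\<forall>\<^sub>F \<epsilon> in at_right (0::real). 0 < \<epsilon>" by (rule eventually_at_right_less)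
  with ev1 ev2 have "\<forall>\<^sub>F \<epsilon> in at_right (0::real). 0 < \<epsilon> \<and> R * \<epsilon> < e \<and> Q * \<epsilon> < \<delta> * M \<and> \<epsilon> < \<delta> * ff \<and>
    (1 - \<delta>) * (F + \<epsilon>) + \<delta> * ((\<delta> * ff + \<epsilon>) / \<delta>) powr p < F"
    by eventually_elim simp
  then show ?thesis using eventually_happens[of _ "at_right (0::real)"] that by auto
qed

text \<open>The numbers \<open>c k\<close> play the averages over generation \<open>N\<close> and
  \<open>a j k\<close> the coefficients down to that depth. The factor
  \<open>(1 - \<delta>) powr p\<close> is the price for scaling the function, the other
  \<open>1 - \<delta>\<close> for scaling the coefficients, and \<open>e\<close> absorbs the
  transport errors.\<close>

lemma finite_tree_le_mart_bellman:
  fixes a :: "nat \<Rightarrow> nat \<Rightarrow> real" and c :: "nat \<Rightarrow> real" and p :: real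
  defines "V N \<equiv> (\<Sum>j=0..N. \<Sum>k<2^j. a j k * descendant_avg (N - j) c k powr p)"
  assumes refine: "infinitely_refining \<mu> Fn" and p: "p > 1" and C: "0 < C" and M: "0 < M" "M \<le> C"
    and ff: "0 < ff" "ff powr p < F"
    and c: "\<And>k. 0 \<le> c k" "\<And>k. c k \<le> K" and a: "\<And>j k. 0 \<le> a j k" "\<And>j k. 2 ^ j * a j k \<le> K"
    and car: "\<And>j k. j \<le> N \<Longrightarrow> k < 2 ^ j \<Longrightarrow> (\<Sum>i=j..N. \<Sum>m<2^(i - j). a i (k * 2 ^ (i - j) + m)) \<le> C / 2 ^ j"
    and tot: "(\<Sum>i=0..N. \<Sum>m<2^i. a i m) \<le> M"
    and mean: "descendant_avg N c 0 = ff" and pmean: "descendant_avg N (\<lambda>k. c k powr p) 0 \<le> F"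
    and \<delta>: "0 < \<delta>" "\<delta> < 1" and e: "0 < e"
  shows "ennreal ((1 - \<delta>) powr p * (1 - \<delta>) * (V N - e)) \<le> mart_bellman \<mu> Fn p F ff M C"
proof -
  define \<theta> where "\<theta> = 1 - \<delta>"
  have \<theta>: "0 < \<theta>" "\<theta> < 1" using \<delta> by (auto simp: \<theta>_def)
  have K: "0 \<le> K" using c[of 0] by linarith
  \<comment> \<open>A common bound for everything the walk estimate is applied to: \<open>c\<close>,
    its p-th power, the rescaled coefficients, and their products with powers of averages.\<close>
  define L where "L = K + K powr p + K * K powr p"
  have L: "K \<le> L" "K powr p \<le> L" "K * K powr p \<le> L" "0 \<le> L" using K by (auto simp: L_def)
  define \<gamma> where "\<gamma> = C / \<theta> - C"
  have \<gamma>: "0 < \<gamma>" using C \<theta> by (simp add: \<gamma>_def field_simps)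
  \<comment> \<open>One bracket per level: the error of the main term, the Lipschitz error of the
    p-th power, and the cost of stopping. In the last, one factor \<open>Suc N\<close> counts the
    coefficients in a tail and the other the stopping times.\<close>
  define R where "R = real (Suc N) * (1 + K * (p * K powr (p - 1)) + K * K powr p * (real (Suc N) * real (Suc N) / \<gamma>))"
  obtain \<epsilon> where \<epsilon>: "0 < \<epsilon>" "R * \<epsilon> < e" "real (Suc N) * \<epsilon> < \<delta> * M" "\<epsilon> < \<delta> * ff"
    "(1 - \<delta>) * (F + \<epsilon>) + \<delta> * ((\<delta> * ff + \<epsilon>) / \<delta>) powr p < F"
    using ex_tolerance[OF p ff \<delta> M(1) e] by metis
  obtain \<nu> w where \<nu>: "\<nu> 0 = (0::nat)" "strict_mono \<nu>" and w: "\<And>j. w j \<in> measurable (Fn (\<nu> j)) (count_space (UNIV :: nat set))"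
    "\<And>j x. w j x < 2 ^ j"
    and walk: "\<forall>\<phi> i j. (\<forall>k. \<bar>\<phi> k\<bar> \<le> L) \<longrightarrow> j + i \<le> N \<longrightarrow>
      (LINT x|\<mu>. \<bar>real_cond_exp \<mu> (Fn (\<nu> j)) (\<lambda>x. \<phi> (w (j + i) x)) x - descendant_avg i \<phi> (w j x)\<bar>) \<le> \<epsilon>"
    by (rule ex_approximate_walk[OF refine \<epsilon>(1) L(4), where N = N], rule that)
  have w0: "w 0 x = 0" for x using w(2)[of 0 x] by simp
  have w_meas: "(\<lambda>x. \<phi> (w j x)) \<in> borel_measurable (Fn (\<nu> j))" for \<phi> :: "nat \<Rightarrow> real" and j
    using measurable_compose[OF w(1), of \<phi> borel] by simp
  note [measurable] = measurable_Fn[OF w_meas]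
  have w_int: "integrable \<mu> (\<lambda>x. \<phi> (w j x))" if "\<And>k. \<bar>\<phi> k\<bar> \<le> l" for \<phi> :: "nat \<Rightarrow> real" and j l
    using that by (intro integrable_bounded[where B = l]) auto
  have expect: "\<bar>(LINT x|\<mu>. \<phi> (w i x)) - descendant_avg i \<phi> 0\<bar> \<le> \<epsilon>" if "\<And>k. \<bar>\<phi> k\<bar> \<le> L" "i \<le> N" for \<phi> i
  proof -
    have "(LINT x|\<mu>. \<bar>real_cond_exp \<mu> (Fn (\<nu> 0)) (\<lambda>x. \<phi> (w (0 + i) x)) x - descendant_avg i \<phi> (w 0 x)\<bar>) \<le> \<epsilon>"
      using walk[THEN spec[of _ \<phi>], THEN spec[of _ i], THEN spec[of _ 0]] that by simp
    then have "\<bar>(LINT x|\<mu>. \<phi> (w i x)) - (LINT x|\<mu>. descendant_avg i \<phi> 0)\<bar> \<le> \<epsilon>"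
      using w_int[of \<phi> L, OF that(1)] by (intro abs_expectation_diff_le[where n = "\<nu> 0"]) (auto simp: w0)
    then show ?thesis by (simp add: prob_space)
  qed
  define f' where "f' x = c (w N x)" for x
  have f': "0 \<le> f' x" "f' x \<le> K" for x using c by (auto simp: f'_def)
  have f'_meas [measurable]: "f' \<in> borel_measurable \<mu>" unfolding f'_def by measurable
  have f'_int: "integrable \<mu> f'" using f' by (intro integrable_bounded[where B = K]) auto
  \<comment> \<open>The walk is at a given \<open>k\<close> with probability close to the j-th power
    of 1/2, so the factor \<open>2 ^ j\<close> makes the expectation close to the sum of the
    \<open>a j k\<close>.\<close>
  define \<alpha> where "\<alpha> j x = 2 ^ j * a j (w j x)" for j x
  have \<alpha>: "0 \<le> \<alpha> j x" "\<alpha> j x \<le> K" for j x using a by (auto simp: \<alpha>_def)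
  have \<alpha>_meas: "\<alpha> j \<in> borel_measurable (Fn (\<nu> j))" for j unfolding \<alpha>_def by (rule w_meas)
  note [measurable] = measurable_Fn[OF \<alpha>_meas]
  have \<alpha>_int: "integrable \<mu> (\<alpha> j)" for j using \<alpha> by (intro integrable_bounded[where B = K]) auto
  define \<phi> where "\<phi> j = descendant_avg (N - j) c" for j
  have \<phi>: "0 \<le> \<phi> j k" "\<phi> j k \<le> K" for j k
    unfolding \<phi>_def using descendant_avg_mono[of "\<lambda>_. 0" c "N - j" k] descendant_avg_mono[of c "\<lambda>_. K" "N - j" k] c by simp_all
  have e1: "(LINT x|\<mu>. \<bar>real_cond_exp \<mu> (Fn (\<nu> j)) f' x - \<phi> j (w j x)\<bar>) \<le> \<epsilon>" if "j \<le> N" for j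
  proof -
    have "\<forall>k. \<bar>c k\<bar> \<le> L" using c L by (auto intro: order_trans)
    then show ?thesis
      using walk[THEN spec[of _ c], THEN spec[of _ "N - j"], THEN spec[of _ j]] that by (simp add: f'_def[abs_def] \<phi>_def)
  qed
  \<comment> \<open>The conditional tail that a fair walk would have; the dyadic Carleson condition
    bounds it by \<open>C\<close>.\<close>
  define \<psi> where "\<psi> j x = (\<Sum>i=j..N. descendant_avg (i - j) (\<lambda>k. 2 ^ i * a i k) (w j x))" for j x
  have \<psi>_eq: "\<psi> j x = 2 ^ j * (\<Sum>i=j..N. \<Sum>m<2^(i - j). a i (w j x * 2 ^ (i - j) + m))" for j x
  proof -
    have "descendant_avg (i - j) (\<lambda>k. 2 ^ i * a i k) (w j x) = 2 ^ j * (\<Sum>m<2^(i - j). a i (w j x * 2 ^ (i - j) + m))" if "j \<le> i" for i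
    proof -
      have "(2::real) ^ i = 2 ^ j * 2 ^ (i - j)" using that by (simp flip: power_add)
      then show ?thesis by (simp add: descendant_avg_def sum_distrib_left[symmetric])
    qed
    then show ?thesis by (simp add: \<psi>_def sum_distrib_left)
  qed
  have \<psi>_le: "\<psi> j x \<le> C" for j x
  proof (cases "j \<le> N")
    case True
    have "\<psi> j x \<le> 2 ^ j * (C / 2 ^ j)" unfolding \<psi>_eq by (intro mult_left_mono car True w) simp
    then show ?thesis by simp
  next
    case False
    then show ?thesis using C by (simp add: \<psi>_def)
  qed
  have a_bd: "\<bar>2 ^ i * a i k\<bar> \<le> K" for i k using a(1)[of i k] a(2)[of i k] by simp
  have avg_int: "integrable \<mu> (\<lambda>x. descendant_avg (i - j) (\<lambda>k. 2 ^ i * a i k) (w j x))" for i j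
    by (rule w_int[of _ K]) (rule abs_descendant_avg_le, rule a_bd)
  have \<psi>_int: "integrable \<mu> (\<psi> j)" for j unfolding \<psi>_def using avg_int by auto
  have e2: "(LINT x|\<mu>. \<bar>real_cond_exp \<mu> (Fn (\<nu> j)) (\<lambda>x. \<Sum>i=j..N. \<alpha> i x) x - \<psi> j x\<bar>) \<le> real (Suc N) * \<epsilon>" if "j \<le> N" for j
  proof -
    interpret s: sigma_finite_subalgebra \<mu> "Fn (\<nu> j)" by (rule sigma_finite_Fn)
    let ?d = "\<lambda>i x. \<bar>real_cond_exp \<mu> (Fn (\<nu> j)) (\<alpha> i) x - descendant_avg (i - j) (\<lambda>k. 2 ^ i * a i k) (w j x)\<bar>"
    have int: "integrable \<mu> (?d i)" for i
      using s.real_cond_exp_int(1)[OF \<alpha>_int] avg_int by (intro integrable_abs Bochner_Integration.integrable_diff)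
    have "AE x in \<mu>. real_cond_exp \<mu> (Fn (\<nu> j)) (\<lambda>x. \<Sum>i\<in>{j..N}. \<alpha> i x) x = (\<Sum>i\<in>{j..N}. real_cond_exp \<mu> (Fn (\<nu> j)) (\<alpha> i) x)"
      by (rule s.real_cond_exp_sum[OF \<alpha>_int])
    then have AE: "AE x in \<mu>. \<bar>real_cond_exp \<mu> (Fn (\<nu> j)) (\<lambda>x. \<Sum>i=j..N. \<alpha> i x) x - \<psi> j x\<bar> \<le> (\<Sum>i=j..N. ?d i x)"
    proof eventually_elim
      case (elim x)
      show ?case unfolding elim \<psi>_def sum_subtractf[symmetric] by (rule sum_abs)
    qed
    have "(LINT x|\<mu>. \<bar>real_cond_exp \<mu> (Fn (\<nu> j)) (\<lambda>x. \<Sum>i=j..N. \<alpha> i x) x - \<psi> j x\<bar>) \<le> (LINT x|\<mu>. (\<Sum>i=j..N. ?d i x))"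
      by (rule integral_mono_AE[OF _ Bochner_Integration.integrable_sum[OF int] AE],
          intro integrable_abs Bochner_Integration.integrable_diff \<psi>_int s.real_cond_exp_int(1)
            Bochner_Integration.integrable_sum \<alpha>_int)
    also have "\<dots> = (\<Sum>i=j..N. LINT x|\<mu>. ?d i x)" using int by (rule Bochner_Integration.integral_sum)
    also have "\<dots> \<le> (\<Sum>i=j..N. \<epsilon>)"
    proof (rule sum_mono)
      fix i assume i: "i \<in> {j..N}"
      have "\<forall>k. \<bar>2 ^ i * a i k\<bar> \<le> L" using a_bd L(1) by (meson order_trans)
      then show "(LINT x|\<mu>. ?d i x) \<le> \<epsilon>"
        using walk[THEN spec[of _ "\<lambda>k. 2 ^ i * a i k"], THEN spec[of _ "i - j"], THEN spec[of _ j]] i by (simp add: \<alpha>_def[abs_def])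
    qed
    also have "\<dots> = real (Suc N - j) * \<epsilon>" by simp
    also have "\<dots> \<le> real (Suc N) * \<epsilon>" using \<epsilon>(1) by (intro mult_right_mono) auto
    finally show ?thesis .
  qed
  obtain H where H: "\<And>j. H j \<in> sets (Fn (\<nu> j))"
    and H_car: "\<And>j S. j \<le> N \<Longrightarrow> S \<in> sets (Fn (\<nu> j)) \<Longrightarrow> (LINT x:S|\<mu>. (\<Sum>i=j..N. \<theta> * \<alpha> i x * indicator (H i) x)) \<le> C * measure \<mu> S"
    and H_small: "\<And>j. j \<le> N \<Longrightarrow> measure \<mu> (space \<mu> - H j) \<le> real (Suc N) * (real (Suc N) * \<epsilon>) / (C / \<theta> - C)"
    using ex_stopping_sets[OF \<nu>(2) C \<theta> \<alpha>_meas \<alpha> \<psi>_int \<psi>_le e2] by blast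
  note H\<mu> [measurable] = sets_Fn_subset[OF H]
  have tot_\<theta>: "(LINT x|\<mu>. (\<Sum>i=0..N. \<theta> * \<alpha> i x * indicator (H i) x)) \<le> M"
  proof -
    have "(LINT x|\<mu>. (\<Sum>i=0..N. \<theta> * \<alpha> i x * indicator (H i) x)) \<le> (LINT x|\<mu>. \<theta> * (\<Sum>i=0..N. \<alpha> i x))"
    proof (rule integral_mono)
      show "integrable \<mu> (\<lambda>x. \<Sum>i=0..N. \<theta> * \<alpha> i x * indicator (H i) x)"
        using \<alpha>_int H\<mu> by (intro Bochner_Integration.integrable_sum integrable_real_mult_indicator integrable_mult_right) auto
      show "(\<Sum>i=0..N. \<theta> * \<alpha> i x * indicator (H i) x) \<le> \<theta> * (\<Sum>i=0..N. \<alpha> i x)" for x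
        unfolding sum_distrib_left using \<theta> \<alpha> by (intro sum_mono) (auto simp: indicator_def)
    qed (use \<alpha>_int in auto)
    also have "\<dots> = \<theta> * (LINT x|\<mu>. (\<Sum>i=0..N. \<alpha> i x))" by simp
    \<comment> \<open>The transport error in the mass is below \<open>\<delta> * M\<close>, and
      scaling absorbs it because
      \<open>\<theta> * (1 + \<delta>) = 1 - \<delta> * \<delta>\<close>.\<close>
    also have "\<dots> \<le> \<theta> * (M + \<delta> * M)"
    proof (rule mult_left_mono)
      have "\<bar>(LINT x|\<mu>. (\<Sum>i=0..N. \<alpha> i x)) - (LINT x|\<mu>. \<psi> 0 x)\<bar> \<le> real (Suc N) * \<epsilon>"
        by (rule abs_expectation_diff_le[OF _ \<psi>_int e2]) (use \<alpha>_int in auto)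
      moreover have "(LINT x|\<mu>. \<psi> 0 x) \<le> M"
        using tot by (simp add: \<psi>_eq w0 prob_space)
      ultimately show "(LINT x|\<mu>. (\<Sum>i=0..N. \<alpha> i x)) \<le> M + \<delta> * M" using \<epsilon>(3) by linarith
    qed (use \<theta> in simp)
    also have "\<dots> = M - \<delta> * \<delta> * M" by (simp add: \<theta>_def algebra_simps)
    also have "\<dots> \<le> M" using M by simp
    finally show ?thesis .
  qed
  obtain \<beta> where \<beta>: "carleson_seq \<mu> Fn C \<beta>" "(\<integral>\<^sup>+x. (\<Sum>n. ennreal (\<beta> n x)) \<partial>\<mu>) = ennreal M"
    "\<And>j x. j \<le> N \<Longrightarrow> x \<in> space \<mu> \<Longrightarrow> \<theta> * \<alpha> j x * indicator (H j) x \<le> \<beta> (\<nu> j) x"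
  proof (rule ex_carleson_seq_above[OF \<nu>(2,1), of M C "\<lambda>j x. \<theta> * \<alpha> j x * indicator (H j) x" K N])
    show "(\<lambda>x. \<theta> * \<alpha> j x * indicator (H j) x) \<in> borel_measurable (Fn (\<nu> j))" for j
      using \<alpha>_meas[of j] H[of j] by measurable
    show "\<theta> * \<alpha> j x * indicator (H j) x \<le> K" for j x
    proof -
      have "\<theta> * \<alpha> j x * indicator (H j) x \<le> 1 * \<alpha> j x * 1"
        using \<theta> \<alpha> by (intro mult_mono) (auto simp: indicator_def)
      then show ?thesis using \<alpha>(2)[of j x] by simp
    qed
  qed (use M \<theta> \<alpha> H_car tot_\<theta> that in auto)
  have Ef': "\<bar>(LINT x|\<mu>. f' x) - ff\<bar> \<le> \<epsilon>"
    unfolding f'_def mean[symmetric] by (rule expect) (use c L in \<open>auto intro: order_trans\<close>)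
  \<comment> \<open>The mean lost through scaling and transport. It is positive because the error
    \<open>\<epsilon>\<close> is below \<open>\<delta> * ff\<close>.\<close>
  define m where "m = ff - \<theta> * (LINT x|\<mu>. f' x)"
  have "\<theta> * (LINT x|\<mu>. f' x) \<le> \<theta> * (ff + \<epsilon>)" "\<theta> * (ff - \<epsilon>) \<le> \<theta> * (LINT x|\<mu>. f' x)"
    using Ef' \<theta> by (auto intro!: mult_left_mono)
  moreover have "\<theta> * \<epsilon> \<le> \<epsilon>" using \<theta> \<epsilon> by simp
  ultimately have m: "0 < m" "m \<le> \<delta> * ff + \<epsilon>"
    using \<epsilon>(4) unfolding m_def \<theta>_def by (simp_all add: algebra_simps)
  have moment: "(LINT x|\<mu>. (\<theta> * f' x + m) powr p) \<le> F"
  proof -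
    have fp_int: "integrable \<mu> (\<lambda>x. f' x powr p)"
      using f' p by (intro integrable_bounded[where B = "K powr p"]) (auto intro!: powr_mono2)
    \<comment> \<open>Read \<open>\<theta> * f' x + m\<close> as the convex combination of
      \<open>f' x\<close> and \<open>m / \<delta>\<close> with weights \<open>\<theta>\<close> and
      \<open>\<delta>\<close>; the value \<open>m / \<delta>\<close> is close to \<open>ff\<close>
      or below it.\<close>
    have "(\<theta> * f' x + m) powr p \<le> \<theta> * f' x powr p + \<delta> * (m / \<delta>) powr p" for x
      using powr_convex_combination[OF p f'(1), of "m / \<delta>" \<delta> x] \<delta> m by (simp add: \<theta>_def)
    then have "(LINT x|\<mu>. (\<theta> * f' x + m) powr p) \<le> (LINT x|\<mu>. \<theta> * f' x powr p + \<delta> * (m / \<delta>) powr p)"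
    proof (intro integral_mono)
      show "integrable \<mu> (\<lambda>x. (\<theta> * f' x + m) powr p)"
        using f' p \<theta> m
        by (intro integrable_bounded[where B = "(\<theta> * K + m) powr p"]) (auto intro!: powr_mono2 add_nonneg_nonneg mult_nonneg_nonneg)
    qed (use fp_int in auto)
    also have "\<dots> = \<theta> * (LINT x|\<mu>. f' x powr p) + \<delta> * (m / \<delta>) powr p"
      using fp_int by (simp add: prob_space)
    also have "\<dots> \<le> \<theta> * (F + \<epsilon>) + \<delta> * ((\<delta> * ff + \<epsilon>) / \<delta>) powr p"
    proof (intro add_mono mult_left_mono powr_mono2 divide_right_mono)
      have "\<bar>c k powr p\<bar> \<le> L" for k using powr_mono2[of p "c k" K] c p L(2) by (simp add: order_trans)
      then have "\<bar>(LINT x|\<mu>. c (w N x) powr p) - descendant_avg N (\<lambda>k. c k powr p) 0\<bar> \<le> \<epsilon>"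
        by (intro expect[of "\<lambda>k. c k powr p"]) auto
      then show "(LINT x|\<mu>. f' x powr p) \<le> F + \<epsilon>" using pmean by (simp add: f'_def)
    qed (use m \<theta> \<delta> p in auto)
    also have "\<dots> \<le> F" using \<epsilon>(5) by (simp add: \<theta>_def)
    finally show ?thesis .
  qed
  obtain f where f: "f \<in> borel_measurable \<mu>" "\<And>x. x \<in> space \<mu> \<Longrightarrow> \<theta> * f' x \<le> f x" "integrable \<mu> f" "integrable \<mu> (\<lambda>x. f x powr p)"
    "(LINT x|\<mu>. f x) = (LINT x|\<mu>. \<theta> * f' x) + m" "(LINT x|\<mu>. f x powr p) = F"
  proof (rule ex_exact_moments[OF refine p _ _ _ m(1) moment, of K])
    fix x
    have "\<theta> * f' x \<le> 1 * f' x" using \<theta> f' by (intro mult_right_mono) auto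
    then show "\<theta> * f' x \<le> K" using f'(2)[of x] by simp
    show "0 \<le> \<theta> * f' x" using \<theta> f' by simp
  qed (use that in auto)
  have f_nn: "0 \<le> f x" if "x \<in> space \<mu>" for x
    using f(2)[OF that] mult_nonneg_nonneg[of \<theta> "f' x"] \<theta> f'(1)[of x] by linarith
  have "(LINT x|\<mu>. f x) = ff" using f(5) by (simp add: m_def)
  then have "mart_admissible \<mu> Fn p F ff M C f \<beta>"
    unfolding mart_admissible_def using f(1,3,4,6) f_nn \<beta>(1,2) by blast
  then have sup: "(\<integral>\<^sup>+x. (\<Sum>n. ennreal (\<beta> n x * real_cond_exp \<mu> (Fn n) f x powr p)) \<partial>\<mu>) \<le> mart_bellman \<mu> Fn p F ff M C"
    unfolding mart_bellman_def by (intro Sup_upper) blast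
  \<comment> \<open>A minorant, up to scaling, of the j-th contribution, with integral controlled by
    the walk estimate and the measure of the stopped set. It may be negative.\<close>
  define g where "g j x = \<alpha> j x * \<phi> j (w j x) powr p - K * (p * K powr (p - 1)) * \<bar>real_cond_exp \<mu> (Fn (\<nu> j)) f' x - \<phi> j (w j x)\<bar>
    - K * K powr p * indicator (- H j) x" for j x
  have g_le: "AE x in \<mu>. \<theta> powr p * \<theta> * g j x \<le> \<beta> (\<nu> j) x * real_cond_exp \<mu> (Fn (\<nu> j)) f x powr p" if "j \<le> N" for j
  proof -
    interpret s: sigma_finite_subalgebra \<mu> "Fn (\<nu> j)" by (rule sigma_finite_Fn)
    have "AE x in \<mu>. real_cond_exp \<mu> (Fn (\<nu> j)) (\<lambda>x. \<theta> * f' x) x \<le> real_cond_exp \<mu> (Fn (\<nu> j)) f x"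
      by (rule s.real_cond_exp_mono) (use f f'_int in auto)
    moreover have "AE x in \<mu>. real_cond_exp \<mu> (Fn (\<nu> j)) (\<lambda>x. \<theta> * f' x) x = \<theta> * real_cond_exp \<mu> (Fn (\<nu> j)) f' x"
      by (rule s.real_cond_exp_cmult[OF f'_int])
    moreover have "AE x in \<mu>. 0 \<le> real_cond_exp \<mu> (Fn (\<nu> j)) f' x"
      by (rule s.real_cond_exp_ge_c[OF f'_int]) (use f' in auto)
    moreover have "AE x in \<mu>. real_cond_exp \<mu> (Fn (\<nu> j)) f' x \<le> K"
      by (rule s.real_cond_exp_le_c[OF f'_int]) (use f' in auto)
    ultimately show ?thesis
      using AE_space
    proof eventually_elim
      case (elim x)
      let ?y = "real_cond_exp \<mu> (Fn (\<nu> j)) f' x"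
      have "\<theta> powr p * \<theta> * g j x \<le> \<theta> powr p * \<theta> * (\<alpha> j x * indicator (H j) x * ?y powr p)"
        unfolding g_def using elim \<theta> \<alpha> \<phi> by (intro mult_left_mono powr_lower_perturbation p) auto
      also have "\<dots> = (\<theta> * \<alpha> j x * indicator (H j) x) * (\<theta> * ?y) powr p"
        using elim \<theta> by (simp add: powr_mult)
      also have "\<dots> \<le> \<beta> (\<nu> j) x * real_cond_exp \<mu> (Fn (\<nu> j)) f x powr p"
      proof (rule mult_mono)
        show lb: "\<theta> * \<alpha> j x * indicator (H j) x \<le> \<beta> (\<nu> j) x" using \<beta>(3)[OF that] elim by simp
        show "0 \<le> \<beta> (\<nu> j) x" using \<beta>(1) elim by (auto simp: carleson_seq_def)
      qed (use elim \<theta> p in \<open>auto intro!: powr_mono2\<close>)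
      finally show ?case .
    qed
  qed
  have cf'_int: "integrable \<mu> (real_cond_exp \<mu> (Fn (\<nu> j)) f')" for j
    by (rule sigma_finite_subalgebra.real_cond_exp_int(1)[OF sigma_finite_Fn f'_int])
  have \<phi>w_int: "integrable \<mu> (\<lambda>x. \<phi> j (w j x))" for j using \<phi> by (intro w_int[of _ K]) auto
  have main_bd: "\<bar>2 ^ j * a j k * \<phi> j k powr p\<bar> \<le> K * K powr p" for j k
    using a[of j k] \<phi>[of j k] p K by (simp add: abs_mult mult_mono powr_mono2)
  have main_int: "integrable \<mu> (\<lambda>x. \<alpha> j x * \<phi> j (w j x) powr p)" for j
    unfolding \<alpha>_def using w_int[of "\<lambda>k. 2 ^ j * a j k * \<phi> j k powr p" "K * K powr p"] main_bd by simp
  have Hc_int: "integrable \<mu> (\<lambda>x. indicator (- H j) x :: real)"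
    and Hc_meas: "(LINT x|\<mu>. indicator (- H j) x) = measure \<mu> (space \<mu> - H j)" for j
  proof -
    have eq: "indicator (- H j) x = (indicator (space \<mu> - H j) x :: real)" if "x \<in> space \<mu>" for x
      using that by (auto simp: indicator_def)
    show "integrable \<mu> (\<lambda>x. indicator (- H j) x :: real)"
      by (subst Bochner_Integration.integrable_cong[OF refl eq]) (auto simp: emeasure_eq_measure)
    show "(LINT x|\<mu>. indicator (- H j) x) = measure \<mu> (space \<mu> - H j)"
      by (subst Bochner_Integration.integral_cong[OF refl eq]) auto
  qed
  have g_int: "integrable \<mu> (g j)" for j
    unfolding g_def
    by (intro Bochner_Integration.integrable_diff integrable_mult_right integrable_abs main_int cf'_int \<phi>w_int Hc_int)
  define B where "B = 1 + K * (p * K powr (p - 1)) + K * K powr p * (real (Suc N) * real (Suc N) / \<gamma>)"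
  have g_ge: "(\<Sum>k<2^j. a j k * \<phi> j k powr p) - B * \<epsilon> \<le> (LINT x|\<mu>. g j x)" if j: "j \<le> N" for j
  proof -
    have "(LINT x|\<mu>. g j x) = (LINT x|\<mu>. \<alpha> j x * \<phi> j (w j x) powr p)
      - K * (p * K powr (p - 1)) * (LINT x|\<mu>. \<bar>real_cond_exp \<mu> (Fn (\<nu> j)) f' x - \<phi> j (w j x)\<bar>)
      - K * K powr p * measure \<mu> (space \<mu> - H j)"
      unfolding g_def Hc_meas[symmetric] using main_int cf'_int \<phi>w_int Hc_int
      by (simp add: Bochner_Integration.integral_diff Bochner_Integration.integrable_diff)
    moreover have "(\<Sum>k<2^j. a j k * \<phi> j k powr p) - \<epsilon> \<le> (LINT x|\<mu>. \<alpha> j x * \<phi> j (w j x) powr p)"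
    proof -
      have "\<bar>2 ^ j * a j k * \<phi> j k powr p\<bar> \<le> L" for k using main_bd L(3) by (rule order_trans)
      then have "\<bar>(LINT x|\<mu>. 2 ^ j * a j (w j x) * \<phi> j (w j x) powr p) - descendant_avg j (\<lambda>k. 2 ^ j * a j k * \<phi> j k powr p) 0\<bar> \<le> \<epsilon>"
        using j by (rule expect[of "\<lambda>k. 2 ^ j * a j k * \<phi> j k powr p"])
      moreover have "descendant_avg j (\<lambda>k. 2 ^ j * a j k * \<phi> j k powr p) 0 = (\<Sum>k<2^j. a j k * \<phi> j k powr p)"
        by (simp add: descendant_avg_def sum_distrib_left[symmetric] mult.assoc)
      ultimately show ?thesis by (simp add: \<alpha>_def)
    qed
    moreover have "K * (p * K powr (p - 1)) * (LINT x|\<mu>. \<bar>real_cond_exp \<mu> (Fn (\<nu> j)) f' x - \<phi> j (w j x)\<bar>) \<le> K * (p * K powr (p - 1)) * \<epsilon>"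
      using e1[OF j] K p by (intro mult_left_mono) auto
    moreover have "K * K powr p * measure \<mu> (space \<mu> - H j) \<le> K * K powr p * (real (Suc N) * (real (Suc N) * \<epsilon>) / \<gamma>)"
      using H_small[OF j] K unfolding \<gamma>_def by (intro mult_left_mono) auto
    ultimately show ?thesis by (simp add: B_def algebra_simps)
  qed
  have RB: "R = real (Suc N) * B" by (simp only: R_def B_def)
  have "V N - e \<le> V N - R * \<epsilon>" using \<epsilon> by simp
  also have "\<dots> = (\<Sum>j=0..N. (\<Sum>k<2^j. a j k * \<phi> j k powr p) - B * \<epsilon>)"
    by (simp add: V_def RB \<phi>_def sum_subtractf)
  also have "\<dots> \<le> (\<Sum>j=0..N. LINT x|\<mu>. g j x)" by (intro sum_mono g_ge) auto
  also have "\<dots> = (LINT x|\<mu>. (\<Sum>j=0..N. g j x))" using g_int by simp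
  finally have "\<theta> powr p * \<theta> * (V N - e) \<le> \<theta> powr p * \<theta> * (LINT x|\<mu>. (\<Sum>j=0..N. g j x))"
    using \<theta> by (intro mult_left_mono) auto
  then have "ennreal (\<theta> powr p * \<theta> * (V N - e)) \<le> ennreal (LINT x|\<mu>. \<theta> powr p * \<theta> * (\<Sum>j=0..N. g j x))"
    by (intro ennreal_leI) simp
  also have "\<dots> \<le> (\<integral>\<^sup>+x. ennreal (\<theta> powr p * \<theta> * (\<Sum>j=0..N. g j x)) \<partial>\<mu>)"
    using g_int by (intro ennreal_integral_le_nn_integral) auto
  also have "\<dots> \<le> (\<integral>\<^sup>+x. (\<Sum>n. ennreal (\<beta> n x * real_cond_exp \<mu> (Fn n) f x powr p)) \<partial>\<mu>)"
  proof (rule nn_integral_mono_AE)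
    have "AE x in \<mu>. \<forall>j\<in>{0..N}. \<theta> powr p * \<theta> * g j x \<le> \<beta> (\<nu> j) x * real_cond_exp \<mu> (Fn (\<nu> j)) f x powr p"
      using g_le by (intro AE_finite_allI) auto
    then show "AE x in \<mu>. ennreal (\<theta> powr p * \<theta> * (\<Sum>j=0..N. g j x)) \<le> (\<Sum>n. ennreal (\<beta> n x * real_cond_exp \<mu> (Fn n) f x powr p))"
      using AE_space
    proof eventually_elim
      case (elim x)
      have nn: "0 \<le> \<beta> n x" for n using \<beta>(1) elim by (auto simp: carleson_seq_def)
      have "ennreal (\<theta> powr p * \<theta> * (\<Sum>j=0..N. g j x)) \<le> ennreal (\<Sum>j=0..N. \<beta> (\<nu> j) x * real_cond_exp \<mu> (Fn (\<nu> j)) f x powr p)"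
        unfolding sum_distrib_left using elim by (intro ennreal_leI sum_mono) auto
      also have "\<dots> = (\<Sum>j=0..N. ennreal (\<beta> (\<nu> j) x * real_cond_exp \<mu> (Fn (\<nu> j)) f x powr p))"
        using nn by (intro sum_ennreal[symmetric]) auto
      also have "\<dots> \<le> (\<Sum>n. ennreal (\<beta> n x * real_cond_exp \<mu> (Fn n) f x powr p))"
        by (rule sum_inj_le_suminf[OF strict_mono_imp_inj_on[OF \<nu>(2)]])
      finally show ?case .
    qed
  qed
  finally show ?thesis using sup unfolding \<theta>_def by (rule order_trans)
qed

end

section \<open>Equality for infinitely refining filtrations\<close>

text \<open>Strictness identifies the equality case of Jensen's inequality. It comes from the mean
  value theorem and the strictly increasing derivative; \<open>x = 0\<close> is computed
  directly.\<close>

lemma powr_above_tangent_strict: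
  fixes p x m :: real
  assumes "p > 1" "x \<ge> 0" "m > 0" "x \<noteq> m"
  shows "m powr p + p * m powr (p - 1) * (x - m) < x powr p"
proof (cases "x = 0")
  case True
  have "m powr (p - 1) * m = m powr p" using assms by (simp add: powr_diff)
  then have "m powr p + p * m powr (p - 1) * (x - m) = (1 - p) * m powr p"
    using True by (simp add: algebra_simps)
  also have "\<dots> < 0" using assms by (intro mult_neg_pos) auto
  finally show ?thesis using True by simp
next
  case False
  then have x: "0 < x" using assms by simp
  have der: "((\<lambda>x. x powr p) has_real_derivative p * z powr (p - 1)) (at z)" if "z > 0" for z
    using that by (auto intro!: derivative_eq_intros)
  consider "m < x" | "x < m" using assms by linarith
  then show ?thesis
  proof cases
    case 1
    then obtain z where z: "m < z" "z < x" "x powr p - m powr p = (x - m) * (p * z powr (p - 1))"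
      using MVT2[of m x "\<lambda>x. x powr p" "\<lambda>z. p * z powr (p - 1)"] der assms by auto
    have "p * m powr (p - 1) < p * z powr (p - 1)"
      using z assms by (simp add: powr_less_mono2)
    then have "(x - m) * (p * m powr (p - 1)) < (x - m) * (p * z powr (p - 1))"
      by (rule mult_strict_left_mono) (use 1 in simp)
    then show ?thesis using z(3) by (simp add: mult.commute)
  next
    case 2
    then obtain z where z: "x < z" "z < m" "m powr p - x powr p = (m - x) * (p * z powr (p - 1))"
      using MVT2[of x m "\<lambda>x. x powr p" "\<lambda>z. p * z powr (p - 1)"] der x by auto
    have "p * z powr (p - 1) < p * m powr (p - 1)"
      using z assms x by (simp add: powr_less_mono2)
    then have "(m - x) * (p * z powr (p - 1)) < (m - x) * (p * m powr (p - 1))"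
      by (rule mult_strict_left_mono) (use 2 in simp)
    then show ?thesis using z(3) by (simp add: algebra_simps)
  qed
qed

text \<open>The gap \<open>g\<close> between the p-th power of \<open>f\<close> and its tangent at
  \<open>ff\<close> is non-negative with integral \<open>F - ff powr p = 0\<close>. So it vanishes
  almost everywhere, and it vanishes only where \<open>f\<close> equals \<open>ff\<close>.\<close>

lemma dyadic_admissible_extremal_AE:
  assumes adm: "dyadic_admissible p F ff M C f \<alpha>" and p: "p > 1" and ff: "0 < ff" "F = ff powr p"
  shows "AE x in lborel. x \<in> dyad 0 0 \<longrightarrow> f x = ff"
proof -
  note A = adm[unfolded dyadic_admissible_def]
  note I = dyadic_admissible_integrable[OF adm p, of 0 0, simplified]
  have [measurable]: "f \<in> borel_measurable borel" using A by simp
  define d where "d = p * ff powr (p - 1)"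
  define g where "g x = f x powr p + ((- d) * f x + (d * ff - ff powr p))" for x
  have c: "set_integrable lborel (dyad 0 0) (\<lambda>x. k)" for k :: real
    by (auto simp: set_integrable_def emeasure_dyad)
  have i1: "set_integrable lborel (dyad 0 0) (\<lambda>x. (- d) * f x)" using I by (intro set_integrable_mult_right) auto
  have i2: "set_integrable lborel (dyad 0 0) (\<lambda>x. (- d) * f x + (d * ff - ff powr p))"
    by (rule set_integral_add(1)[OF i1 c])
  have gi: "set_integrable lborel (dyad 0 0) g" unfolding g_def by (rule set_integral_add(1)[OF I(2) i2])
  have "(LINT x:dyad 0 0|lborel. g x) = F + ((- d) * ff + (d * ff - ff powr p))"
  proof -
    have "(LINT x:dyad 0 0|lborel. (- d) * f x) = (- d) * (LINT x:dyad 0 0|lborel. f x)"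
      by (rule set_integral_mult_right)
    then show ?thesis
      unfolding g_def set_integral_add(2)[OF I(2) i2] set_integral_add(2)[OF i1 c]
      using A by (simp only: avg_def) (simp add: set_integral_const emeasure_dyad)
  qed
  then have z: "(LINT x|lborel. indicator (dyad 0 0) x *\<^sub>R g x) = 0" using ff by (simp add: set_lebesgue_integral_def)
  have nn: "0 \<le> g x" and eq: "g x = 0 \<Longrightarrow> f x = ff" if "x \<in> dyad 0 0" for x
    using powr_above_tangent[OF p, of "f x" ff] powr_above_tangent_strict[OF p, of "f x" ff] A that ff
    by (force simp: g_def d_def algebra_simps)+
  have "AE x in lborel. indicator (dyad 0 0) x *\<^sub>R g x = 0"
    using gi nn z unfolding set_integrable_def
    by (subst integral_nonneg_eq_0_iff_AE[symmetric]) (auto simp: indicator_def)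
  then show ?thesis by eventually_elim (use eq in auto)
qed

section \<open>Averages and partial sums of truncated dyadic trees\<close>

lemma descendant_avg_cong:
  assumes "\<And>m. m < 2 ^ i \<Longrightarrow> \<phi> (k * 2 ^ i + m) = \<psi> (k * 2 ^ i + m)"
  shows "descendant_avg i \<phi> k = descendant_avg i \<psi> k"
  unfolding descendant_avg_def using assms by simp

lemma avg_dyad_split:
  assumes "set_integrable lborel (dyad (Suc j) (2 * k)) g" "set_integrable lborel (dyad (Suc j) (2 * k + 1)) g"
  shows "(avg g (dyad (Suc j) (2 * k)) + avg g (dyad (Suc j) (2 * k + 1))) / 2 = avg g (dyad j k)"
proof -
  have e: "real (2 * k) / 2 ^ Suc j = real k / 2 ^ j" "(real (2 * k + 1) + 1) / 2 ^ Suc j = (real k + 1) / 2 ^ j"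
    "(real (2 * k) + 1) / 2 ^ Suc j = real (2 * k + 1) / 2 ^ Suc j"
    by (simp_all add: field_simps)
  have le: "real k / 2 ^ j \<le> real (2 * k + 1) / 2 ^ Suc j" "real (2 * k + 1) / 2 ^ Suc j \<le> (real k + 1) / 2 ^ j"
    by (simp_all add: field_simps)
  have un: "dyad j k = dyad (Suc j) (2 * k) \<union> dyad (Suc j) (2 * k + 1)"
    unfolding dyad_def e using le by (simp add: ivl_disj_un)
  have dis: "dyad (Suc j) (2 * k) \<inter> dyad (Suc j) (2 * k + 1) = {}"
    unfolding dyad_def e by auto
  have "(LINT x:dyad j k|lborel. g x) = (LINT x:dyad (Suc j) (2 * k)|lborel. g x) + (LINT x:dyad (Suc j) (2 * k + 1)|lborel. g x)"
    unfolding un by (rule set_integral_Un[OF dis assms])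
  then show ?thesis unfolding avg_def measure_dyad by (simp add: field_simps)
qed

lemma descendant_avg_dyad:
  assumes "\<And>j k. k < 2 ^ j \<Longrightarrow> set_integrable lborel (dyad j k) g" "k < 2 ^ j"
  shows "descendant_avg i (\<lambda>k. avg g (dyad (j + i) k)) k = avg g (dyad j k)"
proof (induction i)
  case 0
  then show ?case by simp
next
  case (Suc i)
  have "descendant_avg (Suc i) (\<lambda>k. avg g (dyad (j + Suc i) k)) k
    = descendant_avg i (\<lambda>k. (avg g (dyad (Suc (j + i)) (2 * k)) + avg g (dyad (Suc (j + i)) (2 * k + 1))) / 2) k"
    by (simp add: descendant_avg_Suc)
  also have "\<dots> = descendant_avg i (\<lambda>k. avg g (dyad (j + i) k)) k"
  proof (rule descendant_avg_cong, rule avg_dyad_split)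
    fix m :: nat assume "m < 2 ^ i"
    then have "k * 2 ^ i + m < 2 ^ (j + i)" by (rule descendant_less[OF assms(2)])
    then show "set_integrable lborel (dyad (Suc (j + i)) (2 * (k * 2 ^ i + m))) g"
      "set_integrable lborel (dyad (Suc (j + i)) (2 * (k * 2 ^ i + m) + 1)) g"
      by (auto intro!: assms(1))
  qed
  finally show ?case using Suc by simp
qed

lemma ennreal_sum_sum:
  fixes u :: "nat \<Rightarrow> nat \<Rightarrow> real"
  assumes "\<And>i m. m < 2 ^ i \<Longrightarrow> 0 \<le> u i m"
  shows "ennreal (\<Sum>i=0..n. \<Sum>m<2^i. u i m) = (\<Sum>i=0..n. \<Sum>m<2^i. ennreal (u i m))"
proof -
  have "(\<Sum>i=0..n. \<Sum>m<2^i. ennreal (u i m)) = (\<Sum>i=0..n. ennreal (\<Sum>m<2^i. u i m))"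
    using assms by (intro sum.cong refl sum_ennreal) auto
  also have "\<dots> = ennreal (\<Sum>i=0..n. \<Sum>m<2^i. u i m)"
    using assms by (intro sum_ennreal sum_nonneg) auto
  finally show ?thesis by simp
qed

lemma finite_le_of_suminf_le:
  fixes u :: "nat \<Rightarrow> nat \<Rightarrow> real"
  assumes "(\<Sum>i. \<Sum>m<2^i. ennreal (u i m)) \<le> ennreal B" "0 \<le> B" "\<And>i m. m < 2 ^ i \<Longrightarrow> 0 \<le> u i m"
  shows "(\<Sum>i=0..n. \<Sum>m<2^i. u i m) \<le> B"
proof -
  have "ennreal (\<Sum>i=0..n. \<Sum>m<2^i. u i m) = (\<Sum>i=0..n. \<Sum>m<2^i. ennreal (u i m))"
    using assms(3) by (rule ennreal_sum_sum)
  also have "\<dots> \<le> (\<Sum>i. \<Sum>m<2^i. ennreal (u i m))" by (rule sum_le_suminf) (auto intro: summableI)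
  also have "\<dots> \<le> ennreal B" by (rule assms(1))
  finally show ?thesis using assms(2) by simp
qed

section \<open>Boundary cases and the reverse inequality\<close>

context filtered_space
begin

text \<open>The constant function \<open>ff\<close> has all conditional expectations equal to
  \<open>ff\<close>, so its value depends on the sequence through the total mass alone. Completing
  the zero sequence supplies a Carleson sequence of mass \<open>M\<close>.\<close>

lemma extremal_le_mart_bellman:
  assumes p: "p > 1" and M: "0 \<le> M" "M \<le> C" and ff: "0 \<le> ff"
  shows "ennreal (ff powr p) * ennreal M \<le> mart_bellman \<mu> Fn p (ff powr p) ff M C"
proof -
  obtain \<beta> where \<beta>: "carleson_seq \<mu> Fn C \<beta>" "(\<integral>\<^sup>+x. (\<Sum>n. ennreal (\<beta> n x)) \<partial>\<mu>) = ennreal M"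
    by (rule ex_carleson_seq_above[of "\<lambda>j. j" M C "\<lambda>_ _. 0" 0 0])
      (use M in \<open>auto simp: strict_mono_def set_lebesgue_integral_def\<close>)
  have \<beta>_nn: "0 \<le> \<beta> n x" if "x \<in> space \<mu>" for n x using \<beta>(1) that by (auto simp: carleson_seq_def)
  have [measurable]: "\<beta> n \<in> borel_measurable \<mu>" for n
    using \<beta>(1) measurable_Fn by (auto simp: carleson_seq_def)
  have "mart_admissible \<mu> Fn p (ff powr p) ff M C (\<lambda>_. ff) \<beta>"
    unfolding mart_admissible_def using \<beta> ff by (simp add: prob_space)
  then have "(\<integral>\<^sup>+x. (\<Sum>n. ennreal (\<beta> n x * real_cond_exp \<mu> (Fn n) (\<lambda>_. ff) x powr p)) \<partial>\<mu>) \<le> mart_bellman \<mu> Fn p (ff powr p) ff M C"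
    unfolding mart_bellman_def by (intro Sup_upper) blast
  moreover have "(\<integral>\<^sup>+x. (\<Sum>n. ennreal (\<beta> n x * real_cond_exp \<mu> (Fn n) (\<lambda>_. ff) x powr p)) \<partial>\<mu>)
    = (\<integral>\<^sup>+x. ennreal (ff powr p) * (\<Sum>n. ennreal (\<beta> n x)) \<partial>\<mu>)"
  proof (rule nn_integral_cong_AE)
    have "AE x in \<mu>. \<forall>n. real_cond_exp \<mu> (Fn n) (\<lambda>_. ff) x = ff"
      unfolding AE_all_countable by (intro allI sigma_finite_subalgebra.real_cond_exp_F_meas[OF sigma_finite_Fn]) auto
    then show "AE x in \<mu>. (\<Sum>n. ennreal (\<beta> n x * real_cond_exp \<mu> (Fn n) (\<lambda>_. ff) x powr p)) = ennreal (ff powr p) * (\<Sum>n. ennreal (\<beta> n x))"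
      using AE_space
    proof eventually_elim
      case (elim x)
      then show ?case
        by (simp add: ennreal_mult \<beta>_nn mult.commute flip: ennreal_suminf_cmult)
    qed
  qed
  moreover have "\<dots> = ennreal (ff powr p) * ennreal M"
    using \<beta>(2) by (subst nn_integral_cmult) auto
  ultimately show ?thesis by simp
qed

text \<open>Transport has slack only if \<open>0 < ff\<close>, \<open>ff powr p < F\<close> and
  \<open>0 < M\<close>. Otherwise the dyadic value is explicit: all averages equal \<open>ff\<close>
  when \<open>ff = 0\<close> or \<open>F = ff powr p\<close>, and all coefficients vanish when
  \<open>M = 0\<close>.\<close>

lemma dyadic_value_le_mart_bellman:
  assumes refine: "infinitely_refining \<mu> Fn" and p: "p > 1" and C: "0 < C" and M: "0 \<le> M" "M \<le> C"
    and ff: "0 \<le> ff" "ff powr p \<le> F" and adm: "dyadic_admissible p F ff M C f \<alpha>"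
  shows "dyadic_value p f \<alpha> \<le> mart_bellman \<mu> Fn p F ff M C"
proof -
  note A = adm[unfolded dyadic_admissible_def]
  note I = dyadic_admissible_integrable[OF adm p]
  have f_nn: "0 \<le> f x" if "x \<in> dyad 0 0" for x using A that by blast
  have \<alpha>_nn: "0 \<le> \<alpha> j k" if "k < 2 ^ j" for j k using A that by blast
  have total: "(\<Sum>j. \<Sum>k<2^j. ennreal (\<alpha> j k)) = ennreal M" using A by simp
  have avg_nn: "0 \<le> avg f (dyad j k)" if "k < 2 ^ j" for j k
    using f_nn dyad_subset[OF that] by (intro avg_nonneg) auto
  have const: "dyadic_value p f \<alpha> \<le> mart_bellman \<mu> Fn p F ff M C"
    if eq: "\<And>j k. k < 2 ^ j \<Longrightarrow> avg f (dyad j k) = ff" and F: "ff = 0 \<or> F = ff powr p"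
  proof -
    have "dyadic_value p f \<alpha> = (\<Sum>j. ennreal (ff powr p) * (\<Sum>k<2^j. ennreal (\<alpha> j k)))"
      unfolding dyadic_value_def sum_distrib_left
      by (intro suminf_cong sum.cong refl) (simp add: eq ennreal_mult \<alpha>_nn mult.commute)
    also have "\<dots> = ennreal (ff powr p) * ennreal M" unfolding ennreal_suminf_cmult total ..
    finally show ?thesis
      using F extremal_le_mart_bellman[OF p M ff(1)] by auto
  qed
  consider "ff = 0" | "0 < ff" "F = ff powr p" | "M = 0" | "0 < ff" "ff powr p < F" "0 < M"
    using ff M by force
  then show ?thesis
  proof cases
    case 1
    have "avg f (dyad j k) = ff" if k: "k < 2 ^ j" for j k
    proof -
      have "(LINT x:dyad j k|lborel. f x) \<le> (LINT x:dyad 0 0|lborel. f x)"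
        using f_nn I(1)[of 0 0] I(1)[OF k] dyad_subset[OF k]
        unfolding set_lebesgue_integral_def set_integrable_def by (intro integral_mono) (auto simp: indicator_def)
      moreover have "(LINT x:dyad 0 0|lborel. f x) = 0" using A 1 by (simp add: avg_def)
      moreover have "0 \<le> (LINT x:dyad j k|lborel. f x)"
        unfolding set_lebesgue_integral_def using f_nn dyad_subset[OF k]
        by (intro integral_nonneg_AE) (auto simp: indicator_def)
      ultimately show ?thesis using 1 by (simp add: avg_def)
    qed
    then show ?thesis using 1 by (intro const) auto
  next
    case 2
    have "avg f (dyad j k) = ff" if k: "k < 2 ^ j" for j k
    proof -
      have [measurable]: "f \<in> borel_measurable borel" using A by simp
      have "(LINT x:dyad j k|lborel. f x) = (LINT x:dyad j k|lborel. ff)"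
        using dyadic_admissible_extremal_AE[OF adm p 2] dyad_subset[OF k]
        by (intro set_lebesgue_integral_cong_AE) auto
      then show ?thesis by (simp add: avg_def set_integral_const emeasure_dyad)
    qed
    then show ?thesis using 2 by (intro const) auto
  next
    case 3
    have "(\<Sum>k<2^j. ennreal (\<alpha> j k)) = 0" for j
      using total 3 by (simp add: suminf_eq_zero_iff)
    then have "\<alpha> j k = 0" if "k < 2 ^ j" for j k
      using that \<alpha>_nn[OF that] by (force simp: sum_nonneg_eq_0_iff ennreal_eq_0_iff intro: antisym)
    then show ?thesis by (simp add: dyadic_value_def)
  next
    case 4
    have partial: "(\<Sum>j=0..N. \<Sum>k<2^j. ennreal (\<alpha> j k * avg f (dyad j k) powr p)) \<le> mart_bellman \<mu> Fn p F ff M C" for N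
    proof -
      define c where "c k = (if k < 2 ^ N then avg f (dyad N k) else 0)" for k
      define a where "a j k = (if j \<le> N \<and> k < 2 ^ j then \<alpha> j k else 0)" for j k
      \<comment> \<open>A crude common bound: finitely many non-negative numbers are each at most
        their sum.\<close>
      define K where "K = (\<Sum>k<2^N. c k) + (\<Sum>j=0..N. \<Sum>k<2^j. 2 ^ j * a j k)"
      have c_nn: "0 \<le> c k" and a_nn: "0 \<le> a j k" for j k using avg_nn \<alpha>_nn by (auto simp: c_def a_def)
      have K_nn: "0 \<le> (\<Sum>k<2^N. c k)" "0 \<le> (\<Sum>j=0..N. \<Sum>k<2^j. 2 ^ j * a j k)"
        using c_nn a_nn by (auto intro!: sum_nonneg)
      have c_le: "c k \<le> K" for k
      proof (cases "k < 2 ^ N")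
        case True
        then have "c k \<le> (\<Sum>k<2^N. c k)" using c_nn by (intro member_le_sum) auto
        then show ?thesis using K_nn by (simp add: K_def)
      next
        case False
        then have "c k = 0" by (simp add: c_def)
        then show ?thesis using K_nn by (simp add: K_def)
      qed
      have a_le: "2 ^ j * a j k \<le> K" for j k
      proof (cases "j \<le> N \<and> k < 2 ^ j")
        case True
        then have "2 ^ j * a j k \<le> (\<Sum>k<2^j. 2 ^ j * a j k)" using a_nn by (intro member_le_sum) auto
        also have "\<dots> \<le> (\<Sum>j=0..N. \<Sum>k<2^j. 2 ^ j * a j k)"
          using a_nn True by (intro member_le_sum[of j "{0..N}" "\<lambda>j. \<Sum>k<2^j. 2 ^ j * a j k"]) (auto intro!: sum_nonneg)
        finally show ?thesis using K_nn by (simp add: K_def)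
      next
        case False
        then have "2 ^ j * a j k = 0" by (auto simp: a_def)
        then show ?thesis using K_nn by (simp add: K_def)
      qed
      have avg_c: "descendant_avg (N - j) c k = avg f (dyad j k)" if "j \<le> N" "k < 2 ^ j" for j k
      proof -
        have "descendant_avg (N - j) c k = descendant_avg (N - j) (\<lambda>k. avg f (dyad (j + (N - j)) k)) k"
          using that descendant_less[OF that(2), of _ "N - j"] by (intro descendant_avg_cong) (simp add: c_def)
        also have "\<dots> = avg f (dyad j k)" by (rule descendant_avg_dyad[OF I(1) that(2)])
        finally show ?thesis .
      qed
      have car: "(\<Sum>i=j..N. \<Sum>m<2^(i - j). a i (k * 2 ^ (i - j) + m)) \<le> C / 2 ^ j" if j: "j \<le> N" and k: "k < 2 ^ j" for j k
      proof -
        have "(\<Sum>i=j..N. \<Sum>m<2^(i - j). a i (k * 2 ^ (i - j) + m)) = (\<Sum>i=0..N - j. \<Sum>m<2^i. a (j + i) (k * 2 ^ i + m))"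
          by (rule sum.reindex_bij_witness[of _ "\<lambda>i. j + i" "\<lambda>i. i - j"]) (use j in auto)
        also have "\<dots> = (\<Sum>i=0..N - j. \<Sum>m<2^i. \<alpha> (j + i) (k * 2 ^ i + m))"
          using descendant_less[OF k] j by (intro sum.cong refl) (auto simp: a_def)
        also have "\<dots> \<le> C / 2 ^ j"
          using A k C \<alpha>_nn descendant_less[OF k] by (intro finite_le_of_suminf_le) auto
        finally show ?thesis .
      qed
      have "(\<Sum>i=0..N. \<Sum>m<2^i. a i m) = (\<Sum>i=0..N. \<Sum>m<2^i. \<alpha> i m)" by (simp add: a_def)
      also have "\<dots> \<le> M" using total M \<alpha>_nn by (intro finite_le_of_suminf_le) auto
      finally have tot: "(\<Sum>i=0..N. \<Sum>m<2^i. a i m) \<le> M" .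
      have mean: "descendant_avg N c 0 = ff" using avg_c[of 0 0] A by simp
      \<comment> \<open>Jensen on each interval of generation \<open>N\<close>; averaging may
        strictly lower the p-th moment, so only an inequality is available.\<close>
      have pmean: "descendant_avg N (\<lambda>k. c k powr p) 0 \<le> F"
      proof -
        have "avg f (dyad N k) powr p \<le> avg (\<lambda>x. f x powr p) (dyad N k)" if k: "k < 2 ^ N" for k
        proof -
          have "measure lborel (dyad N k) * ((LINT x:dyad N k|lborel. f x) / measure lborel (dyad N k)) powr p \<le> (LINT x:dyad N k|lborel. f x powr p)"
            using f_nn dyad_subset[OF k] I[OF k] by (intro set_integral_powr_ge[OF p]) (auto simp: emeasure_dyad)
          then show ?thesis by (simp add: avg_def field_simps)
        qed
        then have "descendant_avg N (\<lambda>k. c k powr p) 0 \<le> descendant_avg N (\<lambda>k. avg (\<lambda>x. f x powr p) (dyad (0 + N) k)) 0"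
          unfolding descendant_avg_def by (intro divide_right_mono sum_mono) (auto simp: c_def)
        also have "\<dots> = avg (\<lambda>x. f x powr p) (dyad 0 0)" by (rule descendant_avg_dyad[OF I(2)]) auto
        finally show ?thesis using A by simp
      qed
      define V where "V = (\<Sum>j=0..N. \<Sum>k<2^j. a j k * descendant_avg (N - j) c k powr p)"
      have V_nn: "0 \<le> V" unfolding V_def using a_nn by (intro sum_nonneg) auto
      have bound: "ennreal ((1 - \<delta>) powr p * (1 - \<delta>) * (V - e)) \<le> mart_bellman \<mu> Fn p F ff M C"
        if "0 < \<delta>" "\<delta> < 1" "0 < e" for \<delta> e
        unfolding V_def
        by (rule finite_tree_le_mart_bellman[OF refine p C 4(3) M(2) 4(1,2) c_nn c_le a_nn a_le car tot mean pmean that])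
      have "ennreal V \<le> mart_bellman \<mu> Fn p F ff M C"
      proof (cases "V = 0")
        case False
        then have V: "0 < V" using V_nn by simp
        show ?thesis
        proof (rule ennreal_le_mult_one_interval)
          fix z :: real assume z: "0 < z" "z < 1"
          \<comment> \<open>The permitted loss \<open>z\<close> is split into two equal factors
            \<open>s\<close>: one is the scaling loss, by choosing \<open>t\<close> with
            \<open>t powr (p + 1) = s\<close>, the other comes from
            \<open>e = (1 - s) * V\<close>.\<close>
          define s where "s = sqrt z"
          have s: "0 < s" "s < 1" "s * s = z" using z by (auto simp: s_def)
          define t where "t = s powr (1 / (p + 1))"
          have t: "0 < t" "t < 1" using s p powr_less_mono2[of "1 / (p + 1)" s 1] by (auto simp: t_def)
          have "t powr p * t = t powr (p + 1)" using t by (simp add: powr_add)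
          also have "\<dots> = s" using s p by (simp add: t_def powr_powr)
          finally have "t powr p * t * (V - (1 - s) * V) = z * V" using s(3) by (simp add: algebra_simps)
          moreover have "ennreal (t powr p * t * (V - (1 - s) * V)) \<le> mart_bellman \<mu> Fn p F ff M C"
            using bound[of "1 - t" "(1 - s) * V"] t s V by simp
          ultimately show "ennreal z * ennreal V \<le> mart_bellman \<mu> Fn p F ff M C"
            using z V by (simp add: ennreal_mult)
        qed
      qed simp
      moreover have "(\<Sum>j=0..N. \<Sum>k<2^j. ennreal (\<alpha> j k * avg f (dyad j k) powr p)) = ennreal V"
      proof -
        have "V = (\<Sum>j=0..N. \<Sum>k<2^j. \<alpha> j k * avg f (dyad j k) powr p)"
          unfolding V_def by (intro sum.cong refl) (auto simp: a_def avg_c)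
        then show ?thesis using \<alpha>_nn by (simp only:) (subst ennreal_sum_sum; simp)
      qed
      ultimately show ?thesis by simp
    qed
    show ?thesis
      unfolding dyadic_value_def
    proof (rule suminf_le_const[OF summableI])
      fix n
      have "(\<Sum>j<n. \<Sum>k<2^j. ennreal (\<alpha> j k * avg f (dyad j k) powr p)) \<le> (\<Sum>j=0..n. \<Sum>k<2^j. ennreal (\<alpha> j k * avg f (dyad j k) powr p))"
        by (intro sum_mono2) auto
      then show "(\<Sum>j<n. \<Sum>k<2^j. ennreal (\<alpha> j k * avg f (dyad j k) powr p)) \<le> mart_bellman \<mu> Fn p F ff M C"
        using partial[of n] by (rule order_trans)
    qed
  qed
qed

lemma dyadic_bellman_le:
  assumes "infinitely_refining \<mu> Fn" "p > 1" "0 < C" "0 \<le> M" "M \<le> C" "0 \<le> ff" "ff powr p \<le> F"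
  shows "dyadic_bellman p F ff M C \<le> mart_bellman \<mu> Fn p F ff M C"
  unfolding dyadic_bellman_eq using dyadic_value_le_mart_bellman[OF assms] by (auto intro!: SUP_least)

end

theorem theoremA:
  fixes \<mu> :: "'a measure" and Fn :: "nat \<Rightarrow> 'a measure"
    and p C :: real
  assumes "p > 1" and "C > 0"
    and "filtered_prob_space \<mu> Fn"
  shows "(\<forall>F ff M. 0 \<le> ff \<and> ff powr p \<le> F \<and> 0 \<le> M \<and> M \<le> C \<longrightarrow>
            mart_bellman \<mu> Fn p F ff M C \<le> dyadic_bellman p F ff M C)
       \<and> (infinitely_refining \<mu> Fn \<longrightarrow>
            (\<forall>F ff M. 0 \<le> ff \<and> ff powr p \<le> F \<and> 0 \<le> M \<and> M \<le> C \<longrightarrow>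
               mart_bellman \<mu> Fn p F ff M C = dyadic_bellman p F ff M C))"
proof -
  interpret filtered_space \<mu> Fn by unfold_locales (rule assms(3))
  show ?thesis
    using mart_bellman_le[OF assms(1,2)] dyadic_bellman_le[OF _ assms(1,2)]
    by (intro conjI allI impI antisym) auto
qed

end
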